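(* Let $A$ be a finite alphabet and $L\subseteq A^*$. Then $L$ is definable in $\mathrm{FO}^2[{<},\mathrm{MOD}]$ if and only if $L$ is definable in $\Delta_2[{<},\mathrm{MOD}]$.
   Context: First-order formulas are interpreted over the positions $1,\dots,|w|$ of a word $w\in A^*$. Atomic formulas: $\top$, $\bot$, $\lambda(x)=a$ (position $x$ has label $a$), $x=y$, $x<y$, $\mathrm{MOD}^n_i(x)$ (position $x$ is congruent to $i$ modulo $n$), and the $0$-ary $\mathrm{LEN}^n_i$ (the length of the word is congruent to $i$ modulo $n$), for all $n\ge 1$ and integers $i$. $L\subseteq A^*$ is definable in a class of formulas if $L=\{u\in A^* : u\models\varphi\}$ for some sentence $\varphi$ in the class. $\mathrm{FO}^2[{<},\mathrm{MOD}]$ is the set of all first-order formulas (all Boolean connectives and quantifiers allowed) over these atomic formulas which use only two variables, say $x$ and $y$ (which may be requantified). $\Sigma_2[{<},\mathrm{MOD}]$ is the set of all negation-free formulas (built from atomic formulas using $\wedge,\vee,\exists,\forall$) without an existential quantifier in the scope of a universal quantifier. $\Pi_2[{<},\mathrm{MOD}]$ is the set of all negation-free formulas without a universal quantifier in the scope of an existential quantifier. A language is definable in $\Delta_2[{<},\mathrm{MOD}]$ if it is definable both in $\Sigma_2[{<},\mathrm{MOD}]$ and in $\Pi_2[{<},\mathrm{MOD}]$. *)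

theory Defs
  imports "HOL-Number_Theory.Cong"
begin

type_synonym var = nat

datatype 'a fm =
    Top
  | Bot
  | Lab var 'a
  | Eq var var
  | Less var var
  | Mod nat int var    \<comment> \<open>\<open>Mod n i x\<close>: position \<open>x\<close> is congruent to \<open>i\<close> modulo \<open>n\<close>\<close>
  | Len nat int        \<comment> \<open>\<open>Len n i\<close>: the length of the word is congruent to \<open>i\<close> modulo \<open>n\<close>\<close>
  | Neg "'a fm"
  | Conj "'a fm" "'a fm"
  | Disj "'a fm" "'a fm"
  | Ex var "'a fm"
  | All var "'a fm"

text \<open>
  Positions of a word \<open>w\<close> are \<open>1, \<dots>, length w\<close>, whereas list indexing starts at 0;
  position \<open>p\<close> therefore carries the letter \<open>w ! (p - 1)\<close>.
\<close>

primrec sat :: "'a list \<Rightarrow> (var \<Rightarrow> nat) \<Rightarrow> 'a fm \<Rightarrow> bool" where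
  "sat w v Top \<longleftrightarrow> True"
| "sat w v Bot \<longleftrightarrow> False"
| "sat w v (Lab x a) \<longleftrightarrow> w ! (v x - 1) = a"
| "sat w v (Eq x y) \<longleftrightarrow> v x = v y"
| "sat w v (Less x y) \<longleftrightarrow> v x < v y"
| "sat w v (Mod n i x) \<longleftrightarrow> [int (v x) = i] (mod int n)"
| "sat w v (Len n i) \<longleftrightarrow> [int (length w) = i] (mod int n)"
| "sat w v (Neg \<phi>) \<longleftrightarrow> \<not> sat w v \<phi>"
| "sat w v (Conj \<phi> \<psi>) \<longleftrightarrow> sat w v \<phi> \<and> sat w v \<psi>"
| "sat w v (Disj \<phi> \<psi>) \<longleftrightarrow> sat w v \<phi> \<or> sat w v \<psi>"
| "sat w v (Ex x \<phi>) \<longleftrightarrow> (\<exists>p\<in>{1..length w}. sat w (v(x := p)) \<phi>)"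
| "sat w v (All x \<phi>) \<longleftrightarrow> (\<forall>p\<in>{1..length w}. sat w (v(x := p)) \<phi>)"

primrec vars :: "'a fm \<Rightarrow> var set" where
  "vars Top = {}"
| "vars Bot = {}"
| "vars (Lab x a) = {x}"
| "vars (Eq x y) = {x, y}"
| "vars (Less x y) = {x, y}"
| "vars (Mod n i x) = {x}"
| "vars (Len n i) = {}"
| "vars (Neg \<phi>) = vars \<phi>"
| "vars (Conj \<phi> \<psi>) = vars \<phi> \<union> vars \<psi>"
| "vars (Disj \<phi> \<psi>) = vars \<phi> \<union> vars \<psi>"
| "vars (Ex x \<phi>) = insert x (vars \<phi>)"
| "vars (All x \<phi>) = insert x (vars \<phi>)"

primrec free_vars :: "'a fm \<Rightarrow> var set" where
  "free_vars Top = {}"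
| "free_vars Bot = {}"
| "free_vars (Lab x a) = {x}"
| "free_vars (Eq x y) = {x, y}"
| "free_vars (Less x y) = {x, y}"
| "free_vars (Mod n i x) = {x}"
| "free_vars (Len n i) = {}"
| "free_vars (Neg \<phi>) = free_vars \<phi>"
| "free_vars (Conj \<phi> \<psi>) = free_vars \<phi> \<union> free_vars \<psi>"
| "free_vars (Disj \<phi> \<psi>) = free_vars \<phi> \<union> free_vars \<psi>"
| "free_vars (Ex x \<phi>) = free_vars \<phi> - {x}"
| "free_vars (All x \<phi>) = free_vars \<phi> - {x}"

abbreviation sentence :: "'a fm \<Rightarrow> bool" where
  "sentence \<phi> \<equiv> free_vars \<phi> = {}"

lemma sat_cong: "(\<And>x. x \<in> free_vars \<phi> \<Longrightarrow> v x = v' x) \<Longrightarrow> sat w v \<phi> \<longleftrightarrow> sat w v' \<phi>"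
proof (induction \<phi> arbitrary: v v')
  case (Ex x \<phi>)
  have "sat w (v(x := p)) \<phi> \<longleftrightarrow> sat w (v'(x := p)) \<phi>" for p
    by (rule Ex.IH) (use Ex.prems in auto)
  then show ?case by simp
next
  case (All x \<phi>)
  have "sat w (v(x := p)) \<phi> \<longleftrightarrow> sat w (v'(x := p)) \<phi>" for p
    by (rule All.IH) (use All.prems in auto)
  then show ?case by simp
next
  case (Neg \<phi>)
  have "sat w v \<phi> \<longleftrightarrow> sat w v' \<phi>"
    by (rule Neg.IH) (use Neg.prems in auto)
  then show ?case by simp
next
  case (Conj \<phi> \<psi>)
  have "sat w v \<phi> \<longleftrightarrow> sat w v' \<phi>"
    by (rule Conj.IH(1)) (use Conj.prems in auto)
  moreover have "sat w v \<psi> \<longleftrightarrow> sat w v' \<psi>"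
    by (rule Conj.IH(2)) (use Conj.prems in auto)
  ultimately show ?case by simp
next
  case (Disj \<phi> \<psi>)
  have "sat w v \<phi> \<longleftrightarrow> sat w v' \<phi>"
    by (rule Disj.IH(1)) (use Disj.prems in auto)
  moreover have "sat w v \<psi> \<longleftrightarrow> sat w v' \<psi>"
    by (rule Disj.IH(2)) (use Disj.prems in auto)
  ultimately show ?case by simp
qed simp_all

definition models :: "'a list \<Rightarrow> 'a fm \<Rightarrow> bool" where
  "models w \<phi> \<longleftrightarrow> (\<forall>v. sat w v \<phi>)"

lemma models_sentence: "sentence \<phi> \<Longrightarrow> models w \<phi> \<longleftrightarrow> sat w v \<phi>"
  unfolding models_def using sat_cong[of \<phi>] by (metis empty_iff)

text \<open>
  Formulas over the alphabet \<open>A\<close>. The condition \<open>n \<ge> 1\<close> matters: congruence modulo 0 is equality.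
\<close>

primrec formula_over :: "'a set \<Rightarrow> 'a fm \<Rightarrow> bool" where
  "formula_over A Top \<longleftrightarrow> True"
| "formula_over A Bot \<longleftrightarrow> True"
| "formula_over A (Lab x a) \<longleftrightarrow> a \<in> A"
| "formula_over A (Eq x y) \<longleftrightarrow> True"
| "formula_over A (Less x y) \<longleftrightarrow> True"
| "formula_over A (Mod n i x) \<longleftrightarrow> n \<ge> 1"
| "formula_over A (Len n i) \<longleftrightarrow> n \<ge> 1"
| "formula_over A (Neg \<phi>) \<longleftrightarrow> formula_over A \<phi>"
| "formula_over A (Conj \<phi> \<psi>) \<longleftrightarrow> formula_over A \<phi> \<and> formula_over A \<psi>"
| "formula_over A (Disj \<phi> \<psi>) \<longleftrightarrow> formula_over A \<phi> \<and> formula_over A \<psi>"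
| "formula_over A (Ex x \<phi>) \<longleftrightarrow> formula_over A \<phi>"
| "formula_over A (All x \<phi>) \<longleftrightarrow> formula_over A \<phi>"

primrec negation_free :: "'a fm \<Rightarrow> bool" where
  "negation_free Top \<longleftrightarrow> True"
| "negation_free Bot \<longleftrightarrow> True"
| "negation_free (Lab x a) \<longleftrightarrow> True"
| "negation_free (Eq x y) \<longleftrightarrow> True"
| "negation_free (Less x y) \<longleftrightarrow> True"
| "negation_free (Mod n i x) \<longleftrightarrow> True"
| "negation_free (Len n i) \<longleftrightarrow> True"
| "negation_free (Neg \<phi>) \<longleftrightarrow> False"
| "negation_free (Conj \<phi> \<psi>) \<longleftrightarrow> negation_free \<phi> \<and> negation_free \<psi>"
| "negation_free (Disj \<phi> \<psi>) \<longleftrightarrow> negation_free \<phi> \<and> negation_free \<psi>"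
| "negation_free (Ex x \<phi>) \<longleftrightarrow> negation_free \<phi>"
| "negation_free (All x \<phi>) \<longleftrightarrow> negation_free \<phi>"

primrec subformulas :: "'a fm \<Rightarrow> 'a fm set" where
  "subformulas Top = {Top}"
| "subformulas Bot = {Bot}"
| "subformulas (Lab x a) = {Lab x a}"
| "subformulas (Eq x y) = {Eq x y}"
| "subformulas (Less x y) = {Less x y}"
| "subformulas (Mod n i x) = {Mod n i x}"
| "subformulas (Len n i) = {Len n i}"
| "subformulas (Neg \<phi>) = insert (Neg \<phi>) (subformulas \<phi>)"
| "subformulas (Conj \<phi> \<psi>) = insert (Conj \<phi> \<psi>) (subformulas \<phi> \<union> subformulas \<psi>)"
| "subformulas (Disj \<phi> \<psi>) = insert (Disj \<phi> \<psi>) (subformulas \<phi> \<union> subformulas \<psi>)"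
| "subformulas (Ex x \<phi>) = insert (Ex x \<phi>) (subformulas \<phi>)"
| "subformulas (All x \<phi>) = insert (All x \<phi>) (subformulas \<phi>)"

text \<open>The two variables of \<open>FO\<^sup>2\<close> are 0 and 1; both may be requantified.\<close>

definition FO2_less_MOD :: "'a set \<Rightarrow> 'a fm set" where
  "FO2_less_MOD A = {\<phi>. formula_over A \<phi> \<and> vars \<phi> \<subseteq> {0, 1}}"

definition Sigma2_less_MOD :: "'a set \<Rightarrow> 'a fm set" where
  "Sigma2_less_MOD A = {\<phi>. formula_over A \<phi> \<and> negation_free \<phi> \<and>
     (\<forall>x \<psi> y \<chi>. All x \<psi> \<in> subformulas \<phi> \<longrightarrow> Ex y \<chi> \<notin> subformulas \<psi>)}"

definition Pi2_less_MOD :: "'a set \<Rightarrow> 'a fm set" where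
  "Pi2_less_MOD A = {\<phi>. formula_over A \<phi> \<and> negation_free \<phi> \<and>
     (\<forall>x \<psi> y \<chi>. Ex x \<psi> \<in> subformulas \<phi> \<longrightarrow> All y \<chi> \<notin> subformulas \<psi>)}"

definition definable_in :: "'a set \<Rightarrow> 'a fm set \<Rightarrow> 'a list set \<Rightarrow> bool" where
  "definable_in A F L \<longleftrightarrow> (\<exists>\<phi>\<in>F. sentence \<phi> \<and> L = {u \<in> lists A. models u \<phi>})"

definition Delta2_less_MOD_definable :: "'a set \<Rightarrow> 'a list set \<Rightarrow> bool" where
  "Delta2_less_MOD_definable A L \<longleftrightarrow>
     definable_in A (Sigma2_less_MOD A) L \<and> definable_in A (Pi2_less_MOD A) L"

end

theory Submission
  imports Defs
begin

text \<open>
  Colour every position by its residue modulo a common modulus \<open>n\<close>. Both properties are equivalent to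
  being saturated, for fixed length modulo \<open>n\<close>, under agreement on the order of all short rankers
  (instructions ``next or previous letter \<open>b\<close>'') of the coloured word.
  An \<open>FO\<^sup>2\<close> formula cannot separate words on which short rankers agree, since a new pebble can be
  answered by a ranker next to it, and the order of two rankers is both \<open>FO\<^sup>2\<close> and \<open>\<Delta>\<^sub>2\<close> expressible.
  For the converse let \<open>u\<close> and \<open>v\<close> agree on rankers. Cutting at first occurrences of new letters and
  inducting on the number of letters, either they are matched piece by piece, or
  \<open>u \<sim> x u' y\<close> and \<open>v \<sim> x v' y\<close>, where \<open>x\<close> and \<open>y\<close> are products of many factors containing all the coloured
  letters involved. As such an \<open>x\<close> can be replaced by \<open>x z x\<close> in the \<open>\<Sigma>\<^sub>2\<close> preorder,
  \<open>x u' y t x v' y\<close> lies above both words, where \<open>t\<close> restores the colours. Hence no language that is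
  \<open>\<Sigma>\<^sub>2\<close> together with its complement separates \<open>u\<close> from \<open>v\<close>.
\<close>

section \<open>The \<open>\<Sigma>\<^sub>2\<close> game\<close>

text \<open>\<open>\<Sigma>\<^sub>2\<close> is not closed under negation, so its game yields only a
  preorder, and two words are compared through a third one above both. This third word must itself
  be the colouring of a word. Factors therefore cannot be combined at will: each is carried together
  with the residue at which it starts, and matched factors are kept equal in length modulo
  \<open>n\<close>. In algebraic terms a word with many blocks covering an alphabet \<open>C\<close>
  plays the part of an idempotent e, and inserting a word over \<open>C\<close> between two copies
  plays the part of the passage from e to e z e that characterizes \<open>\<Sigma>\<^sub>2\<close>
  among ordered monoids. Words are not idempotent, so blocks are counted instead: every round spends
  one block and may halve the rest, whence \<open>2 ^ (l + k) - 1\<close> blocks for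
  \<open>l + k\<close> rounds. The games recurse on plain factors because a pebble cuts a word into
  two parts that can be played independently; this makes the preorder compatible with
  concatenation.\<close>

text \<open>In \<open>le l k u w\<close>, Duplicator survives \<open>k\<close> rounds in which Spoiler plays in \<open>u\<close>, followed by
  \<open>l\<close> rounds in which Spoiler plays in \<open>w\<close> (the relation \<open>uni\<close>). Accordingly \<open>\<Sigma>\<^sub>2\<close> formulas are
  inherited from \<open>u\<close> by \<open>w\<close>.\<close>

primrec uni :: "nat \<Rightarrow> 'b list \<Rightarrow> 'b list \<Rightarrow> bool" where
  "uni 0 u w \<longleftrightarrow> True"
| "uni (Suc l) u w \<longleftrightarrow> (\<forall>w1 b w2. w = w1 @ b # w2 \<longrightarrow>
     (\<exists>u1 u2. u = u1 @ b # u2 \<and> uni l u1 w1 \<and> uni l u2 w2))"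

primrec le :: "nat \<Rightarrow> nat \<Rightarrow> 'b list \<Rightarrow> 'b list \<Rightarrow> bool" where
  "le l 0 u w \<longleftrightarrow> uni l u w"
| "le l (Suc k) u w \<longleftrightarrow> le l k u w \<and> (\<forall>u1 b u2. u = u1 @ b # u2 \<longrightarrow>
     (\<exists>w1 w2. w = w1 @ b # w2 \<and> le l k u1 w1 \<and> le l k u2 w2))"

lemma append_split_cases:
  assumes "u @ v = x @ b # y"
  obtains y' where "u = x @ b # y'" "y = y' @ v"
  | x' where "v = x' @ b # y" "x = u @ x'"
  using assms by (force simp: append_eq_append_conv2 append_eq_Cons_conv Cons_eq_append_conv)

lemma uni_SucE:
  assumes "uni (Suc l) u (w1 @ b # w2)"
  obtains u1 u2 where "u = u1 @ b # u2" "uni l u1 w1" "uni l u2 w2"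
  using assms unfolding uni.simps by blast

lemma uni_SucI:
  assumes "\<And>w1 b w2. w = w1 @ b # w2 \<Longrightarrow> \<exists>u1 u2. u = u1 @ b # u2 \<and> uni l u1 w1 \<and> uni l u2 w2"
  shows "uni (Suc l) u w"
  using assms unfolding uni.simps by blast

lemma uni_refl: "uni l u u"
  by (induction l arbitrary: u) (simp, rule uni_SucI, blast)

lemma uni_trans: "uni l u v \<Longrightarrow> uni l v w \<Longrightarrow> uni l u w"
proof (induction l arbitrary: u v w)
  case (Suc l)
  show ?case
  proof (rule uni_SucI)
    fix w1 b w2
    assume "w = w1 @ b # w2"
    with Suc.prems(2) obtain v1 v2 where v: "v = v1 @ b # v2" "uni l v1 w1" "uni l v2 w2"
      by (metis uni_SucE)
    with Suc.prems(1) obtain u1 u2 where u: "u = u1 @ b # u2" "uni l u1 v1" "uni l u2 v2"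
      by (metis uni_SucE)
    from u v Suc.IH show "\<exists>u1 u2. u = u1 @ b # u2 \<and> uni l u1 w1 \<and> uni l u2 w2"
      by blast
  qed
qed simp

lemma uni_Suc_D: "uni (Suc l) u w \<Longrightarrow> uni l u w"
proof (induction l arbitrary: u w)
  case (Suc l)
  show ?case
  proof (rule uni_SucI)
    fix w1 b w2
    assume "w = w1 @ b # w2"
    with Suc.prems have "uni (Suc (Suc l)) u (w1 @ b # w2)" by simp
    then show "\<exists>u1 u2. u = u1 @ b # u2 \<and> uni l u1 w1 \<and> uni l u2 w2"
      by (rule uni_SucE) (blast intro: Suc.IH)
  qed
qed simp

text \<open>The letter picked by Spoiler lies in one of the two factors, whose own strategy answers
  it; the untouched factor gives up its spare round by \<open>uni_Suc_D\<close>.\<close>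

lemma uni_append: "uni l u w \<Longrightarrow> uni l u' w' \<Longrightarrow> uni l (u @ u') (w @ w')"
proof (induction l arbitrary: u w u' w')
  case (Suc l)
  show ?case
  proof (rule uni_SucI)
    fix w1 b w2
    assume "w @ w' = w1 @ b # w2"
    then show "\<exists>u1 u2. u @ u' = u1 @ b # u2 \<and> uni l u1 w1 \<and> uni l u2 w2"
    proof (cases rule: append_split_cases)
      case (1 y')
      with Suc.prems obtain u1 u2 where u: "u = u1 @ b # u2" "uni l u1 w1" "uni l u2 y'"
        by (metis uni_SucE)
      with 1 Suc.IH[OF u(3) uni_Suc_D[OF Suc.prems(2)]] show ?thesis
        by (intro exI[of _ u1] exI[of _ "u2 @ u'"]) simp
    next
      case (2 x')
      with Suc.prems obtain u1 u2 where u: "u' = u1 @ b # u2" "uni l u1 x'" "uni l u2 w2"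
        by (metis uni_SucE)
      with 2 Suc.IH[OF uni_Suc_D[OF Suc.prems(1)] u(2)] show ?thesis
        by (intro exI[of _ "u @ u1"] exI[of _ u2]) simp
    qed
  qed
qed simp

lemma uni_map: "uni l u w \<Longrightarrow> uni l (map h u) (map h w)"
proof (induction l arbitrary: u w)
  case (Suc l)
  show ?case
  proof (rule uni_SucI)
    fix w1 b w2
    assume "map h w = w1 @ b # w2"
    then obtain x1 x x2 where x: "w = x1 @ x # x2" "w1 = map h x1" "b = h x" "w2 = map h x2"
      by (auto simp: map_eq_append_conv map_eq_Cons_conv)
    with Suc.prems obtain u1 u2 where u: "u = u1 @ x # u2" "uni l u1 x1" "uni l u2 x2"
      by (metis uni_SucE)
    with x Suc.IH show "\<exists>u1 u2. map h u = u1 @ b # u2 \<and> uni l u1 w1 \<and> uni l u2 w2"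
      by (intro exI[of _ "map h u1"] exI[of _ "map h u2"]) simp
  qed
qed simp

lemma uni_set:
  assumes "uni (Suc l) u w"
  shows "set w \<subseteq> set u"
proof
  fix b
  assume "b \<in> set w"
  then obtain w1 w2 where "w = w1 @ b # w2" by (meson split_list)
  with assms obtain u1 u2 where "u = u1 @ b # u2" by (metis uni_SucE)
  then show "b \<in> set u" by simp
qed

lemma le_SucE:
  assumes "le l (Suc k) (u1 @ b # u2) w"
  obtains w1 w2 where "w = w1 @ b # w2" "le l k u1 w1" "le l k u2 w2"
  using assms unfolding le.simps by blast

lemma le_Suc_D: "le l (Suc k) u w \<Longrightarrow> le l k u w"
  by simp

text \<open>The first premise is a genuine demand: for empty \<open>u\<close> the second is vacuous,
  whereas \<open>le l k [] w\<close> forces \<open>w\<close> to be empty once \<open>l\<close> is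
  positive. It also lets Spoiler change to the other word early.\<close>

lemma le_SucI:
  assumes "le l k u w"
    and "\<And>u1 b u2. u = u1 @ b # u2 \<Longrightarrow> \<exists>w1 w2. w = w1 @ b # w2 \<and> le l k u1 w1 \<and> le l k u2 w2"
  shows "le l (Suc k) u w"
  using assms unfolding le.simps by blast

lemma le_refl: "le l k u u"
proof (induction k arbitrary: u)
  case (Suc k)
  then show ?case by (intro le_SucI) blast+
qed (simp add: uni_refl)

lemma le_trans: "le l k u v \<Longrightarrow> le l k v w \<Longrightarrow> le l k u w"
proof (induction k arbitrary: u v w)
  case 0
  then show ?case by (auto intro: uni_trans)
next
  case (Suc k)
  show ?case
  proof (rule le_SucI)
    show "le l k u w" using Suc le_Suc_D by metis
    fix u1 b u2
    assume "u = u1 @ b # u2"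
    with Suc.prems(1) obtain v1 v2 where v: "v = v1 @ b # v2" "le l k u1 v1" "le l k u2 v2"
      by (metis le_SucE)
    with Suc.prems(2) obtain w1 w2 where w: "w = w1 @ b # w2" "le l k v1 w1" "le l k v2 w2"
      by (metis le_SucE)
    from v w Suc.IH show "\<exists>w1 w2. w = w1 @ b # w2 \<and> le l k u1 w1 \<and> le l k u2 w2"
      by blast
  qed
qed

lemma le_append: "le l k u w \<Longrightarrow> le l k u' w' \<Longrightarrow> le l k (u @ u') (w @ w')"
proof (induction k arbitrary: u w u' w')
  case 0
  then show ?case by (simp add: uni_append)
next
  case (Suc k)
  show ?case
  proof (rule le_SucI)
    show "le l k (u @ u') (w @ w')"
      using Suc.IH Suc.prems le_Suc_D by metis
    fix u1 b u2
    assume "u @ u' = u1 @ b # u2"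
    then show "\<exists>w1 w2. w @ w' = w1 @ b # w2 \<and> le l k u1 w1 \<and> le l k u2 w2"
    proof (cases rule: append_split_cases)
      case (1 y')
      with Suc.prems obtain w1 w2 where w: "w = w1 @ b # w2" "le l k u1 w1" "le l k y' w2"
        by (metis le_SucE)
      with 1 Suc.IH[OF w(3) le_Suc_D[OF Suc.prems(2)]] show ?thesis
        by (intro exI[of _ w1] exI[of _ "w2 @ w'"]) simp
    next
      case (2 x')
      with Suc.prems obtain w1 w2 where w: "w' = w1 @ b # w2" "le l k x' w1" "le l k u2 w2"
        by (metis le_SucE)
      with 2 Suc.IH[OF le_Suc_D[OF Suc.prems(1)] w(2)] show ?thesis
        by (intro exI[of _ "w @ w1"] exI[of _ w2]) simp
    qed
  qed
qed

text \<open>A relabelling acts on a strategy letter by letter. This serves to forget pebbles and to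
  introduce empty marks.\<close>

lemma le_map: "le l k u w \<Longrightarrow> le l k (map h u) (map h w)"
proof (induction k arbitrary: u w)
  case 0
  then show ?case by (simp add: uni_map)
next
  case (Suc k)
  show ?case
  proof (rule le_SucI)
    show "le l k (map h u) (map h w)"
      using Suc.IH Suc.prems le_Suc_D by metis
    fix u1 b u2
    assume "map h u = u1 @ b # u2"
    then obtain x1 x x2 where x: "u = x1 @ x # x2" "u1 = map h x1" "b = h x" "u2 = map h x2"
      by (auto simp: map_eq_append_conv map_eq_Cons_conv)
    with Suc.prems obtain w1 w2 where "w = w1 @ x # w2" "le l k x1 w1" "le l k x2 w2"
      by (metis le_SucE)
    with x Suc.IH show "\<exists>w1 w2. map h w = w1 @ b # w2 \<and> le l k u1 w1 \<and> le l k u2 w2"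
      by (intro exI[of _ "map h w1"] exI[of _ "map h w2"]) simp
  qed
qed

lemma le_uni: "le l k u w \<Longrightarrow> uni l u w"
  by (induction k) auto

text \<open>One round in each direction already compares the alphabets; hence the indices
  \<open>Suc l\<close> and \<open>Suc k\<close> throughout the construction of upper bounds.\<close>

lemma le_set:
  assumes "le (Suc l) (Suc k) u w"
  shows "set u = set w"
proof
  show "set w \<subseteq> set u" using le_uni[OF assms] by (rule uni_set)
  show "set u \<subseteq> set w"
  proof
    fix b
    assume "b \<in> set u"
    then obtain u1 u2 where "u = u1 @ b # u2" by (meson split_list)
    with assms obtain w1 w2 where "w = w1 @ b # w2" by (metis le_SucE)
    then show "b \<in> set w" by simp
  qed
qed

section \<open>Words with many blocks covering an alphabet\<close>

text \<open>Blocks are read from the left and whatever follows the last one is arbitrary, so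
  richness survives extending the word on either side.\<close>

primrec rich :: "'b set \<Rightarrow> nat \<Rightarrow> 'b list \<Rightarrow> bool" where
  "rich C 0 x \<longleftrightarrow> True"
| "rich C (Suc j) x \<longleftrightarrow> (\<exists>y z. x = y @ z \<and> C \<subseteq> set y \<and> rich C j z)"

lemma rich_SucI: "C \<subseteq> set y \<Longrightarrow> rich C j z \<Longrightarrow> rich C (Suc j) (y @ z)"
  unfolding rich.simps by blast

lemma rich_SucE:
  assumes "rich C (Suc j) x"
  obtains y z where "x = y @ z" "C \<subseteq> set y" "rich C j z"
  using assms unfolding rich.simps by blast

lemma rich_prepend:
  assumes "rich C j x"
  shows "rich C j (y @ x)"
proof (cases j)
  case (Suc i)
  with assms obtain x1 x2 where "x = x1 @ x2" "C \<subseteq> set x1" "rich C i x2"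
    by (metis rich_SucE)
  with Suc rich_SucI[of C "y @ x1" i x2] show ?thesis by auto
qed simp

lemma rich_append: "rich C i x \<Longrightarrow> rich C j y \<Longrightarrow> rich C (i + j) (x @ y)"
proof (induction i arbitrary: x)
  case 0
  then show ?case by (simp add: rich_prepend)
next
  case (Suc i)
  then obtain x1 x2 where "x = x1 @ x2" "C \<subseteq> set x1" "rich C i x2"
    by (metis rich_SucE)
  with Suc rich_SucI[of C x1 "i + j" "x2 @ y"] show ?case by simp
qed

lemma rich_mono: "rich C j x \<Longrightarrow> i \<le> j \<Longrightarrow> rich C i x"
proof (induction i arbitrary: j x)
  case (Suc i)
  from Suc.prems obtain j' where j': "j = Suc j'" "i \<le> j'" by (cases j) auto
  with Suc.prems obtain x1 x2 where "x = x1 @ x2" "C \<subseteq> set x1" "rich C j' x2"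
    by (metis rich_SucE)
  with j' Suc.IH show ?case by (auto intro!: rich_SucI)
qed simp

text \<open>A single letter can spoil at most one of the \<open>i + j + 1\<close> blocks. The blocks
  before it lie in \<open>s\<close> and those after it in \<open>t\<close>; of the remaining
  \<open>i + j\<close>, one side gets its share.\<close>

lemma rich_split: "rich C (Suc (i + j)) (s @ b # t) \<Longrightarrow> rich C i s \<or> rich C j t"
proof (induction i arbitrary: s)
  case (Suc i)
  then obtain y z where yz: "s @ b # t = y @ z" "C \<subseteq> set y" "rich C (Suc (i + j)) z"
    by (metis add_Suc rich_SucE)
  from yz(1)[symmetric] show ?case
  proof (cases rule: append_split_cases)
    case (1 y')
    then have "rich C (Suc (i + j)) t" using rich_prepend[OF yz(3)] by simp
    then show ?thesis using rich_mono[of C "Suc (i + j)" t j] by simp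
  next
    case (2 x')
    with yz Suc.IH[of x'] show ?thesis by (auto intro: rich_SucI)
  qed
qed simp

text \<open>The occurrence is taken from the block that has \<open>i\<close> blocks before it and
  \<open>j\<close> behind it.\<close>

lemma rich_pick:
  assumes "rich C (Suc (i + j)) r" "b \<in> C"
  shows "\<exists>r1 r2. r = r1 @ b # r2 \<and> rich C i r1 \<and> rich C j r2"
  using assms(1)
proof (induction i arbitrary: r)
  case 0
  then obtain y z where yz: "r = y @ z" "C \<subseteq> set y" "rich C j z"
    by (metis add_0 rich_SucE)
  with assms(2) obtain y1 y2 where "y = y1 @ b # y2" by (meson in_mono split_list)
  with yz show ?case
    by (intro exI[of _ y1] exI[of _ "y2 @ z"]) (simp add: rich_prepend)
next
  case (Suc i)
  then obtain y z where yz: "r = y @ z" "C \<subseteq> set y" "rich C (Suc (i + j)) z"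
    by (metis add_Suc rich_SucE)
  with Suc.IH[of z] obtain r1 r2 where "z = r1 @ b # r2" "rich C i r1" "rich C j r2" by auto
  with yz have "r = (y @ r1) @ b # r2" "rich C (Suc i) (y @ r1)" "rich C j r2"
    by (simp_all add: rich_SucI del: rich.simps(2))
  then show ?case by blast
qed

text \<open>The recursion of the block count: one block supplies the answer to a move, and
  \<open>2 ^ l - 1\<close> blocks must remain on each side of it.\<close>

lemma double_power_pred: "2 ^ Suc l - 1 = Suc ((2 ^ l - 1) + (2 ^ l - 1 :: nat))"
proof -
  have "2 * m - 1 = Suc ((m - 1) + (m - 1))" if "1 \<le> m" for m :: nat
    using that by arith
  from this[of "2 ^ l"] show ?thesis by simp
qed

text \<open>Every answer comes from the middle block, so both remaining factors are rich enough for
  the remaining rounds, whatever word over \<open>C\<close> stands opposite.\<close>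

lemma rich_uni: "rich C (2 ^ l - 1) r \<Longrightarrow> set Z \<subseteq> C \<Longrightarrow> uni l r Z"
proof (induction l arbitrary: r Z)
  case (Suc l)
  have "2 ^ Suc l - 1 = Suc ((2 ^ l - 1) + (2 ^ l - 1 :: nat))"
    by (rule double_power_pred)
  with Suc.prems(1) have "rich C (Suc ((2 ^ l - 1) + (2 ^ l - 1))) r" by simp
  note r = this
  show ?case
  proof (rule uni_SucI)
    fix w1 b w2
    assume Z: "Z = w1 @ b # w2"
    with Suc.prems(2) have "b \<in> C" by simp
    from rich_pick[OF r this] obtain r1 r2
      where "r = r1 @ b # r2" "rich C (2 ^ l - 1) r1" "rich C (2 ^ l - 1) r2" by blast
    with Z Suc show "\<exists>u1 u2. r = u1 @ b # u2 \<and> uni l u1 w1 \<and> uni l u2 w2" by auto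
  qed
qed simp

text \<open>Whatever letter of \<open>r\<close> is chosen, one side of it is still rich, and it is answered in
  the copy of \<open>r\<close> that leaves the inserted word on that side.\<close>

lemma le_duplicate:
  assumes "rich C (2 ^ (l + k) - 1) r" "set r \<subseteq> C" "set Y \<subseteq> C"
  shows "le l k r (r @ Y @ r)"
  using assms
proof (induction k arbitrary: r Y)
  case 0
  then show ?case by (simp add: rich_uni)
next
  case (Suc k)
  let ?J = "2 ^ (l + k) - 1 :: nat"
  have J: "2 ^ (l + Suc k) - 1 = Suc (?J + ?J)"
    using double_power_pred[of "l + k"] by simp
  have "le l k r (r @ Y @ r)"
    using Suc.IH[of r Y] Suc.prems rich_mono[of C _ r ?J] J by auto
  then show ?case
  proof (rule le_SucI)
    fix s b t
    assume r: "r = s @ b # t"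
    show "\<exists>w1 w2. r @ Y @ r = w1 @ b # w2 \<and> le l k s w1 \<and> le l k t w2"
    proof -
    from rich_split[of C ?J ?J s b t] Suc.prems(1) J r consider "rich C ?J s" | "rich C ?J t"
      by auto
    then show ?thesis
    proof cases
      case 1
      then have "le l k s (s @ (b # t @ Y) @ s)"
        by (rule Suc.IH) (use Suc.prems r in auto)
      then show ?thesis
        using r le_refl[of l k t]
        by (intro exI[of _ "s @ (b # t @ Y) @ s"] exI[of _ t]) simp
    next
      case 2
      then have "le l k t (t @ (Y @ s @ [b]) @ t)"
        by (rule Suc.IH) (use Suc.prems r in auto)
      then show ?thesis
        using r le_refl[of l k s]
        by (intro exI[of _ "s"] exI[of _ "t @ (Y @ s @ [b]) @ t"]) simp
    qed
  qed
  qed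
qed

declare uni.simps(2) [simp del] le.simps(2) [simp del] rich.simps(2) [simp del]

section \<open>Common upper bounds of equivalent words\<close>

text \<open>A cut at a first or last occurrence is determined by the word and the letter, and is of
  the kind that a ranker can point at. Levels are cumulative, so each of them still compares
  alphabets.\<close>

primrec eqv :: "nat \<Rightarrow> 'b list \<Rightarrow> 'b list \<Rightarrow> bool" where
  "eqv 0 u v \<longleftrightarrow> set u = set v"
| "eqv (Suc m) u v \<longleftrightarrow> eqv m u v \<and>
     (\<forall>p a q p' q'. u = p @ a # q \<and> v = p' @ a # q' \<and>
        (a \<notin> set p \<and> a \<notin> set p' \<or> a \<notin> set q \<and> a \<notin> set q') \<longrightarrow>
        eqv m p p' \<and> eqv m q q')"

lemma eqv_mono: "eqv m u v \<Longrightarrow> i \<le> m \<Longrightarrow> eqv i u v"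
  by (induction m) (auto simp: le_Suc_eq)

lemma eqv_set: "eqv m u v \<Longrightarrow> set u = set v"
  by (induction m) auto

lemma eqv_split:
  assumes "eqv (Suc m) (p @ a # q) (p' @ a # q')"
    and "a \<notin> set p \<and> a \<notin> set p' \<or> a \<notin> set q \<and> a \<notin> set q'"
  shows "eqv m p p'" "eqv m q q'"
  using assms unfolding eqv.simps by blast+

declare eqv.simps(2) [simp del]

text \<open>\<open>a\<close> is the letter whose first occurrence comes last. The prefix before it
  misses exactly this letter, so induction on the alphabet applies to it, while together with
  \<open>a\<close> it forms one block.\<close>

lemma last_new_letter:
  assumes "u \<noteq> []"
  obtains p a q where "u = p @ a # q" "a \<notin> set p" "insert a (set p) = set u"
proof -
  have "\<exists>p a q. u = p @ a # q \<and> a \<notin> set p \<and> insert a (set p) = set u"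
    using assms
  proof (induction u rule: rev_induct)
    case (snoc x u)
    show ?case
    proof (cases "x \<in> set u")
      case True
      then have "u \<noteq> []" by auto
      with snoc.IH obtain p a q where "u = p @ a # q" "a \<notin> set p" "insert a (set p) = set u"
        by blast
      with True show ?thesis
        by (intro exI[of _ p] exI[of _ a] exI[of _ "q @ [x]"]) auto
    next
      case False
      then show ?thesis by (intro exI[of _ u] exI[of _ x] exI[of _ "[]"]) auto
    qed
  qed simp
  with that show thesis by blast
qed

lemma first_new_letter:
  assumes "u \<noteq> []"
  obtains p a q where "u = p @ a # q" "a \<notin> set q" "insert a (set q) = set u"
proof -
  from assms obtain p a q where "rev u = p @ a # q" "a \<notin> set p" "insert a (set p) = set u"
    by (metis last_new_letter rev_is_Nil_conv set_rev)
  moreover from this have "u = rev q @ a # rev p" by (simp add: rev_eq_append_conv)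
  ultimately have "u = rev q @ a # rev p" "a \<notin> set (rev p)" "insert a (set (rev p)) = set u"
    unfolding set_rev by blast+
  with that show thesis by blast
qed

section \<open>Words with consistent residues\<close>

text \<open>Factors of a coloured word may start anywhere, hence the parameter \<open>c\<close>,
  which matters only modulo \<open>n\<close>.\<close>

definition path :: "nat \<Rightarrow> nat \<Rightarrow> ('a \<times> nat) list \<Rightarrow> bool" where
  "path n c u \<longleftrightarrow> (\<forall>i<length u. snd (u ! i) = (c + i) mod n)"

lemma path_Nil [simp]: "path n c []"
  by (simp add: path_def)

lemma path_Cons [simp]: "path n c (a # u) \<longleftrightarrow> snd a = c mod n \<and> path n (Suc c) u"
  by (auto simp: path_def less_Suc_eq_0_disj)

lemma path_append [simp]: "path n c (u @ v) \<longleftrightarrow> path n c u \<and> path n (c + length u) v"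
  by (induction u arbitrary: c) auto

lemma path_cong: "[c = d] (mod n) \<Longrightarrow> path n c u \<longleftrightarrow> path n d u"
  unfolding path_def cong_def by (metis mod_add_left_eq)

lemma path_take: "path n c u \<Longrightarrow> path n c (take i u)"
  by (metis append_take_drop_id path_append)

lemma path_drop: "path n c u \<Longrightarrow> i \<le> length u \<Longrightarrow> path n (c + i) (drop i u)"
  by (metis append_take_drop_id path_append length_take min.absorb2)

text \<open>A path of length \<open>n\<close> visits every residue, so a window of it can start at
  the residue of \<open>c + e\<close> and stop where the residue of \<open>c\<close> is due
  again.\<close>

lemma return_path:
  assumes "path n c r" "n \<le> length r" "0 < n"
  obtains t where "path n (c + e) t" "[e + length t = 0] (mod n)" "set t \<subseteq> set r"
proof
  \<comment> \<open>Skipping \<open>e mod n\<close> letters and reading \<open>n - e mod n\<close>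
    stays within the first \<open>n\<close> letters of \<open>r\<close>. If \<open>n\<close> divides
    \<open>e\<close>, the window is a full period.\<close>
  let ?t = "take (n - e mod n) (drop (e mod n) r)"
  have len: "length ?t = n - e mod n"
    using assms by simp
  have "path n (c + e mod n) ?t"
    using assms by (intro path_take path_drop) (auto intro: less_imp_le order.trans mod_le_divisor)
  then show "path n (c + e) ?t"
    by (subst path_cong[of _ "c + e mod n"]) (simp_all add: cong_def mod_add_right_eq)
  have "[e + (n - e mod n) = e mod n + (n - e mod n)] (mod n)"
    by (simp add: cong_def mod_add_left_eq)
  also have "e mod n + (n - e mod n) = n"
    using assms by simp
  finally show "[e + length ?t = 0] (mod n)"
    unfolding len by (simp add: cong_def)
  show "set ?t \<subseteq> set r"
    by (meson in_set_dropD in_set_takeD subsetI)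
qed


lemma cong_cancel_left:
  fixes n :: nat
  shows "[a + x = b + y] (mod n) \<Longrightarrow> [a = b] (mod n) \<Longrightarrow> [x = y] (mod n)"
  by (metis cong_add cong_add_lcancel_nat cong_refl cong_sym cong_trans)

lemma cong_cancel_right:
  fixes n :: nat
  shows "[a + x = b + y] (mod n) \<Longrightarrow> [x = y] (mod n) \<Longrightarrow> [a = b] (mod n)"
  by (metis add.commute cong_cancel_left)

text \<open>The shared letter carries its own residue, so two paths that start alike reach it after
  equally many steps modulo \<open>n\<close>. Colouring thus makes matching cuts have matching
  lengths.\<close>

lemma path_letter_cong:
  assumes "path n c (p @ a # q)" "path n c' (p' @ a # q')" "[c = c'] (mod n)"
  shows "[length p = length p'] (mod n)"
proof -
  from assms have "[c + length p = c' + length p'] (mod n)"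
    by (simp add: cong_def)
  then show ?thesis using assms(3) by (rule cong_cancel_left)
qed

text \<open>The length condition lets the bound stand in for \<open>u\<close> inside a longer path
  without shifting the residues behind it.\<close>

definition upper_bounded :: "nat \<Rightarrow> nat \<Rightarrow> nat \<Rightarrow> nat \<Rightarrow> ('a \<times> nat) list \<Rightarrow> ('a \<times> nat) list \<Rightarrow> bool" where
  "upper_bounded n l k c u v \<longleftrightarrow>
     (\<exists>w. path n c w \<and> [length w = length u] (mod n) \<and> le l k u w \<and> le l k v w)"

lemma upper_bounded_append:
  assumes "path n c x" "[length x = length u] (mod n)" "[length x = length v] (mod n)"
    and "le l k u x" "le l k v x" "upper_bounded n l k (c + length u) u' v'"
  shows "upper_bounded n l k c (u @ u') (v @ v')"
proof -
  from assms(6) obtain w where w: "path n (c + length u) w" "[length w = length u'] (mod n)"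
    "le l k u' w" "le l k v' w"
    unfolding upper_bounded_def by blast
  have "path n (c + length x) w"
    using w(1) path_cong[OF cong_add[OF cong_refl assms(2)]] by blast
  with assms w show ?thesis
    unfolding upper_bounded_def by (intro exI[of _ "x @ w"]) (auto intro: le_append cong_add)
qed

lemma upper_bounded_prepend:
  assumes "path n (c + length u) x" "[length x = length u'] (mod n)"
    and "le l k u' x" "le l k v' x" "upper_bounded n l k c u v"
  shows "upper_bounded n l k c (u @ u') (v @ v')"
proof -
  from assms(5) obtain w where w: "path n c w" "[length w = length u] (mod n)"
    "le l k u w" "le l k v w"
    unfolding upper_bounded_def by blast
  have "path n (c + length w) x"
    using assms(1) path_cong[OF cong_add[OF cong_refl w(2)]] by blast
  with assms w show ?thesis
    unfolding upper_bounded_def by (intro exI[of _ "w @ x"]) (auto intro: le_append cong_add)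
qed

section \<open>Peeling off rich factors and assembling the bound\<close>

text \<open>Level \<open>m\<close> is what the induction hypothesis for smaller alphabets consumes,
  \<open>j\<close> levels pay for the cuts, and \<open>m'\<close> is kept for peeling at the other
  end. Each cut removes a prefix using all of \<open>C\<close>, unless the remainder has already
  lost a letter; then a bound exists outright.\<close>

lemma peel_left:
  fixes C :: "('a \<times> nat) set"
  assumes IH: "\<And>c (u :: ('a \<times> nat) list) v. path n c u \<Longrightarrow> path n c v \<Longrightarrow> [length u = length v] (mod n) \<Longrightarrow>
      eqv m u v \<Longrightarrow> card (set u) < card C \<Longrightarrow> upper_bounded n (Suc l) (Suc k) c u v"
    and C: "finite C" "C \<noteq> {}"
    and uv: "path n c u" "path n c v" "[length u = length v] (mod n)" "set u = C"
  shows "eqv (m + m' + j) u v \<Longrightarrow> upper_bounded n (Suc l) (Suc k) c u v \<or>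
    (\<exists>x y z u' v'. u = x @ u' \<and> v = y @ v' \<and> path n c z \<and>
      [length z = length x] (mod n) \<and> [length z = length y] (mod n) \<and>
      le (Suc l) (Suc k) x z \<and> le (Suc l) (Suc k) y z \<and> rich C j z \<and> eqv (m + m') u' v')"
proof (induction j arbitrary: m')
  case 0
  then show ?case
    by (intro disjI2 exI[of _ "[]"] exI[of _ u] exI[of _ v]) (simp add: le_refl)
next
  case (Suc j)
  let ?le = "le (Suc l) (Suc k)"
  show ?case
  proof (cases "upper_bounded n (Suc l) (Suc k) c u v")
    case False
    from Suc.prems have "eqv (m + Suc m' + j) u v" by simp
    with Suc.IH[of "Suc m'"] False obtain x y z u' v' where *: "u = x @ u'" "v = y @ v'" "path n c z"
      "[length z = length x] (mod n)" "[length z = length y] (mod n)"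
      "?le x z" "?le y z" "rich C j z" "eqv (Suc (m + m')) u' v'"
      by auto
    have xy: "[length x = length y] (mod n)"
      using * cong_sym cong_trans by blast
    have c: "[c + length x = c + length y] (mod n)"
      using xy by (simp add: cong_add_lcancel_nat)
    have paths: "path n (c + length x) u'" "path n (c + length x) v'"
      using uv * path_cong[OF c] by auto
    have len: "[length u' = length v'] (mod n)"
      using uv(3) xy unfolding * by (auto intro: cong_cancel_left)
    have sub: "set u' \<subseteq> C" using uv * by auto
    \<comment> \<open>Remainders over a smaller alphabet have a common bound by the induction
      hypothesis, and appending it to \<open>z\<close> would bound \<open>u\<close> and
      \<open>v\<close>.\<close>
    have "set u' = C"
    proof (rule ccontr)
      assume "set u' \<noteq> C"
      with sub C have "card (set u') < card C" by (simp add: psubset_card_mono psubsetI)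
      moreover have "eqv m u' v'" using *(9) by (rule eqv_mono) simp
      ultimately have "upper_bounded n (Suc l) (Suc k) (c + length x) u' v'"
        using IH paths len by blast
      with False upper_bounded_append * show False by blast
    qed
    with C obtain p a q where u': "u' = p @ a # q" "a \<notin> set p" "insert a (set p) = C"
      by (metis last_new_letter set_empty)
    \<comment> \<open>\<open>v'\<close> has the same alphabet, so it can be cut at its own first
      \<open>a\<close>, and \<open>eqv\<close> matches the two cuts.\<close>
    have "a \<in> set v'" using eqv_set[OF *(9)] u' by auto
    then obtain p' q' where v': "v' = p' @ a # q'" "a \<notin> set p'"
      by (meson split_list_first)
    have eqv: "eqv (m + m') p p'" "eqv (m + m') q q'"
      using eqv_split[of "m + m'" p a q p' q'] *(9) u' v' by auto
    have lenp: "[length p = length p'] (mod n)"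
      using paths unfolding u' v' by (rule path_letter_cong) (rule cong_refl)
    have "card (set p) < card C"
      using u' C by (metis card_insert_disjoint finite_set lessI)
    then have "upper_bounded n (Suc l) (Suc k) (c + length x) p p'"
      using IH[of "c + length x" p p'] paths u' v' lenp eqv_mono[OF eqv(1)] by simp
    then obtain w where w: "path n (c + length x) w" "[length w = length p] (mod n)"
        "?le p w" "?le p' w"
      unfolding upper_bounded_def by blast
    have a: "snd a = (c + length x + length p) mod n"
      using paths(1) u' by simp
    have zw: "[c + length z + length w = c + length x + length p] (mod n)"
      by (intro cong_add cong_refl *(4) w(2))
    have "path n (c + length z) w"
      using w(1) path_cong[OF cong_add[OF cong_refl *(4)]] by blast
    moreover have "snd a = (c + length z + length w) mod n"
      using a zw by (simp add: cong_def)
    ultimately have "path n c (z @ w @ [a])"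
      using *(3) by (simp add: add.assoc)
    moreover have "[length (z @ w @ [a]) = length (x @ p @ [a])] (mod n)"
      unfolding length_append by (intro cong_add cong_refl *(4) w(2))
    moreover have "[length (z @ w @ [a]) = length (y @ p' @ [a])] (mod n)"
      unfolding length_append by (intro cong_add cong_refl *(5) cong_trans[OF w(2) lenp])
    moreover have "?le (x @ p @ [a]) (z @ w @ [a])" "?le (y @ p' @ [a]) (z @ w @ [a])"
      using * w by (auto intro!: le_append le_refl)
    \<comment> \<open>By \<open>le_set\<close>, \<open>w\<close> has the alphabet of
      \<open>p\<close>, so \<open>w @ [a]\<close> is one further block covering
      \<open>C\<close>.\<close>
    moreover have "rich C (j + Suc 0) (z @ w @ [a])"
      by (rule rich_append[OF *(8)])
        (use u'(3) le_set[OF w(3)] rich_SucI[of C "w @ [a]" 0 "[]"] in auto)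
    moreover have "u = (x @ p @ [a]) @ q" "v = (y @ p' @ [a]) @ q'"
      using * u' v' by simp_all
    ultimately show ?thesis
      using eqv(2) by (metis One_nat_def add.commute plus_1_eq_Suc)
  qed simp
qed

text \<open>The mirror image, except that residues still run from left to right, so the start of a
  right factor depends on the lengths before it. The alphabet is only contained in \<open>C\<close>,
  as the words are those left over by \<open>peel_left\<close>.\<close>

lemma peel_right:
  fixes C :: "('a \<times> nat) set"
  assumes IH: "\<And>c (u :: ('a \<times> nat) list) v. path n c u \<Longrightarrow> path n c v \<Longrightarrow> [length u = length v] (mod n) \<Longrightarrow>
      eqv m u v \<Longrightarrow> card (set u) < card C \<Longrightarrow> upper_bounded n (Suc l) (Suc k) c u v"
    and C: "finite C" "C \<noteq> {}"
    and uv: "path n c u" "path n c v" "[length u = length v] (mod n)" "set u \<subseteq> C"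
  shows "eqv (m + m' + j) u v \<Longrightarrow> upper_bounded n (Suc l) (Suc k) c u v \<or>
    (\<exists>x y z u' v'. u = u' @ x \<and> v = v' @ y \<and> path n (c + length u') z \<and>
      [length z = length x] (mod n) \<and> [length z = length y] (mod n) \<and>
      le (Suc l) (Suc k) x z \<and> le (Suc l) (Suc k) y z \<and> rich C j z \<and> eqv (m + m') u' v')"
proof (induction j arbitrary: m')
  case 0
  then show ?case
    by (intro disjI2 exI[of _ "[]"] exI[of _ u] exI[of _ v]) (simp add: le_refl)
next
  case (Suc j)
  let ?le = "le (Suc l) (Suc k)"
  show ?case
  proof (cases "upper_bounded n (Suc l) (Suc k) c u v")
    case False
    from Suc.prems have "eqv (m + Suc m' + j) u v" by simp
    with Suc.IH[of "Suc m'"] False obtain x y z u' v' where *: "u = u' @ x" "v = v' @ y"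
      "path n (c + length u') z"
      "[length z = length x] (mod n)" "[length z = length y] (mod n)"
      "?le x z" "?le y z" "rich C j z" "eqv (Suc (m + m')) u' v'"
      by auto
    have xy: "[length x = length y] (mod n)"
      using * cong_sym cong_trans by blast
    have paths: "path n c u'" "path n c v'"
      using uv * by auto
    have len: "[length u' = length v'] (mod n)"
      using uv(3) xy unfolding * by (auto intro: cong_cancel_right)
    have sub: "set u' \<subseteq> C" using uv * by auto
    have "set u' = C"
    proof (rule ccontr)
      assume "set u' \<noteq> C"
      with sub C have "card (set u') < card C" by (simp add: psubset_card_mono psubsetI)
      moreover have "eqv m u' v'" using *(9) by (rule eqv_mono) simp
      ultimately have "upper_bounded n (Suc l) (Suc k) c u' v'"
        using IH paths len by blast
      with False upper_bounded_prepend * show False by blast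
    qed
    with C obtain p a q where u': "u' = p @ a # q" "a \<notin> set q" "insert a (set q) = C"
      by (metis first_new_letter set_empty)
    have "a \<in> set v'" using eqv_set[OF *(9)] u' by auto
    then obtain p' q' where v': "v' = p' @ a # q'" "a \<notin> set q'"
      by (meson split_list_last)
    have eqv: "eqv (m + m') p p'" "eqv (m + m') q q'"
      using eqv_split[of "m + m'" p a q p' q'] *(9) u' v' by auto
    have lenp: "[length p = length p'] (mod n)"
      using paths unfolding u' v' by (rule path_letter_cong) (rule cong_refl)
    \<comment> \<open>The parts up to and including \<open>a\<close> agree in length modulo
      \<open>n\<close> and are cancelled from the total lengths.\<close>
    have lenq: "[length q = length q'] (mod n)"
    proof -
      have "[Suc (length p) + length q = Suc (length p') + length q'] (mod n)"
        using len u' v' by simp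
      moreover have "[Suc (length p) = Suc (length p')] (mod n)"
        using cong_add[OF lenp cong_refl[of 1]] by simp
      ultimately show ?thesis by (rule cong_cancel_left)
    qed
    have q_path: "path n (c + length p + 1) q" using paths(1) u' by simp
    have "path n (c + length p' + 1) q'" using paths(2) v' by simp
    moreover have "[c + length p' + 1 = c + length p + 1] (mod n)"
      by (intro cong_add cong_refl cong_sym[OF lenp])
    ultimately have q'_path: "path n (c + length p + 1) q'"
      using path_cong by blast
    have "card (set q) < card C"
      using u' C by (metis card_insert_disjoint finite_set lessI)
    then have "upper_bounded n (Suc l) (Suc k) (c + length p + 1) q q'"
      using IH[OF q_path q'_path lenq] eqv_mono[OF eqv(2)] by simp
    then obtain w where w: "path n (c + length p + 1) w" "[length w = length q] (mod n)"
        "?le q w" "?le q' w"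
      unfolding upper_bounded_def by blast
    have "[c + length p + 1 + length w = c + length u'] (mod n)"
      using cong_add[OF cong_refl[of "c + length p + 1"] w(2)] u' by (simp add: add_ac)
    then have "path n (c + length p + 1 + length w) z"
      using *(3) path_cong by blast
    then have "path n (c + length p) (a # w @ z)"
      using w(1) paths(1) u' by simp
    moreover have "[length (a # w @ z) = length (a # q @ x)] (mod n)"
      using cong_add[OF cong_refl[of 1] cong_add[OF w(2) *(4)]] by simp
    moreover have "[length (a # w @ z) = length (a # q' @ y)] (mod n)"
      using cong_add[OF cong_refl[of 1] cong_add[OF cong_trans[OF w(2) lenq] *(5)]] by simp
    moreover have "?le ([a] @ q @ x) ([a] @ w @ z)" "?le ([a] @ q' @ y) ([a] @ w @ z)"
      by (intro le_append le_refl *(6,7) w)+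
    moreover have "rich C (Suc j) ((a # w) @ z)"
      by (rule rich_SucI) (use u'(3) le_set[OF w(3)] *(8) in auto)
    moreover have "u = p @ (a # q @ x)" "v = p' @ (a # q' @ y)"
      using * u' v' by simp_all
    ultimately show ?thesis
      using eqv(1) by (metis append_Cons append_Nil)
  qed simp
qed

lemma rich_length: "rich C j x \<Longrightarrow> C \<noteq> {} \<Longrightarrow> j \<le> length x"
proof (induction j arbitrary: x)
  case (Suc j)
  then obtain y z where "x = y @ z" "C \<subseteq> set y" "rich C j z" by (metis rich_SucE)
  moreover from this Suc.prems(2) have "0 < length y" by auto
  moreover have "j \<le> length z" using calculation(3) Suc.prems(2) by (rule Suc.IH)
  ultimately show ?case by (cases y) auto
qed simp

text \<open>The level \<open>m + j + j\<close> pays for \<open>j\<close> blocks at each end. The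
  rich ends absorb everything else: duplicating \<open>t\<close> in the bound of \<open>u\<close>
  and \<open>z\<close> in the bound of \<open>v\<close> leads to one and the same word in two
  bracketings.\<close>

lemma eqv_imp_upper_bounded_step:
  fixes C :: "('a \<times> nat) set"
  assumes n: "0 < n"
    and IH: "\<And>c (u :: ('a \<times> nat) list) v. path n c u \<Longrightarrow> path n c v \<Longrightarrow> [length u = length v] (mod n) \<Longrightarrow>
      eqv m u v \<Longrightarrow> card (set u) < card C \<Longrightarrow> upper_bounded n (Suc l) (Suc k) c u v"
    and C: "finite C" "C \<noteq> {}"
    and uv: "path n c u" "path n c v" "[length u = length v] (mod n)" "set u = C"
    and j: "2 ^ (Suc l + Suc k) \<le> j" "n \<le> j"
    and eqv: "eqv (m + j + j) u v"
  shows "upper_bounded n (Suc l) (Suc k) c u v"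
proof (rule ccontr)
  assume not_bounded: "\<not> ?thesis"
  let ?le = "le (Suc l) (Suc k)"
  from peel_left[OF IH C uv eqv] not_bounded obtain x y z u' v'
    where *: "u = x @ u'" "v = y @ v'" "path n c z"
      "[length z = length x] (mod n)" "[length z = length y] (mod n)"
      "?le x z" "?le y z" "rich C j z" "eqv (m + j) u' v'"
    by auto
  have xy: "[length x = length y] (mod n)"
    using * cong_sym cong_trans by blast
  have c: "[c + length x = c + length y] (mod n)"
    using xy by (simp add: cong_add_lcancel_nat)
  have paths: "path n (c + length x) u'" "path n (c + length x) v'"
    using uv * path_cong[OF c] by auto
  have len: "[length u' = length v'] (mod n)"
    using uv(3) xy unfolding * by (auto intro: cong_cancel_left)
  have sub: "set u' \<subseteq> C" using uv * by auto
  have "eqv (m + 0 + j) u' v'" using *(9) by simp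
  from peel_right[OF IH C paths len sub this]
    upper_bounded_append[OF *(3-7), of u' v'] not_bounded *(1,2)
  obtain r s t u2 v2
    where **: "u' = u2 @ r" "v' = v2 @ s" "path n (c + length x + length u2) t"
      "[length t = length r] (mod n)" "[length t = length s] (mod n)"
      "?le r t" "?le s t" "rich C j t"
    by auto
  have sets: "set z \<subseteq> C" "set t \<subseteq> C" "set u2 \<subseteq> C" "set v2 \<subseteq> C"
    using le_set[OF *(6)] le_set[OF **(6)] eqv_set[OF eqv] uv(4) * ** by auto
  \<comment> \<open>\<open>e\<close> is the length of the first pass, from which \<open>g\<close>
    must lead back to the residue of \<open>c\<close>, where the second copy of \<open>z\<close>
    starts. The blocks of \<open>z\<close> make it long enough to contain such a
    \<open>g\<close>.\<close>
  define e where "e = length (z @ u2 @ t)"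
  have "n \<le> length z" using rich_length[OF *(8)] C j(2) by simp
  then obtain g where g: "path n (c + e) g" "[e + length g = 0] (mod n)" "set g \<subseteq> set z"
    using return_path[OF *(3) _ n] by blast
  define w where "w = z @ u2 @ (t @ (g @ z @ v2) @ t)"
  have rich: "rich C (2 ^ (Suc l + Suc k) - 1) z" "rich C (2 ^ (Suc l + Suc k) - 1) t"
    using rich_mono[OF *(8)] rich_mono[OF **(8)] j(1) by auto
  have "?le u (z @ u2 @ t)"
    unfolding * ** by (intro le_append le_refl * **)
  moreover have "?le (z @ u2 @ t) w"
    unfolding w_def using sets g rich by (intro le_append le_refl le_duplicate[of C]) auto
  ultimately have u_le: "?le u w" by (rule le_trans)
  have "?le v (z @ v2 @ t)"
    unfolding * ** by (intro le_append le_refl * **)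
  moreover have "?le (z @ v2 @ t) ((z @ (u2 @ t @ g) @ z) @ v2 @ t)"
    using sets g rich by (intro le_append le_refl le_duplicate[of C]) auto
  ultimately have "?le v ((z @ (u2 @ t @ g) @ z) @ v2 @ t)" by (rule le_trans)
  \<comment> \<open>The two duplications differ in bracketing only.\<close>
  then have v_le: "?le v w" unfolding w_def append.assoc .
  have len_t: "[length r = length s] (mod n)"
    using ** cong_sym cong_trans by blast
  have len2: "[length u2 = length v2] (mod n)"
    using len len_t unfolding ** by (auto intro: cong_cancel_right)
  have p_u2: "path n (c + length z) u2"
    using paths(1) path_cong[OF cong_add[OF cong_refl *(4)]] unfolding ** by auto
  have p_v2: "path n (c + length z) v2"
    using paths(2) path_cong[OF cong_add[OF cong_refl *(4)]] unfolding ** by auto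
  have p_t: "path n (c + length z + length u2) t"
  proof -
    have "[c + length z + length u2 = c + length x + length u2] (mod n)"
      by (intro cong_add cong_refl *(4))
    with **(3) path_cong show ?thesis by blast
  qed
  have p_t': "path n (c + length z + length v2) t"
  proof -
    have "[c + length z + length v2 = c + length z + length u2] (mod n)"
      by (intro cong_add cong_refl cong_sym[OF len2])
    with p_t path_cong show ?thesis by blast
  qed
  \<comment> \<open>Behind \<open>g\<close> the residues repeat, so the second pass is checked as if
    it started at \<open>c\<close>.\<close>
  have shift: "path n (c + (e + length g) + i) y \<longleftrightarrow> path n (c + i) y" for i and y :: "('a \<times> nat) list"
    by (rule path_cong) (use cong_add[OF cong_add[OF cong_refl[of c] g(2)] cong_refl[of i]] in simp)
  have "path n c w"
    using *(3) p_u2 p_t g(1) shift[of 0 z] shift[of "length z" v2] shift[of "length z + length v2" t] p_v2 p_t'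
    unfolding w_def e_def by (simp add: add_ac)
  moreover have "[length w = length u] (mod n)"
  proof -
    have "[(e + length g) + (length z + length v2 + length t) = 0 + (length y + length v2 + length s)] (mod n)"
      by (intro cong_add g(2) *(5) **(5) cong_refl)
    then have "[length w = length v] (mod n)"
      unfolding w_def e_def * ** by (simp add: add_ac)
    with uv(3) show ?thesis using cong_sym cong_trans by blast
  qed
  ultimately show False
    using not_bounded u_le v_le unfolding upper_bounded_def by blast
qed

text \<open>The level is uniform in the words and in the start \<open>c\<close>; it grows with the
  alphabet size \<open>N\<close>, on which the induction runs.\<close>

theorem eqv_imp_upper_bounded:
  assumes "0 < n"
  shows "\<exists>m. \<forall>c (u :: ('a \<times> nat) list) v. path n c u \<longrightarrow> path n c v \<longrightarrow>
    [length u = length v] (mod n) \<longrightarrow> eqv m u v \<longrightarrow> card (set u) \<le> N \<longrightarrow>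
    upper_bounded n (Suc l) (Suc k) c u v"
proof (induction N)
  case 0
  have "upper_bounded n (Suc l) (Suc k) c u v" if "eqv 0 u v" "card (set u) = 0"
    for c and u v :: "('a \<times> nat) list"
    using that unfolding upper_bounded_def
    by (intro exI[of _ "[]"]) (simp add: le_refl)
  then show ?case by (intro exI[of _ 0]) simp
next
  case (Suc N)
  then obtain m where m: "\<And>c (u :: ('a \<times> nat) list) v. path n c u \<Longrightarrow> path n c v \<Longrightarrow>
    [length u = length v] (mod n) \<Longrightarrow> eqv m u v \<Longrightarrow> card (set u) \<le> N \<Longrightarrow>
    upper_bounded n (Suc l) (Suc k) c u v"
    by blast
  \<comment> \<open>The power of two pays for \<open>le_duplicate\<close>, the summand
    \<open>n\<close> for the connecting word from \<open>return_path\<close>.\<close>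
  define j where "j = 2 ^ (Suc l + Suc k) + n"
  have "upper_bounded n (Suc l) (Suc k) c u v"
    if uv: "path n c u" "path n c v" "[length u = length v] (mod n)" and eqv: "eqv (m + j + j) u v"
      and card: "card (set u) \<le> Suc N"
    for c and u v :: "('a \<times> nat) list"
  proof (cases "card (set u) \<le> N")
    case True
    have "eqv m u v" using eqv by (rule eqv_mono) simp
    with m uv True show ?thesis by blast
  next
    case False
    with card have "card (set u) = Suc N" by simp
    then have "set u \<noteq> {}" and less: "\<And>y :: ('a \<times> nat) list. card (set y) < card (set u) \<Longrightarrow> card (set y) \<le> N"
      by auto
    show ?thesis
      by (rule eqv_imp_upper_bounded_step[OF assms m _ \<open>set u \<noteq> {}\<close> uv refl _ _ eqv])
        (auto simp: j_def dest: less)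
  qed
  then show ?case by blast
qed

section \<open>Preservation of \<open>\<Sigma>\<^sub>2\<close> formulas\<close>

text \<open>Together with \<open>sigma2\<close>, this recasts the conditions on nested subformulas
  by recursion, the form in which preservation can be proved by structural induction.\<close>

primrec universal :: "'a fm \<Rightarrow> bool" where
  "universal Top \<longleftrightarrow> True"
| "universal Bot \<longleftrightarrow> True"
| "universal (Lab x a) \<longleftrightarrow> True"
| "universal (Eq x y) \<longleftrightarrow> True"
| "universal (Less x y) \<longleftrightarrow> True"
| "universal (Mod n i x) \<longleftrightarrow> True"
| "universal (Len n i) \<longleftrightarrow> True"
| "universal (Neg \<phi>) \<longleftrightarrow> False"
| "universal (Conj \<phi> \<psi>) \<longleftrightarrow> universal \<phi> \<and> universal \<psi>"
| "universal (Disj \<phi> \<psi>) \<longleftrightarrow> universal \<phi> \<and> universal \<psi>"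
| "universal (Ex x \<phi>) \<longleftrightarrow> False"
| "universal (All x \<phi>) \<longleftrightarrow> universal \<phi>"

primrec sigma2 :: "'a fm \<Rightarrow> bool" where
  "sigma2 Top \<longleftrightarrow> True"
| "sigma2 Bot \<longleftrightarrow> True"
| "sigma2 (Lab x a) \<longleftrightarrow> True"
| "sigma2 (Eq x y) \<longleftrightarrow> True"
| "sigma2 (Less x y) \<longleftrightarrow> True"
| "sigma2 (Mod n i x) \<longleftrightarrow> True"
| "sigma2 (Len n i) \<longleftrightarrow> True"
| "sigma2 (Neg \<phi>) \<longleftrightarrow> False"
| "sigma2 (Conj \<phi> \<psi>) \<longleftrightarrow> sigma2 \<phi> \<and> sigma2 \<psi>"
| "sigma2 (Disj \<phi> \<psi>) \<longleftrightarrow> sigma2 \<phi> \<and> sigma2 \<psi>"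
| "sigma2 (Ex x \<phi>) \<longleftrightarrow> sigma2 \<phi>"
| "sigma2 (All x \<phi>) \<longleftrightarrow> universal \<phi>"

lemma subformulas_refl: "\<phi> \<in> subformulas \<phi>"
  by (cases \<phi>) auto

lemma subformulas_trans: "\<psi> \<in> subformulas \<phi> \<Longrightarrow> subformulas \<psi> \<subseteq> subformulas \<phi>"
  by (induction \<phi>) auto

lemma universal_iff: "universal \<phi> \<longleftrightarrow> negation_free \<phi> \<and> (\<forall>y \<chi>. Ex y \<chi> \<notin> subformulas \<phi>)"
  by (induction \<phi>) (auto simp: subformulas_refl)

lemma sigma2_iff: "sigma2 \<phi> \<longleftrightarrow> negation_free \<phi> \<and>
    (\<forall>x \<psi> y \<chi>. All x \<psi> \<in> subformulas \<phi> \<longrightarrow> Ex y \<chi> \<notin> subformulas \<psi>)"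
proof (induction \<phi>)
  case (All x \<phi>)
  show ?case
  proof
    assume "sigma2 (All x \<phi>)"
    then have "universal \<phi>" by simp
    then show "negation_free (All x \<phi>) \<and>
        (\<forall>x' \<psi> y \<chi>. All x' \<psi> \<in> subformulas (All x \<phi>) \<longrightarrow> Ex y \<chi> \<notin> subformulas \<psi>)"
      unfolding universal_iff
      by (auto dest: subformulas_trans[THEN subsetD, rotated] dest!: subformulas_trans[of "All _ _"])
  next
    assume "negation_free (All x \<phi>) \<and>
        (\<forall>x' \<psi> y \<chi>. All x' \<psi> \<in> subformulas (All x \<phi>) \<longrightarrow> Ex y \<chi> \<notin> subformulas \<psi>)"
    then show "sigma2 (All x \<phi>)" by (auto simp: universal_iff)
  qed
next
  case (Conj \<phi> \<psi>)
  then show ?case by auto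
next
  case (Disj \<phi> \<psi>)
  then show ?case by auto
qed auto

lemma Sigma2_iff: "\<phi> \<in> Sigma2_less_MOD A \<longleftrightarrow> formula_over A \<phi> \<and> sigma2 \<phi>"
  by (simp add: Sigma2_less_MOD_def sigma2_iff)

primrec depth :: "'a fm \<Rightarrow> nat" where
  "depth Top = 0"
| "depth Bot = 0"
| "depth (Lab x a) = 0"
| "depth (Eq x y) = 0"
| "depth (Less x y) = 0"
| "depth (Mod n i x) = 0"
| "depth (Len n i) = 0"
| "depth (Neg \<phi>) = depth \<phi>"
| "depth (Conj \<phi> \<psi>) = max (depth \<phi>) (depth \<psi>)"
| "depth (Disj \<phi> \<psi>) = max (depth \<phi>) (depth \<psi>)"
| "depth (Ex x \<phi>) = Suc (depth \<phi>)"
| "depth (All x \<phi>) = Suc (depth \<phi>)"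

primrec moduli_dvd :: "nat \<Rightarrow> 'a fm \<Rightarrow> bool" where
  "moduli_dvd m Top \<longleftrightarrow> True"
| "moduli_dvd m Bot \<longleftrightarrow> True"
| "moduli_dvd m (Lab x a) \<longleftrightarrow> True"
| "moduli_dvd m (Eq x y) \<longleftrightarrow> True"
| "moduli_dvd m (Less x y) \<longleftrightarrow> True"
| "moduli_dvd m (Mod n i x) \<longleftrightarrow> n dvd m"
| "moduli_dvd m (Len n i) \<longleftrightarrow> n dvd m"
| "moduli_dvd m (Neg \<phi>) \<longleftrightarrow> moduli_dvd m \<phi>"
| "moduli_dvd m (Conj \<phi> \<psi>) \<longleftrightarrow> moduli_dvd m \<phi> \<and> moduli_dvd m \<psi>"
| "moduli_dvd m (Disj \<phi> \<psi>) \<longleftrightarrow> moduli_dvd m \<phi> \<and> moduli_dvd m \<psi>"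
| "moduli_dvd m (Ex x \<phi>) \<longleftrightarrow> moduli_dvd m \<phi>"
| "moduli_dvd m (All x \<phi>) \<longleftrightarrow> moduli_dvd m \<phi>"

lemma moduli_dvd_trans: "moduli_dvd m \<phi> \<Longrightarrow> m dvd m' \<Longrightarrow> moduli_dvd m' \<phi>"
  by (induction \<phi>) (auto intro: dvd_trans)

text \<open>Products of moduli are common multiples; they are positive because every modulus in a
  formula over \<open>A\<close> is at least 1.\<close>

lemma common_modulus: "formula_over A \<phi> \<Longrightarrow> \<exists>m>0. moduli_dvd m \<phi>"
proof (induction \<phi>)
  case (Conj \<phi> \<psi>)
  then obtain m m' where "0 < m" "moduli_dvd m \<phi>" "0 < m'" "moduli_dvd m' \<psi>" by auto
  then show ?case
    using moduli_dvd_trans[of m \<phi> "m * m'"] moduli_dvd_trans[of m' \<psi> "m * m'"]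
    by (intro exI[of _ "m * m'"]) simp
next
  case (Disj \<phi> \<psi>)
  then obtain m m' where "0 < m" "moduli_dvd m \<phi>" "0 < m'" "moduli_dvd m' \<psi>" by auto
  then show ?case
    using moduli_dvd_trans[of m \<phi> "m * m'"] moduli_dvd_trans[of m' \<psi> "m * m'"]
    by (intro exI[of _ "m * m'"]) simp
next
  case (Mod m i x)
  then show ?case by (intro exI[of _ m]) simp
next
  case (Len m i)
  then show ?case by (intro exI[of _ m]) simp
qed (auto intro: exI[of _ 1])

section \<open>Words carrying residues and pebbles\<close>

text \<open>List index \<open>i\<close> is position \<open>i + 1\<close>, so a coloured word is a
  path that starts at 1.\<close>

definition coloured :: "nat \<Rightarrow> 'a list \<Rightarrow> ('a \<times> nat) list" where
  "coloured n w = map (\<lambda>i. (w ! i, Suc i mod n)) [0..<length w]"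

lemma length_coloured [simp]: "length (coloured n w) = length w"
  by (simp add: coloured_def)

lemma nth_coloured [simp]: "i < length w \<Longrightarrow> coloured n w ! i = (w ! i, Suc i mod n)"
  by (simp add: coloured_def)

lemma path_coloured: "path n 1 (coloured n w)"
  by (simp add: path_def)

lemma coloured_map_fst: "path n 1 w \<Longrightarrow> coloured n (map fst w) = w"
  by (rule nth_equalityI) (auto simp: path_def prod_eq_iff)

lemma set_coloured: "0 < n \<Longrightarrow> w \<in> lists A \<Longrightarrow> set (coloured n w) \<subseteq> A \<times> {..<n}"
  by (auto simp: coloured_def in_lists_conv_set)

text \<open>Pebbles are recorded in the letters: each position carries the set of variables placed on it.\<close>

definition marked :: "nat \<Rightarrow> 'a list \<Rightarrow> (var \<Rightarrow> nat) \<Rightarrow> var set \<Rightarrow> (('a \<times> nat) \<times> var set) list" where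
  "marked n w v X = map (\<lambda>i. ((w ! i, Suc i mod n), {x \<in> X. v x = Suc i})) [0..<length w]"

lemma length_marked [simp]: "length (marked n w v X) = length w"
  by (simp add: marked_def)

lemma nth_marked [simp]:
  "i < length w \<Longrightarrow> marked n w v X ! i = ((w ! i, Suc i mod n), {x \<in> X. v x = Suc i})"
  by (simp add: marked_def)

lemma marked_empty: "marked n w v {} = map (\<lambda>b. (b, {})) (coloured n w)"
  by (simp add: marked_def coloured_def)

lemma marked_restrict: "Y \<subseteq> X \<Longrightarrow> marked n w v Y = map (\<lambda>(b, S). (b, S \<inter> Y)) (marked n w v X)"
  by (auto simp: marked_def)

text \<open>As \<open>x\<close> had no recorded place, a new pebble changes a single letter and
  leaves the factors around it intact. This translates a round of the game into placing a
  pebble.\<close>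

lemma marked_insert:
  assumes "x \<notin> X" "marked n w v X = W1 @ (b, S) # W2"
  shows "marked n w (v(x := Suc (length W1))) (insert x X) = W1 @ (b, insert x S) # W2"
proof -
  let ?i = "length W1"
  have len: "length w = Suc (length W1 + length W2)"
    using arg_cong[OF assms(2), of length] by simp
  have "marked n w (v(x := Suc ?i)) (insert x X) = (marked n w v X)[?i := (b, insert x S)]"
  proof (rule nth_equalityI)
    fix i
    assume "i < length (marked n w (v(x := Suc ?i)) (insert x X))"
    then have i: "i < length w" by simp
    have "(b, S) = marked n w v X ! ?i" using assms(2) by simp
    then have "b = (w ! ?i, Suc ?i mod n)" "S = {y \<in> X. v y = Suc ?i}"
      using len by simp_all
    moreover have "?i < length (marked n w v X)" using len by simp
    ultimately show "marked n w (v(x := Suc ?i)) (insert x X) ! i =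
        (marked n w v X)[?i := (b, insert x S)] ! i"
      using i assms(1) by (auto simp: nth_list_update)
  qed simp
  then show ?thesis using assms(2) by simp
qed

lemma marked_split:
  assumes "p \<in> {1..length w}"
  obtains W1 b S W2 where "marked n w v X = W1 @ (b, S) # W2" "p = Suc (length W1)"
proof -
  from assms have p: "p - 1 < length (marked n w v X)" "p = Suc (p - 1)" by auto
  obtain b S where "marked n w v X ! (p - 1) = (b, S)" by fastforce
  with id_take_nth_drop[OF p(1)] p show thesis
    by (intro that[of "take (p - 1) (marked n w v X)" b S "drop (Suc (p - 1)) (marked n w v X)"])
      simp_all
qed

lemma le_marked_restrict:
  "le l k (marked n u v X) (marked n w v' X) \<Longrightarrow> Y \<subseteq> X \<Longrightarrow>
    le l k (marked n u v Y) (marked n w v' Y)"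
  by (simp add: marked_restrict[of Y X] le_map)

text \<open>After the round, the chosen letter is put back with \<open>x\<close> added to its mark
  on both sides, and compatibility with concatenation reassembles the words.\<close>

lemma le_marked_ex:
  assumes "le l (Suc k) (marked n u v X) (marked n w v' X)" "p \<in> {1..length u}" "x \<notin> X"
  obtains q where "q \<in> {1..length w}"
    "le l k (marked n u (v(x := p)) (insert x X)) (marked n w (v'(x := q)) (insert x X))"
proof -
  obtain U1 b S U2 where U: "marked n u v X = U1 @ (b, S) # U2" "p = Suc (length U1)"
    using assms(2) by (rule marked_split)
  with assms(1) obtain W1 W2 where W: "marked n w v' X = W1 @ (b, S) # W2"
    "le l k U1 W1" "le l k U2 W2"
    by (metis le_SucE)
  have "le l k (U1 @ [(b, insert x S)] @ U2) (W1 @ [(b, insert x S)] @ W2)"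
    by (intro le_append le_refl W)
  moreover have "Suc (length W1) \<in> {1..length w}"
    using arg_cong[OF W(1), of length] by simp
  ultimately show thesis
    using U(2) marked_insert[OF assms(3) U(1)] marked_insert[OF assms(3) W(1)]
    by (intro that[of "Suc (length W1)"]) simp_all
qed

lemma uni_marked_all:
  assumes "uni (Suc l) (marked n u v X) (marked n w v' X)" "q \<in> {1..length w}" "x \<notin> X"
  obtains p where "p \<in> {1..length u}"
    "uni l (marked n u (v(x := p)) (insert x X)) (marked n w (v'(x := q)) (insert x X))"
proof -
  obtain W1 b S W2 where W: "marked n w v' X = W1 @ (b, S) # W2" "q = Suc (length W1)"
    using assms(2) by (rule marked_split)
  with assms(1) obtain U1 U2 where U: "marked n u v X = U1 @ (b, S) # U2"
    "uni l U1 W1" "uni l U2 W2"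
    by (metis uni_SucE)
  have "uni l (U1 @ [(b, insert x S)] @ U2) (W1 @ [(b, insert x S)] @ W2)"
    by (intro uni_append uni_refl U)
  moreover have "Suc (length U1) \<in> {1..length u}"
    using arg_cong[OF U(1), of length] by simp
  ultimately show thesis
    using W(2) marked_insert[OF assms(3) U(1)] marked_insert[OF assms(3) W(1)]
    by (intro that[of "Suc (length U1)"]) simp_all
qed

text \<open>One round suffices: the marked letter at \<open>v' x\<close> must occur in the other
  word, and since its mark contains \<open>x\<close>, it can only stand at
  \<open>v x\<close>.\<close>

lemma uni_marked_letter:
  assumes "uni (Suc l) (marked n u v X) (marked n w v' X)" "x \<in> X" "v' x \<in> {1..length w}"
  shows "u ! (v x - 1) = w ! (v' x - 1)" "[v x = v' x] (mod n)"
    "{y \<in> X. v y = v x} = {y \<in> X. v' y = v' x}"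
proof -
  have "marked n w v' X ! (v' x - 1) \<in> set (marked n w v' X)"
    using assms(3) by (intro nth_mem) auto
  with uni_set[OF assms(1)] have "marked n w v' X ! (v' x - 1) \<in> set (marked n u v X)" by blast
  then obtain i where i: "i < length u" "marked n u v X ! i = marked n w v' X ! (v' x - 1)"
    by (metis in_set_conv_nth length_marked)
  have eq: "marked n w v' X ! (v' x - 1) =
      ((w ! (v' x - 1), v' x mod n), {y \<in> X. v' y = v' x})"
    using assms(3) by (subst nth_marked) auto
  from i eq have S: "{y \<in> X. v y = Suc i} = {y \<in> X. v' y = v' x}" by simp
  with assms(2) have x: "v x = Suc i" by blast
  with S show "{y \<in> X. v y = v x} = {y \<in> X. v' y = v' x}" by simp
  show "u ! (v x - 1) = w ! (v' x - 1)" "[v x = v' x] (mod n)"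
    using i eq x by (auto simp: cong_def)
qed

text \<open>Two rounds are used: the first cuts both words at \<open>x\<close>, the second finds the
  mark of \<open>y\<close> in the right factors. This is the origin of the summand 2 in the budgets
  of the preservation lemmas.\<close>

lemma uni_marked_less:
  assumes "uni (Suc (Suc l)) (marked n u v X) (marked n w v' X)"
    and "x \<in> X" "v' x \<in> {1..length w}" "y \<in> X" "v' y \<in> {1..length w}" "v' x < v' y"
  shows "v x < v y"
proof -
  obtain W1 b S W2 where W: "marked n w v' X = W1 @ (b, S) # W2" "v' x = Suc (length W1)"
    using assms(3) by (rule marked_split)
  with assms(1) obtain U1 U2 where U: "marked n u v X = U1 @ (b, S) # U2"
    "uni (Suc l) U1 W1" "uni (Suc l) U2 W2"
    by (metis uni_SucE)
  have len: "length w = Suc (length W1 + length W2)" "length u = Suc (length U1 + length U2)"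
    using arg_cong[OF W(1), of length] arg_cong[OF U(1), of length] by simp_all
  have "(b, S) = marked n w v' X ! length W1" using W(1) by simp
  then have "x \<in> S" using W(2) len assms(2) by auto
  moreover have "(b, S) = marked n u v X ! length U1" using U(1) by simp
  ultimately have x: "v x = Suc (length U1)" using len by auto
  define j where "j = v' y - 1 - Suc (length W1)"
  have j: "j < length W2" "W2 ! j = marked n w v' X ! (v' y - 1)"
    using assms(5,6) W len unfolding j_def by (auto simp: nth_append nth_Cons' simp del: nth_marked)
  have "W2 ! j \<in> set U2" using nth_mem[OF j(1)] uni_set[OF U(3)] by blast
  then obtain i where i: "i < length U2" "U2 ! i = W2 ! j" by (auto simp: in_set_conv_nth)
  then have "marked n u v X ! (Suc (length U1) + i) = marked n w v' X ! (v' y - 1)"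
    using U(1) j by (simp add: nth_append del: nth_marked)
  then have "{z \<in> X. v z = Suc (Suc (length U1) + i)} = {z \<in> X. v' z = v' y}"
    using i len assms(5) by (subst (asm) nth_marked nth_marked; auto)
  with assms(4) have "v y = Suc (Suc (length U1) + i)" by blast
  with x show ?thesis by simp
qed

text \<open>The slack \<open>l\<close> absorbs the difference between the depth of a conjunction or
  disjunction and the depths of its parts.\<close>

lemma universal_preserved:
  assumes "universal \<phi>" "moduli_dvd n \<phi>" "[length u = length w] (mod n)"
    and "uni (depth \<phi> + l + 2) (marked n u v X) (marked n w v' X)" "free_vars \<phi> \<subseteq> X"
    and "\<And>x. x \<in> X \<Longrightarrow> v x \<in> {1..length u} \<and> v' x \<in> {1..length w}"
    and "sat u v \<phi>"
  shows "sat w v' \<phi>"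
  using assms
proof (induction \<phi> arbitrary: v v' X l)
  case (Lab x a)
  with uni_marked_letter[of _ n u v X w v' x] show ?case by simp
next
  case (Eq x y)
  then have "{z \<in> X. v z = v x} = {z \<in> X. v' z = v' x}"
    by (intro uni_marked_letter(3)[of "Suc l"]) auto
  moreover have "y \<in> {z \<in> X. v z = v x}" using Eq.prems by auto
  ultimately show ?case by simp
next
  case (Less x y)
  then have "{z \<in> X. v z = v x} = {z \<in> X. v' z = v' x}"
    by (intro uni_marked_letter(3)[of "Suc l"]) auto
  moreover have "y \<in> X" "y \<notin> {z \<in> X. v z = v x}" using Less.prems by auto
  ultimately have "v' y \<noteq> v' x" by blast
  \<comment> \<open>Order is transferred only from \<open>w\<close> to \<open>u\<close>. Trichotomy
    turns this around, equality having been excluded by the marks.\<close>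
  with Less uni_marked_less[of l n u v X w v' y x] show ?case
    by (cases "v' x" "v' y" rule: linorder_cases) auto
next
  case (Mod m i x)
  then have "[v x = v' x] (mod n)"
    using uni_marked_letter[of _ n u v X w v' x] by simp
  with Mod have "[v x = v' x] (mod m)" by (auto intro: cong_dvd_modulus_nat)
  with Mod show ?case by (simp add: cong_int_iff[symmetric]) (metis cong_sym cong_trans)
next
  case (Len m i)
  then have "[length u = length w] (mod m)" by (auto intro: cong_dvd_modulus_nat)
  with Len show ?case by (simp add: cong_int_iff[symmetric]) (metis cong_sym cong_trans)
next
  case (Conj \<phi> \<psi>)
  have "sat w v' \<phi>"
    using Conj.prems by (intro Conj.IH(1)[of "max (depth \<phi>) (depth \<psi>) - depth \<phi> + l" v X v']) auto
  moreover have "sat w v' \<psi>"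
    using Conj.prems by (intro Conj.IH(2)[of "max (depth \<phi>) (depth \<psi>) - depth \<psi> + l" v X v']) auto
  ultimately show ?case by simp
next
  case (Disj \<phi> \<psi>)
  have "sat w v' \<phi>" if "sat u v \<phi>"
    using that Disj.prems by (intro Disj.IH(1)[of "max (depth \<phi>) (depth \<psi>) - depth \<phi> + l" v X v']) auto
  moreover have "sat w v' \<psi>" if "sat u v \<psi>"
    using that Disj.prems by (intro Disj.IH(2)[of "max (depth \<phi>) (depth \<psi>) - depth \<psi> + l" v X v']) auto
  ultimately show ?case using Disj.prems by auto
next
  case (All x \<phi>)
  have "sat w (v'(x := q)) \<phi>" if q: "q \<in> {1..length w}" for q
  proof -
    \<comment> \<open>A requantified \<open>x\<close> loses its old mark before the new pebble is
      placed.\<close>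
    have "uni (Suc (depth \<phi> + l + 2)) (marked n u v (X - {x})) (marked n w v' (X - {x}))"
      using All.prems(4) le_marked_restrict[of _ 0 n u v X w v' "X - {x}"] by simp
    then obtain p where p: "p \<in> {1..length u}"
      "uni (depth \<phi> + l + 2) (marked n u (v(x := p)) (insert x (X - {x})))
         (marked n w (v'(x := q)) (insert x (X - {x})))"
      using q by (rule uni_marked_all) auto
    have "sat u (v(x := p)) \<phi>" using All.prems(7) p(1) by simp
    show ?thesis
      by (rule All.IH[OF _ _ _ p(2) _ _ \<open>sat u (v(x := p)) \<phi>\<close>]) (use All.prems p(1) q in auto)
  qed
  then show ?case by simp
qed simp_all

lemma sigma2_preserved:
  assumes "sigma2 \<phi>" "moduli_dvd n \<phi>" "[length u = length w] (mod n)"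
    and "le (depth \<phi> + l + 2) (depth \<phi> + k) (marked n u v X) (marked n w v' X)" "free_vars \<phi> \<subseteq> X"
    and "\<And>x. x \<in> X \<Longrightarrow> v x \<in> {1..length u} \<and> v' x \<in> {1..length w}"
    and "sat u v \<phi>"
  shows "sat w v' \<phi>"
  using assms
proof (induction \<phi> arbitrary: v v' X l k)
  case (Conj \<phi> \<psi>)
  let ?d = "max (depth \<phi>) (depth \<psi>)"
  have "sat w v' \<phi>"
    using Conj.prems by (intro Conj.IH(1)[of "?d - depth \<phi> + l" "?d - depth \<phi> + k" v X v']) auto
  moreover have "sat w v' \<psi>"
    using Conj.prems by (intro Conj.IH(2)[of "?d - depth \<psi> + l" "?d - depth \<psi> + k" v X v']) auto
  ultimately show ?case by simp
next
  case (Disj \<phi> \<psi>)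
  let ?d = "max (depth \<phi>) (depth \<psi>)"
  have "sat w v' \<phi>" if "sat u v \<phi>"
    using that Disj.prems by (intro Disj.IH(1)[of "?d - depth \<phi> + l" "?d - depth \<phi> + k" v X v']) auto
  moreover have "sat w v' \<psi>" if "sat u v \<psi>"
    using that Disj.prems by (intro Disj.IH(2)[of "?d - depth \<psi> + l" "?d - depth \<psi> + k" v X v']) auto
  ultimately show ?case using Disj.prems by auto
next
  case (Ex x \<phi>)
  from Ex.prems(7) obtain p where p: "p \<in> {1..length u}" "sat u (v(x := p)) \<phi>" by auto
  \<comment> \<open>An existential quantifier spends a round of the first phase only; since the
    depth drops, the other budget gains one unit of slack.\<close>
  have "le (depth \<phi> + Suc l + 2) (Suc (depth \<phi> + k)) (marked n u v (X - {x})) (marked n w v' (X - {x}))"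
    using Ex.prems(4) le_marked_restrict[of _ _ n u v X w v' "X - {x}"] by simp
  then obtain q where q: "q \<in> {1..length w}"
    "le (depth \<phi> + Suc l + 2) (depth \<phi> + k) (marked n u (v(x := p)) (insert x (X - {x})))
       (marked n w (v'(x := q)) (insert x (X - {x})))"
    using p(1) by (rule le_marked_ex) auto
  have "sat w (v'(x := q)) \<phi>"
    by (rule Ex.IH[OF _ _ _ q(2) _ _ p(2)]) (use Ex.prems p(1) q in auto)
  with q show ?case by auto
next
  case (All x \<phi>)
  then show ?case
    using universal_preserved[of "All x \<phi>" n u w l v X v'] le_uni by fastforce
next
  case (Neg \<phi>)
  then show ?case by simp
qed (use le_uni universal_preserved in \<open>(metis universal.simps)+\<close>)

theorem sigma2_sentence_preserved:
  assumes "sigma2 \<phi>" "moduli_dvd n \<phi>" "sentence \<phi>" "[length u = length w] (mod n)"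
    and "le (depth \<phi> + l + 2) (depth \<phi> + k) (coloured n u) (coloured n w)" "models u \<phi>"
  shows "models w \<phi>"
proof -
  have "le (depth \<phi> + l + 2) (depth \<phi> + k) (marked n u v {}) (marked n w v {})" for v
    using le_map[OF assms(5)] by (simp add: marked_empty)
  from sigma2_preserved[OF assms(1,2,4) this] assms(3,6) show ?thesis
    unfolding models_def by blast
qed

section \<open>Rankers and two-variable formulas\<close>

text \<open>The outermost constructor is the last instruction carried out; a run starts beyond
  either end of the word.\<close>

datatype 'b ranker = Start | End | Nxt 'b "'b ranker" | Prv 'b "'b ranker"

text \<open>The positions \<open>0\<close> and \<open>length w + 1\<close> serve as sentinels.\<close>

primrec reaches :: "'b list \<Rightarrow> 'b ranker \<Rightarrow> nat \<Rightarrow> bool" where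
  "reaches w Start p \<longleftrightarrow> p = 0"
| "reaches w End p \<longleftrightarrow> p = Suc (length w)"
| "reaches w (Nxt b r) p \<longleftrightarrow> p \<in> {1..length w} \<and> w ! (p - 1) = b \<and>
     (\<exists>i<p. reaches w r i \<and> (\<forall>q. i < q \<and> q < p \<longrightarrow> w ! (q - 1) \<noteq> b))"
| "reaches w (Prv b r) p \<longleftrightarrow> p \<in> {1..length w} \<and> w ! (p - 1) = b \<and>
     (\<exists>i>p. reaches w r i \<and> (\<forall>q. p < q \<and> q < i \<longrightarrow> w ! (q - 1) \<noteq> b))"

lemma reaches_unique: "reaches w r p \<Longrightarrow> reaches w r q \<Longrightarrow> p = q"
proof (induction r arbitrary: p q)
  case (Nxt b r)
  from Nxt.prems obtain i j where i: "i < p" "reaches w r i" "\<forall>k. i < k \<and> k < p \<longrightarrow> w ! (k - 1) \<noteq> b"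
    and j: "j < q" "reaches w r j" "\<forall>k. j < k \<and> k < q \<longrightarrow> w ! (k - 1) \<noteq> b"
    and b: "w ! (p - 1) = b" "w ! (q - 1) = b"
    by auto
  have "i = j" using i j by (intro Nxt.IH)
  with i j b show ?case by (cases p q rule: linorder_cases) blast+
next
  case (Prv b r)
  from Prv.prems obtain i j where i: "p < i" "reaches w r i" "\<forall>k. p < k \<and> k < i \<longrightarrow> w ! (k - 1) \<noteq> b"
    and j: "q < j" "reaches w r j" "\<forall>k. q < k \<and> k < j \<longrightarrow> w ! (k - 1) \<noteq> b"
    and b: "w ! (p - 1) = b" "w ! (q - 1) = b"
    by auto
  have "i = j" using i j by (intro Prv.IH)
  with i j b show ?case by (cases p q rule: linorder_cases) blast+
qed simp_all

lemma reaches_range: "reaches w r p \<Longrightarrow> p \<in> {1..length w} \<or> r = Start \<and> p = 0 \<or> r = End \<and> p = Suc (length w)"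
  by (cases r) auto

lemma reaches_le: "reaches w r p \<Longrightarrow> p \<le> Suc (length w)"
  using reaches_range[of w r p] by auto

lemma reaches_Nxt_ex:
  assumes "reaches w r i" "i < p" "p \<in> {1..length w}"
  obtains q where "reaches w (Nxt (w ! (p - 1)) r) q" "i < q" "q \<le> p"
proof -
  define P where "P = (\<lambda>q. i < q \<and> q \<le> p \<and> w ! (q - 1) = w ! (p - 1))"
  have "P p" using assms by (simp add: P_def)
  define q where "q = (LEAST q. P q)"
  have q: "P q" unfolding q_def using \<open>P p\<close> by (rule LeastI)
  have "\<not> P k" if "k < q" for k
    using that unfolding q_def by (rule not_less_Least)
  then have "\<forall>k. i < k \<and> k < q \<longrightarrow> w ! (k - 1) \<noteq> w ! (p - 1)"
    using q by (auto simp: P_def)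
  with q assms have "reaches w (Nxt (w ! (p - 1)) r) q"
    by (auto simp: P_def)
  then show thesis using q that unfolding P_def by blast
qed

lemma reaches_Prv_ex:
  assumes "reaches w r i" "p < i" "p \<in> {1..length w}"
  obtains q where "reaches w (Prv (w ! (p - 1)) r) q" "q < i" "p \<le> q"
proof -
  define P where "P = (\<lambda>q. q < i \<and> p \<le> q \<and> w ! (q - 1) = w ! (p - 1))"
  have "P p" using assms by (simp add: P_def)
  have bound: "\<And>k. P k \<Longrightarrow> k \<le> i" by (simp add: P_def)
  define q where "q = (GREATEST q. P q)"
  have q: "P q" unfolding q_def using \<open>P p\<close> bound by (rule GreatestI_nat)
  have greatest: "k \<le> q" if "P k" for k
    using that bound unfolding q_def by (rule Greatest_le_nat)
  have "w ! (k - 1) \<noteq> w ! (p - 1)" if "q < k" "k < i" for k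
  proof
    assume "w ! (k - 1) = w ! (p - 1)"
    with that q have "P k" by (simp add: P_def)
    with greatest that show False by (simp add: leD)
  qed
  moreover have "q \<le> length w"
    using q reaches_le[OF assms(1)] by (simp add: P_def)
  ultimately have "reaches w (Prv (w ! (p - 1)) r) q"
    using q assms by (auto simp: P_def)
  then show thesis using q that unfolding P_def by blast
qed

section \<open>Comparing words through their rankers\<close>

text \<open>The relation fails for undefined rankers, so \<open>before w Start r\<close> tests
  whether \<open>r\<close>, if other than \<open>Start\<close>, is defined. Agreement on it
  therefore covers definedness as well as order.\<close>

definition before :: "'b list \<Rightarrow> 'b ranker \<Rightarrow> 'b ranker \<Rightarrow> bool" where
  "before w r s \<longleftrightarrow> (\<exists>p q. reaches w r p \<and> reaches w s q \<and> p < q)"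

primrec rankers :: "'b set \<Rightarrow> nat \<Rightarrow> 'b ranker set" where
  "rankers B 0 = {Start, End}"
| "rankers B (Suc m) = rankers B m \<union> (\<lambda>(b, r). Nxt b r) ` (B \<times> rankers B m)
     \<union> (\<lambda>(b, r). Prv b r) ` (B \<times> rankers B m)"

lemma finite_rankers: "finite B \<Longrightarrow> finite (rankers B m)"
  by (induction m) auto

lemma rankers_mono: "i \<le> m \<Longrightarrow> rankers B i \<subseteq> rankers B m"
  by (induction m) (auto simp: le_Suc_eq)

lemma Start_End_rankers: "Start \<in> rankers B m" "End \<in> rankers B m"
  by (induction m) auto

definition ranker_equiv :: "'b set \<Rightarrow> nat \<Rightarrow> 'b list \<Rightarrow> 'b list \<Rightarrow> bool" where
  "ranker_equiv B m u v \<longleftrightarrow> (\<forall>r\<in>rankers B m. \<forall>s\<in>rankers B m. before u r s \<longleftrightarrow> before v r s)"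

lemma ranker_equiv_sym: "ranker_equiv B m u v \<Longrightarrow> ranker_equiv B m v u"
  by (simp add: ranker_equiv_def)

lemma ranker_equiv_mono: "ranker_equiv B m u v \<Longrightarrow> i \<le> m \<Longrightarrow> ranker_equiv B i u v"
  using rankers_mono[of i m B] unfolding ranker_equiv_def by blast

lemma ranker_equiv_defined:
  assumes "ranker_equiv B m u v" "r \<in> rankers B m" "reaches u r p"
  obtains q where "reaches v r q"
proof (cases "r = Start")
  case True
  then show thesis using that by simp
next
  case False
  with reaches_range[OF assms(3)] have "before u Start r"
    using assms(3) by (auto simp: before_def)
  with assms have "before v Start r"
    using Start_End_rankers(1) unfolding ranker_equiv_def by blast
  then show thesis using that by (auto simp: before_def)
qed

lemma ranker_equiv_less:
  assumes "ranker_equiv B m u v" "r \<in> rankers B m" "s \<in> rankers B m"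
    and "reaches u r p" "reaches u s p'" "reaches v r q" "reaches v s q'"
  shows "p < p' \<longleftrightarrow> q < q'"
proof -
  have "before w r s \<longleftrightarrow> x < y" if "reaches w r x" "reaches w s y" for w :: "'a list" and x y
    using that reaches_unique unfolding before_def by metis
  with assms show ?thesis unfolding ranker_equiv_def by metis
qed

text \<open>The two strict comparisons together also record whether the ranker reaches the position
  itself.\<close>

definition same_side :: "'b set \<Rightarrow> nat \<Rightarrow> 'b list \<Rightarrow> nat \<Rightarrow> 'b list \<Rightarrow> nat \<Rightarrow> bool" where
  "same_side B m u p v q \<longleftrightarrow> (\<forall>r\<in>rankers B m. \<forall>i j. reaches u r i \<longrightarrow> reaches v r j \<longrightarrow>
     (i < p \<longleftrightarrow> j < q) \<and> (p < i \<longleftrightarrow> q < j))"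

lemma same_side_sym: "same_side B m u p v q \<Longrightarrow> same_side B m v q u p"
  unfolding same_side_def by blast

lemma same_side_mono: "same_side B m u p v q \<Longrightarrow> i \<le> m \<Longrightarrow> same_side B i u p v q"
  using rankers_mono[of i m B] unfolding same_side_def by blast

lemma same_side_reaches:
  assumes "ranker_equiv B m u v" "r \<in> rankers B m" "reaches u r p" "reaches v r q"
  shows "same_side B m u p v q"
  using assms ranker_equiv_less[OF assms(1)] unfolding same_side_def by blast

lemma same_side_range:
  assumes "same_side B m u p v q" "p \<in> {1..length u}"
  shows "q \<in> {1..length v}"
proof -
  have "0 < p \<longleftrightarrow> 0 < q" "p < Suc (length u) \<longleftrightarrow> q < Suc (length v)"
    using assms(1) Start_End_rankers[of B m] unfolding same_side_def by (metis reaches.simps)+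
  with assms(2) show ?thesis by auto
qed

lemma reaches_letter:
  assumes "reaches u r p" "reaches v r q" "p \<in> {1..length u}"
  shows "q \<in> {1..length v}" "u ! (p - 1) = v ! (q - 1)"
  using assms by (cases r; auto)+

text \<open>Duplicator's answer to a pebble at \<open>p\<close> while the other one stands at
  \<open>i\<close>. If no short ranker reaches \<open>p\<close>, the letter of \<open>p\<close> is
  sought by one more instruction from the nearest short ranker point. It is found between that point
  and \<open>p\<close>, where no short ranker can tell the found position from \<open>p\<close>.
  Starting from the side of \<open>p\<close> away from \<open>i\<close> keeps the found position on
  the same side of \<open>i\<close> as \<open>p\<close>.\<close>

lemma ranker_extend:
  assumes B: "set u \<subseteq> B" and equiv: "ranker_equiv B (Suc m) u v"
    and side: "same_side B (Suc m) u i v j"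
    and letter: "i \<in> {1..length u} \<Longrightarrow> u ! (i - 1) = v ! (j - 1)"
    and p: "p \<in> {1..length u}"
  obtains q where "q \<in> {1..length v}" "u ! (p - 1) = v ! (q - 1)" "same_side B m u p v q"
    "p < i \<longleftrightarrow> q < j" "i < p \<longleftrightarrow> j < q"
proof -
  have m: "rankers B m \<subseteq> rankers B (Suc m)" by (rule rankers_mono) simp
  have b: "u ! (p - 1) \<in> B" using B p by (meson nth_mem atLeastAtMost_iff less_le_trans subsetD diff_less zero_less_one)
  have lin: "same_side B m u p v q"
    if 1: "\<And>r i' j'. r \<in> rankers B m \<Longrightarrow> reaches u r i' \<Longrightarrow> reaches v r j' \<Longrightarrow> i' \<noteq> p"
      "\<And>r i' j'. r \<in> rankers B m \<Longrightarrow> reaches u r i' \<Longrightarrow> reaches v r j' \<Longrightarrow> i' < p \<Longrightarrow> j' < q"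
      "\<And>r i' j'. r \<in> rankers B m \<Longrightarrow> reaches u r i' \<Longrightarrow> reaches v r j' \<Longrightarrow> p < i' \<Longrightarrow> q < j'" for q
    unfolding same_side_def by (metis 1 linorder_neqE_nat order_less_asym)
  consider "p = i" | r where "p \<noteq> i" "r \<in> rankers B m" "reaches u r p"
    | "p < i" "\<not> (\<exists>r\<in>rankers B m. reaches u r p)"
    | "i < p" "\<not> (\<exists>r\<in>rankers B m. reaches u r p)"
    by (metis linorder_neqE_nat)
  then show thesis
  proof cases
    case 1
    with that[of j] show thesis
      using same_side_range[OF side] letter p same_side_mono[OF side, of m] by auto
  next
    case (2 r)
    with m have r: "r \<in> rankers B (Suc m)" by blast
    with equiv 2 obtain q where q: "reaches v r q" by (metis ranker_equiv_defined)
    have "p < i \<longleftrightarrow> q < j" "i < p \<longleftrightarrow> j < q"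
      using side r 2 q unfolding same_side_def by blast+
    moreover have "same_side B m u p v q"
      using ranker_equiv_mono[OF equiv, of m] 2 q by (auto intro: same_side_reaches)
    ultimately show thesis
      using that reaches_letter[OF 2(3) q p] by blast
  next
    case 3
    \<comment> \<open>Short ranker points to the left of \<open>p\<close>; \<open>Start\<close>
      keeps this set nonempty.\<close>
    define K where "K = {k. k < p \<and> (\<exists>r\<in>rankers B m. reaches u r k)}"
    have "finite K" "0 \<in> K"
      using p Start_End_rankers(1)[of B m] by (auto simp: K_def intro: bexI[of _ Start])
    define k where "k = Max K"
    have "k \<in> K" unfolding k_def using \<open>finite K\<close> \<open>0 \<in> K\<close> by (intro Max_in) auto
    then obtain r where r: "k < p" "r \<in> rankers B m" "reaches u r k" by (auto simp: K_def)
    have max: "k' \<le> k" if "k' \<in> K" for k'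
      unfolding k_def using \<open>finite K\<close> that by (rule Max_ge)
    let ?r = "Nxt (u ! (p - 1)) r"
    obtain q' where q': "reaches u ?r q'" "k < q'" "q' \<le> p"
      using r(3,1) p by (rule reaches_Nxt_ex)
    have r': "?r \<in> rankers B (Suc m)" using b r(2) by auto
    with equiv q' obtain q where q: "reaches v ?r q" by (metis ranker_equiv_defined)
    have side': "same_side B (Suc m) u q' v q"
      using equiv r' q'(1) q by (rule same_side_reaches)
    \<comment> \<open>From \<open>q' \<le> p < i\<close>, transferred by the side condition on
      \<open>i\<close> at level \<open>Suc m\<close>.\<close>
    have "q < j" using side r' q' q 3 unfolding same_side_def by (meson le_less_trans)
    moreover have "same_side B m u p v q"
    proof (rule lin)
      fix s i' j'
      assume s: "s \<in> rankers B m" "reaches u s i'" "reaches v s j'"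
      then show "i' \<noteq> p" using 3 by blast
      have s': "i' < q' \<longleftrightarrow> j' < q" "q' < i' \<longleftrightarrow> q < j'"
        using side' s m unfolding same_side_def by blast+
      show "j' < q" if "i' < p"
      proof -
        have "i' \<in> K" using s that by (auto simp: K_def)
        then have "i' < q'" using max q'(2) by (blast intro: le_less_trans)
        then show ?thesis using s' by simp
      qed
      show "q < j'" if "p < i'"
        using s' that q'(3) by auto
    qed
    ultimately show thesis
      using that[of q] q 3 by auto
  next
    case 4
    \<comment> \<open>Here the approach is from the right, with \<open>End\<close> guaranteeing a
      starting point.\<close>
    define K where "K = {k. p < k \<and> (\<exists>r\<in>rankers B m. reaches u r k)}"
    have "finite K"
      by (rule finite_subset[of _ "{..Suc (length u)}"]) (auto simp: K_def dest: reaches_le)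
    have "Suc (length u) \<in> K"
      using p Start_End_rankers(2)[of B m] by (auto simp: K_def intro: bexI[of _ End])
    define k where "k = Min K"
    have "k \<in> K" unfolding k_def using \<open>finite K\<close> \<open>Suc (length u) \<in> K\<close> by (intro Min_in) auto
    then obtain r where r: "p < k" "r \<in> rankers B m" "reaches u r k" by (auto simp: K_def)
    have min: "k \<le> k'" if "k' \<in> K" for k'
      unfolding k_def using \<open>finite K\<close> that by (rule Min_le)
    let ?r = "Prv (u ! (p - 1)) r"
    obtain q' where q': "reaches u ?r q'" "q' < k" "p \<le> q'"
      using r(3,1) p by (rule reaches_Prv_ex)
    have r': "?r \<in> rankers B (Suc m)" using b r(2) by auto
    with equiv q' obtain q where q: "reaches v ?r q" by (metis ranker_equiv_defined)
    have side': "same_side B (Suc m) u q' v q"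
      using equiv r' q'(1) q by (rule same_side_reaches)
    have "j < q" using side r' q' q 4 unfolding same_side_def by (meson less_le_trans)
    moreover have "same_side B m u p v q"
    proof (rule lin)
      fix s i' j'
      assume s: "s \<in> rankers B m" "reaches u s i'" "reaches v s j'"
      then show "i' \<noteq> p" using 4 by blast
      have s': "i' < q' \<longleftrightarrow> j' < q" "q' < i' \<longleftrightarrow> q < j'"
        using side' s m unfolding same_side_def by blast+
      show "q < j'" if "p < i'"
      proof -
        have "i' \<in> K" using s that by (auto simp: K_def)
        then have "q' < i'" using min q'(2) by (blast intro: less_le_trans)
        then show ?thesis using s' by simp
      qed
      show "j' < q" if "i' < p"
        using s' that q'(3) by auto
    qed
    ultimately show thesis
      using that[of q] q 4 by auto
  qed
qed

section \<open>The two-pebble game\<close>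

definition pebbles_equiv :: "'a set \<Rightarrow> nat \<Rightarrow> nat \<Rightarrow> var set \<Rightarrow>
    'a list \<Rightarrow> (var \<Rightarrow> nat) \<Rightarrow> 'a list \<Rightarrow> (var \<Rightarrow> nat) \<Rightarrow> bool" where
  "pebbles_equiv A n m X u v w v' \<longleftrightarrow>
     (\<forall>x\<in>X. v x \<in> {1..length u} \<and> v' x \<in> {1..length w} \<and>
        coloured n u ! (v x - 1) = coloured n w ! (v' x - 1) \<and>
        same_side (A \<times> {..<n}) m (coloured n u) (v x) (coloured n w) (v' x)) \<and>
     (\<forall>x\<in>X. \<forall>y\<in>X. v x < v y \<longleftrightarrow> v' x < v' y)"

lemma pebbles_equiv_sym: "pebbles_equiv A n m X u v w v' \<Longrightarrow> pebbles_equiv A n m X w v' u v"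
  by (auto simp: pebbles_equiv_def dest: same_side_sym)

lemma pebbles_equiv_subset: "pebbles_equiv A n m X u v w v' \<Longrightarrow> Y \<subseteq> X \<Longrightarrow> pebbles_equiv A n m Y u v w v'"
  unfolding pebbles_equiv_def by blast

text \<open>The point where two variables matter: when one pebble moves, at most one other stays, so
  the answer must respect the order with a single position, which \<open>ranker_extend\<close>
  achieves.\<close>

lemma pebbles_equiv_extend:
  assumes "0 < n" "u \<in> lists A" "ranker_equiv (A \<times> {..<n}) (Suc m) (coloured n u) (coloured n w)"
    and eq: "pebbles_equiv A n (Suc m) (X - {x}) u v w v'"
    and X: "X \<subseteq> {0, 1}" "x \<in> {0, 1}" and p: "p \<in> {1..length u}"
  obtains q where "q \<in> {1..length w}" "pebbles_equiv A n m X u (v(x := p)) w (v'(x := q))"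
proof -
  let ?B = "A \<times> {..<n}" and ?u = "coloured n u" and ?w = "coloured n w"
  define y where "y = 1 - x"
  have y: "X - {x} \<subseteq> {y}" "y \<noteq> x" using X by (auto simp: y_def)
  \<comment> \<open>If no other pebble is placed, the sentinel 0 takes its role;
    \<open>Start\<close> reaches it in both words.\<close>
  define i where "i = (if y \<in> X then v y else 0)"
  define j where "j = (if y \<in> X then v' y else 0)"
  have zero: "same_side ?B (Suc m) ?u 0 ?w 0"
    using assms(3) Start_End_rankers(1) by (rule same_side_reaches) simp_all
  have "same_side ?B (Suc m) ?u i ?w j"
    using eq y zero unfolding i_def j_def pebbles_equiv_def by auto
  moreover have "?u ! (i - 1) = ?w ! (j - 1)" if "i \<in> {1..length ?u}"
    using eq y that unfolding i_def j_def pebbles_equiv_def by (auto split: if_splits)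
  ultimately obtain q where q: "q \<in> {1..length ?w}" "?u ! (p - 1) = ?w ! (q - 1)"
    "same_side ?B m ?u p ?w q" "p < i \<longleftrightarrow> q < j" "i < p \<longleftrightarrow> j < q"
    using set_coloured[OF assms(1,2)] assms(3) p
    by (elim ranker_extend[of ?u ?B m ?w i j p]) auto
  have "same_side ?B m ?u (v y) ?w (v' y)" if "y \<in> X"
    using eq y that by (auto simp: pebbles_equiv_def intro: same_side_mono)
  then have "pebbles_equiv A n m X u (v(x := p)) w (v'(x := q))"
    using eq y q p unfolding pebbles_equiv_def i_def j_def by (auto split: if_splits)
  with q(1) show thesis by (intro that) auto
qed

lemma free_vars_subset_vars: "free_vars \<phi> \<subseteq> vars \<phi>"
  by (induction \<phi>) auto

text \<open>Each quantifier spends one level of rankers, and the pebble of a requantified variable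
  is discarded before it is placed anew.\<close>

lemma FO2_invariant:
  assumes "0 < n" "u \<in> lists A" "w \<in> lists A" "[length u = length w] (mod n)"
    and "moduli_dvd n \<phi>" "vars \<phi> \<subseteq> {0, 1}" "depth \<phi> \<le> m"
    and "ranker_equiv (A \<times> {..<n}) m (coloured n u) (coloured n w)"
    and "pebbles_equiv A n m (free_vars \<phi>) u v w v'"
  shows "sat u v \<phi> \<longleftrightarrow> sat w v' \<phi>"
  using assms(5-)
proof (induction \<phi> arbitrary: m v v')
  case (Lab x a)
  then have "coloured n u ! (v x - 1) = coloured n w ! (v' x - 1)"
    "v x - 1 < length u" "v' x - 1 < length w"
    unfolding pebbles_equiv_def by auto
  then show ?case by simp
next
  case (Eq x y)
  then have "v x < v y \<longleftrightarrow> v' x < v' y" "v y < v x \<longleftrightarrow> v' y < v' x"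
    unfolding pebbles_equiv_def by auto
  then show ?case by auto
next
  case (Less x y)
  then show ?case unfolding pebbles_equiv_def by auto
next
  case (Mod k i x)
  then have "coloured n u ! (v x - 1) = coloured n w ! (v' x - 1)"
    "v x - 1 < length u" "v' x - 1 < length w" "Suc (v x - 1) = v x" "Suc (v' x - 1) = v' x"
    unfolding pebbles_equiv_def by auto
  then have "[v x = v' x] (mod n)" by (simp add: cong_def)
  with Mod have "[int (v x) = int (v' x)] (mod int k)"
    by (auto simp: cong_int_iff intro: cong_dvd_modulus_nat)
  then show ?case by (auto intro: cong_trans cong_sym)
next
  case (Len k i)
  with assms(4) have "[int (length u) = int (length w)] (mod int k)"
    by (auto simp: cong_int_iff intro: cong_dvd_modulus_nat)
  then show ?case by (auto intro: cong_trans cong_sym)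
next
  case (Neg \<phi>)
  from Neg.IH[of m v v'] Neg.prems show ?case by simp
next
  case (Conj \<phi> \<psi>)
  from Conj.IH(1)[of m v v'] Conj.IH(2)[of m v v'] Conj.prems show ?case
    by (auto dest: pebbles_equiv_subset)
next
  case (Disj \<phi> \<psi>)
  from Disj.IH(1)[of m v v'] Disj.IH(2)[of m v v'] Disj.prems show ?case
    by (auto dest: pebbles_equiv_subset)
next
  case (Ex x \<phi>)
  then obtain m' where m: "m = Suc m'" "depth \<phi> \<le> m'" by (cases m) auto
  have fv: "free_vars \<phi> \<subseteq> {0, 1}" "x \<in> {0, 1}"
    using Ex.prems(2) free_vars_subset_vars[of \<phi>] by auto
  have IH: "sat u (v(x := p)) \<phi> \<longleftrightarrow> sat w (v'(x := q)) \<phi>"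
    if "pebbles_equiv A n m' (free_vars \<phi>) u (v(x := p)) w (v'(x := q))" for p q
    using Ex.IH[OF _ _ m(2) _ that] Ex.prems m ranker_equiv_mono[of _ m _ _ m']
    by (auto simp del: fun_upd_apply)
  have equiv: "ranker_equiv (A \<times> {..<n}) (Suc m') (coloured n u) (coloured n w)"
      "pebbles_equiv A n (Suc m') (free_vars \<phi> - {x}) u v w v'"
    using Ex.prems m(1) by simp_all
  note equiv' = equiv(1)[THEN ranker_equiv_sym] equiv(2)[THEN pebbles_equiv_sym]
  show ?case
  proof
    assume "sat u v (Ex x \<phi>)"
    then obtain p where p: "p \<in> {1..length u}" "sat u (v(x := p)) \<phi>" by auto
    from pebbles_equiv_extend[OF assms(1,2) equiv fv p(1)] IH p(2)
    show "sat w v' (Ex x \<phi>)" by (metis sat.simps(11))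
  next
    assume "sat w v' (Ex x \<phi>)"
    then obtain q where q: "q \<in> {1..length w}" "sat w (v'(x := q)) \<phi>" by auto
    from pebbles_equiv_extend[OF assms(1,3) equiv' fv q(1)] IH q(2)
    show "sat u v (Ex x \<phi>)" by (metis pebbles_equiv_sym sat.simps(11))
  qed
next
  case (All x \<phi>)
  then obtain m' where m: "m = Suc m'" "depth \<phi> \<le> m'" by (cases m) auto
  have fv: "free_vars \<phi> \<subseteq> {0, 1}" "x \<in> {0, 1}"
    using All.prems(2) free_vars_subset_vars[of \<phi>] by auto
  have IH: "sat u (v(x := p)) \<phi> \<longleftrightarrow> sat w (v'(x := q)) \<phi>"
    if "pebbles_equiv A n m' (free_vars \<phi>) u (v(x := p)) w (v'(x := q))" for p q
    using All.IH[OF _ _ m(2) _ that] All.prems m ranker_equiv_mono[of _ m _ _ m']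
    by (auto simp del: fun_upd_apply)
  have equiv: "ranker_equiv (A \<times> {..<n}) (Suc m') (coloured n u) (coloured n w)"
      "pebbles_equiv A n (Suc m') (free_vars \<phi> - {x}) u v w v'"
    using All.prems m(1) by simp_all
  note equiv' = equiv(1)[THEN ranker_equiv_sym] equiv(2)[THEN pebbles_equiv_sym]
  show ?case
  proof
    assume sat: "sat u v (All x \<phi>)"
    have "sat w (v'(x := q)) \<phi>" if "q \<in> {1..length w}" for q
      using pebbles_equiv_extend[OF assms(1,3) equiv' fv that] IH sat
      by (metis pebbles_equiv_sym sat.simps(12))
    then show "sat w v' (All x \<phi>)" by simp
  next
    assume sat: "sat w v' (All x \<phi>)"
    have "sat u (v(x := p)) \<phi>" if "p \<in> {1..length u}" for p
      using pebbles_equiv_extend[OF assms(1,2) equiv fv that] IH sat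
      by (metis sat.simps(12))
    then show "sat u v (All x \<phi>)" by simp
  qed
qed simp_all

section \<open>From rankers to factorizations\<close>

text \<open>Both end points are excluded: index \<open>i\<close> is already position
  \<open>i + 1\<close>. Sentinels are admissible ends, so the whole word is such a factor.\<close>

definition between :: "'b list \<Rightarrow> nat \<Rightarrow> nat \<Rightarrow> 'b list" where
  "between w i j = take (j - Suc i) (drop i w)"

lemma length_between: "j \<le> Suc (length w) \<Longrightarrow> length (between w i j) = j - Suc i"
  by (simp add: between_def)

lemma nth_between: "k < j - Suc i \<Longrightarrow> j \<le> Suc (length w) \<Longrightarrow> between w i j ! k = w ! (i + k)"
  by (simp add: between_def)

lemma set_between:
  assumes "j \<le> Suc (length w)"
  shows "set (between w i j) = {w ! (p - 1) | p. i < p \<and> p < j}"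
proof -
  have "set (between w i j) = {w ! (i + k) | k. k < j - Suc i}"
    unfolding set_conv_nth length_between[OF assms]
    by (rule Collect_cong) (metis assms nth_between)
  also have "\<dots> = {w ! (p - 1) | p. i < p \<and> p < j}"
  proof (intro equalityI subsetI)
    fix b
    assume "b \<in> {w ! (i + k) | k. k < j - Suc i}"
    then obtain k where "b = w ! (i + k)" "k < j - Suc i" by blast
    then show "b \<in> {w ! (p - 1) | p. i < p \<and> p < j}"
      by (intro CollectI exI[of _ "Suc (i + k)"]) auto
  next
    fix b
    assume "b \<in> {w ! (p - 1) | p. i < p \<and> p < j}"
    then obtain p where "b = w ! (p - 1)" "i < p" "p < j" by blast
    then show "b \<in> {w ! (i + k) | k. k < j - Suc i}"
      by (intro CollectI exI[of _ "p - Suc i"]) auto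
  qed
  finally show ?thesis .
qed

lemma between_split:
  assumes "between w i j = p @ a # q" "j \<le> Suc (length w)"
  defines "k \<equiv> Suc (i + length p)"
  shows "i < k" "k < j" "w ! (k - 1) = a" "between w i k = p" "between w k j = q"
proof -
  have len: "j - Suc i = Suc (length p + length q)"
    using arg_cong[OF assms(1), of length] length_between[OF assms(2), of i] by simp
  show "i < k" "k < j" using len by (auto simp: k_def)
  have "between w i j ! length p = a" using assms(1) by simp
  then show "w ! (k - 1) = a"
    using nth_between[of "length p" j i w] assms(2) len by (simp add: k_def)
  have "between w i k = take (length p) (between w i j)"
    using len by (simp add: between_def k_def)
  then show "between w i k = p" using assms(1) by simp
  have "drop k w = drop (Suc (length p)) (drop i w)" "j - Suc k = j - Suc i - Suc (length p)"
    by (simp_all add: k_def add.commute)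
  then have "between w k j = drop (Suc (length p)) (between w i j)"
    by (simp only: between_def drop_take)
  then show "between w k j = q" using assms(1) by simp
qed

lemma reaches_Nxt_between:
  assumes "between w i j = p @ a # q" "a \<notin> set p" "reaches w r i" "j \<le> Suc (length w)"
  shows "reaches w (Nxt a r) (Suc (i + length p))"
proof -
  note split = between_split[OF assms(1,4)]
  have "a \<notin> set (between w i (Suc (i + length p)))" using split(4) assms(2) by simp
  then have "\<forall>k. i < k \<and> k < Suc (i + length p) \<longrightarrow> w ! (k - 1) \<noteq> a"
    using split(2) assms(4) by (subst (asm) set_between) auto
  with split assms(3,4) show ?thesis
    unfolding reaches.simps by (intro conjI exI[of _ i]) auto
qed

lemma reaches_Prv_between:
  assumes "between w i j = p @ a # q" "a \<notin> set q" "reaches w r j"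
  shows "reaches w (Prv a r) (Suc (i + length p))"
proof -
  have j: "j \<le> Suc (length w)" using assms(3) by (rule reaches_le)
  note split = between_split[OF assms(1) j]
  have "a \<notin> set (between w (Suc (i + length p)) j)" using split(5) assms(2) by simp
  then have "\<forall>k. Suc (i + length p) < k \<and> k < j \<longrightarrow> w ! (k - 1) \<noteq> a"
    using j by (subst (asm) set_between) auto
  with split assms(3) j show ?thesis
    unfolding reaches.simps by (intro conjI exI[of _ j]) auto
qed

text \<open>A letter \<open>b\<close> of the factor is met by \<open>Nxt b r\<close> before the
  right end; agreement on the order of this ranker with \<open>r\<close> and \<open>s\<close> places
  its image in the other factor.\<close>

lemma ranker_equiv_set_between:
  assumes "ranker_equiv B (Suc l) u v" "r \<in> rankers B l" "s \<in> rankers B l" "set u \<subseteq> B"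
    and "reaches u r i" "reaches u s j" "reaches v r i'" "reaches v s j'"
  shows "set (between u i j) \<subseteq> set (between v i' j')"
proof
  fix b
  assume "b \<in> set (between u i j)"
  then obtain p where p: "b = u ! (p - 1)" "i < p" "p < j"
    using set_between[of j u i] reaches_le[OF assms(6)] by auto
  have p_range: "p \<in> {1..length u}" using p reaches_le[OF assms(6)] by auto
  then have "b \<in> B" using p(1) assms(4) by (auto simp: subset_iff)
  then have b: "Nxt b r \<in> rankers B (Suc l)" using assms(2) by auto
  obtain q where q: "reaches u (Nxt b r) q" "i < q" "q \<le> p"
    using reaches_Nxt_ex[OF assms(5) p(2) p_range] p(1) by blast
  obtain q' where q': "reaches v (Nxt b r) q'"
    using ranker_equiv_defined[OF assms(1) b q(1)] by blast
  have rs: "r \<in> rankers B (Suc l)" "s \<in> rankers B (Suc l)" using assms(2,3) by auto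
  have "i' < q'" "q' < j'"
    using ranker_equiv_less[OF assms(1) rs(1) b assms(5) q(1) assms(7) q']
      ranker_equiv_less[OF assms(1) b rs(2) q(1) assms(6) q' assms(8)] q p by auto
  then show "b \<in> set (between v i' j')"
    using q' reaches_le[OF assms(8)] by (subst set_between) auto
qed

text \<open>The ends of the factors are reached by rankers of depth \<open>l\<close>. A cut adds an
  end at depth \<open>l + 1\<close> while \<open>m\<close> drops by one, so \<open>l + m\<close> is
  invariant; the extra \<open>Suc\<close> pays for comparing alphabets at level 0.\<close>

lemma ranker_equiv_imp_eqv_between:
  assumes "ranker_equiv B (Suc (l + m)) u v" "r \<in> rankers B l" "s \<in> rankers B l"
    and "set u \<subseteq> B" "set v \<subseteq> B"
    and "reaches u r i" "reaches u s j" "reaches v r i'" "reaches v s j'"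
  shows "eqv m (between u i j) (between v i' j')"
  using assms
proof (induction m arbitrary: l r s i j i' j')
  case 0
  then show ?case
    using ranker_equiv_set_between[of B l u v r s i j i' j']
      ranker_equiv_set_between[OF ranker_equiv_sym, of B l u v r s i' j' i j] by auto
next
  case (Suc m)
  have mono: "rankers B l \<subseteq> rankers B (Suc l)" by (rule rankers_mono) simp
  have j: "j \<le> Suc (length u)" "j' \<le> Suc (length v)" using Suc.prems reaches_le by blast+
  have equiv: "ranker_equiv B (Suc (Suc l + m)) u v" using Suc.prems(1) by simp
  have "eqv m (between u i j) (between v i' j')"
    using Suc.prems ranker_equiv_mono[OF Suc.prems(1), of "Suc (l + m)"]
    by (intro Suc.IH[of l r s]) auto
  moreover have "eqv m p p' \<and> eqv m q q'"
    if p: "between u i j = p @ a # q" "between v i' j' = p' @ a # q'"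
      and a: "a \<notin> set p \<and> a \<notin> set p' \<or> a \<notin> set q \<and> a \<notin> set q'" for p a q p' q'
  proof -
    note splits = between_split[OF p(1) j(1)] between_split[OF p(2) j(2)]
    have "a \<in> B"
      using splits(2,3) j Suc.prems(4) by (auto simp: subset_iff)
    with Suc.prems(2,3) have ts: "Nxt a r \<in> rankers B (Suc l)" "Prv a s \<in> rankers B (Suc l)" by auto
    obtain t where t: "t \<in> rankers B (Suc l)" "reaches u t (Suc (i + length p))"
      "reaches v t (Suc (i' + length p'))"
      using a reaches_Nxt_between[OF p(1) _ Suc.prems(6) j(1)]
        reaches_Nxt_between[OF p(2) _ Suc.prems(8) j(2)]
        reaches_Prv_between[OF p(1) _ Suc.prems(7)] reaches_Prv_between[OF p(2) _ Suc.prems(9)] ts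
      by metis
    have rs: "r \<in> rankers B (Suc l)" "s \<in> rankers B (Suc l)" using mono Suc.prems(2,3) by auto
    show ?thesis
      using Suc.IH[OF equiv rs(1) t(1) Suc.prems(4,5,6) t(2) Suc.prems(8) t(3)]
        Suc.IH[OF equiv t(1) rs(2) Suc.prems(4,5) t(2) Suc.prems(7) t(3) Suc.prems(9)] splits
      by simp
  qed
  ultimately show ?case unfolding eqv.simps by blast
qed

lemma ranker_equiv_imp_eqv:
  assumes "ranker_equiv B (Suc m) u v" "set u \<subseteq> B" "set v \<subseteq> B"
  shows "eqv m u v"
proof -
  have "between w 0 (Suc (length w)) = w" for w :: "'a list" by (simp add: between_def)
  then show ?thesis
    using ranker_equiv_imp_eqv_between[of B 0 m u v Start End 0 "Suc (length u)" 0 "Suc (length v)"]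
      assms by simp
qed

section \<open>Expressibility\<close>

text \<open>Relations replace explicit formulas. The guards on words and positions matter: the
  negation-free complement of a letter atom is a disjunction over \<open>A\<close>, correct only at
  a position carrying a letter of \<open>A\<close>.\<close>

definition expressible :: "'a set \<Rightarrow> 'a fm set \<Rightarrow> var set \<Rightarrow> ('a list \<Rightarrow> (var \<Rightarrow> nat) \<Rightarrow> bool) \<Rightarrow> bool" where
  "expressible A F X R \<longleftrightarrow> (\<exists>\<phi>\<in>F. free_vars \<phi> \<subseteq> X \<and>
     (\<forall>w\<in>lists A. \<forall>v. (\<forall>x\<in>X. v x \<in> {1..length w}) \<longrightarrow> (sat w v \<phi> \<longleftrightarrow> R w v)))"

lemma expressibleI:
  assumes "\<phi> \<in> F" "free_vars \<phi> \<subseteq> X"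
    and "\<And>w v. w \<in> lists A \<Longrightarrow> \<forall>x\<in>X. v x \<in> {1..length w} \<Longrightarrow> sat w v \<phi> \<longleftrightarrow> R w v"
  shows "expressible A F X R"
  using assms unfolding expressible_def by blast

lemma expressibleE:
  assumes "expressible A F X R"
  obtains \<phi> where "\<phi> \<in> F" "free_vars \<phi> \<subseteq> X"
    "\<And>w v. w \<in> lists A \<Longrightarrow> \<forall>x\<in>X. v x \<in> {1..length w} \<Longrightarrow> sat w v \<phi> \<longleftrightarrow> R w v"
  using assms unfolding expressible_def by blast

lemma expressible_mono:
  assumes "expressible A F X R" "X \<subseteq> Y" "F \<subseteq> G"
    and "\<And>w v. w \<in> lists A \<Longrightarrow> \<forall>x\<in>Y. v x \<in> {1..length w} \<Longrightarrow> R w v \<longleftrightarrow> R' w v"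
  shows "expressible A G Y R'"
proof -
  from assms(1) obtain \<phi> where \<phi>: "\<phi> \<in> F" "free_vars \<phi> \<subseteq> X"
    "\<And>w v. w \<in> lists A \<Longrightarrow> \<forall>x\<in>X. v x \<in> {1..length w} \<Longrightarrow> sat w v \<phi> \<longleftrightarrow> R w v"
    by (rule expressibleE) blast
  show ?thesis
    by (rule expressibleI[of \<phi>]) (use \<phi> assms(2-4) in blast)+
qed

lemma expressible_cong:
  assumes "expressible A F X R"
    and "\<And>w v. w \<in> lists A \<Longrightarrow> \<forall>x\<in>X. v x \<in> {1..length w} \<Longrightarrow> R w v \<longleftrightarrow> R' w v"
  shows "expressible A F X R'"
  using assms(1) by (rule expressible_mono) (use assms(2) in auto)

definition positive_fragment :: "'a fm set \<Rightarrow> bool" where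
  "positive_fragment F \<longleftrightarrow> Top \<in> F \<and> Bot \<in> F \<and> (\<forall>\<phi>\<in>F. \<forall>\<psi>\<in>F. Conj \<phi> \<psi> \<in> F \<and> Disj \<phi> \<psi> \<in> F)"

lemma expressible_const: "positive_fragment F \<Longrightarrow> expressible A F X (\<lambda>w v. c)"
  unfolding positive_fragment_def
  by (cases c) (auto intro: expressibleI[of Top] expressibleI[of Bot])

lemma expressible_conj:
  assumes "positive_fragment F" "expressible A F X R" "expressible A F X S"
  shows "expressible A F X (\<lambda>w v. R w v \<and> S w v)"
proof -
  from assms(2) obtain \<phi> where "\<phi> \<in> F" "free_vars \<phi> \<subseteq> X"
    "\<And>w v. w \<in> lists A \<Longrightarrow> \<forall>x\<in>X. v x \<in> {1..length w} \<Longrightarrow> sat w v \<phi> \<longleftrightarrow> R w v"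
    by (rule expressibleE) blast
  moreover from assms(3) obtain \<psi> where "\<psi> \<in> F" "free_vars \<psi> \<subseteq> X"
    "\<And>w v. w \<in> lists A \<Longrightarrow> \<forall>x\<in>X. v x \<in> {1..length w} \<Longrightarrow> sat w v \<psi> \<longleftrightarrow> S w v"
    by (rule expressibleE) blast
  ultimately show ?thesis
    using assms(1) by (intro expressibleI[of "Conj \<phi> \<psi>"]) (auto simp: positive_fragment_def)
qed

lemma expressible_disj:
  assumes "positive_fragment F" "expressible A F X R" "expressible A F X S"
  shows "expressible A F X (\<lambda>w v. R w v \<or> S w v)"
proof -
  from assms(2) obtain \<phi> where "\<phi> \<in> F" "free_vars \<phi> \<subseteq> X"
    "\<And>w v. w \<in> lists A \<Longrightarrow> \<forall>x\<in>X. v x \<in> {1..length w} \<Longrightarrow> sat w v \<phi> \<longleftrightarrow> R w v"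
    by (rule expressibleE) blast
  moreover from assms(3) obtain \<psi> where "\<psi> \<in> F" "free_vars \<psi> \<subseteq> X"
    "\<And>w v. w \<in> lists A \<Longrightarrow> \<forall>x\<in>X. v x \<in> {1..length w} \<Longrightarrow> sat w v \<psi> \<longleftrightarrow> S w v"
    by (rule expressibleE) blast
  ultimately show ?thesis
    using assms(1) by (intro expressibleI[of "Disj \<phi> \<psi>"]) (auto simp: positive_fragment_def)
qed

lemma expressible_ex:
  assumes "\<And>\<phi>. \<phi> \<in> F \<Longrightarrow> Ex y \<phi> \<in> F" "expressible A F (insert y X) R"
  shows "expressible A F X (\<lambda>w v. \<exists>p\<in>{1..length w}. R w (v(y := p)))"
proof -
  from assms(2) obtain \<phi> where \<phi>: "\<phi> \<in> F" "free_vars \<phi> \<subseteq> insert y X"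
    "\<And>w v. w \<in> lists A \<Longrightarrow> \<forall>x\<in>insert y X. v x \<in> {1..length w} \<Longrightarrow> sat w v \<phi> \<longleftrightarrow> R w v"
    by (rule expressibleE) blast
  have "sat w (v(y := p)) \<phi> \<longleftrightarrow> R w (v(y := p))"
    if "w \<in> lists A" "\<forall>x\<in>X. v x \<in> {1..length w}" "p \<in> {1..length w}" for w v p
    using \<phi>(3)[of w "v(y := p)"] that by auto
  with \<phi> assms(1) show ?thesis
    by (intro expressibleI[of "Ex y \<phi>"]) auto
qed

lemma expressible_all:
  assumes "\<And>\<phi>. \<phi> \<in> F \<Longrightarrow> All y \<phi> \<in> F" "expressible A F (insert y X) R"
  shows "expressible A F X (\<lambda>w v. \<forall>p\<in>{1..length w}. R w (v(y := p)))"
proof -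
  from assms(2) obtain \<phi> where \<phi>: "\<phi> \<in> F" "free_vars \<phi> \<subseteq> insert y X"
    "\<And>w v. w \<in> lists A \<Longrightarrow> \<forall>x\<in>insert y X. v x \<in> {1..length w} \<Longrightarrow> sat w v \<phi> \<longleftrightarrow> R w v"
    by (rule expressibleE) blast
  have "sat w (v(y := p)) \<phi> \<longleftrightarrow> R w (v(y := p))"
    if "w \<in> lists A" "\<forall>x\<in>X. v x \<in> {1..length w}" "p \<in> {1..length w}" for w v p
    using \<phi>(3)[of w "v(y := p)"] that by auto
  with \<phi> assms(1) show ?thesis
    by (intro expressibleI[of "All y \<phi>"]) auto
qed

text \<open>A set saturated under finitely many tests is a Boolean combination of them. As
  \<open>F\<close> may lack negation, every test is assumed expressible together with its negation,
  which leaves a positive combination.\<close>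

lemma expressible_saturated:
  assumes "positive_fragment F" "finite T"
    and "\<And>t. t \<in> T \<Longrightarrow> expressible A F {} (\<lambda>w v. t w)"
    and "\<And>t. t \<in> T \<Longrightarrow> expressible A F {} (\<lambda>w v. \<not> t w)"
    and "\<And>u w. u \<in> lists A \<Longrightarrow> w \<in> lists A \<Longrightarrow> \<forall>t\<in>T. t u \<longleftrightarrow> t w \<Longrightarrow> u \<in> L \<Longrightarrow> w \<in> L"
  shows "expressible A F {} (\<lambda>w v. w \<in> L)"
  using assms(2-)
proof (induction T arbitrary: L)
  case empty
  then have "w \<in> L \<longleftrightarrow> L \<inter> lists A \<noteq> {}" if "w \<in> lists A" for w
    using that by blast
  then show ?case
    by (intro expressible_cong[OF expressible_const[OF assms(1), of A _ "L \<inter> lists A \<noteq> {}"]]) auto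
next
  case (insert t T)
  \<comment> \<open>A local name: \<open>sat K\<close> closes \<open>K\<close> under agreement on
    the smaller set \<open>T\<close>. \<open>L\<close> is closed only under agreement on
    \<open>insert t T\<close>, so its two halves according to \<open>t\<close> are treated
    separately.\<close>
  define sat where "sat = (\<lambda>K. {w. \<exists>u\<in>K \<inter> lists A. \<forall>s\<in>T. s u \<longleftrightarrow> s w})"
  have sat: "expressible A F {} (\<lambda>w v. w \<in> sat K)" for K
  proof (rule insert.IH)
    fix u w
    assume "\<forall>t\<in>T. t u \<longleftrightarrow> t w" "u \<in> sat K"
    then show "w \<in> sat K" unfolding sat_def mem_Collect_eq by metis
  qed (use insert.prems(1,2) in blast)+
  have "expressible A F {} (\<lambda>w v. (t w \<and> w \<in> sat {u \<in> L. t u}) \<or> (\<not> t w \<and> w \<in> sat {u \<in> L. \<not> t u}))"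
    by (intro expressible_disj expressible_conj assms(1) sat insert.prems(1,2) insertI1)
  then show ?case
  proof (rule expressible_cong)
    fix w and v :: "var \<Rightarrow> nat"
    assume w: "w \<in> lists A"
    show "(t w \<and> w \<in> sat {u \<in> L. t u}) \<or> (\<not> t w \<and> w \<in> sat {u \<in> L. \<not> t u}) \<longleftrightarrow> w \<in> L"
      using w insert.prems(3)[of _ w] by (auto simp: sat_def)
  qed
qed

lemma definable_iff_expressible:
  assumes "L \<subseteq> lists A"
  shows "definable_in A F L \<longleftrightarrow> expressible A F {} (\<lambda>w v. w \<in> L)"
proof
  assume "definable_in A F L"
  then obtain \<phi> where \<phi>: "\<phi> \<in> F" "sentence \<phi>" "L = {u \<in> lists A. models u \<phi>}"
    unfolding definable_in_def by blast
  show "expressible A F {} (\<lambda>w v. w \<in> L)"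
  proof (rule expressibleI)
    fix w v
    assume "w \<in> lists A"
    then show "sat w v \<phi> \<longleftrightarrow> w \<in> L" using \<phi> models_sentence[of \<phi> w v] by simp
  qed (use \<phi> in auto)
next
  assume "expressible A F {} (\<lambda>w v. w \<in> L)"
  then obtain \<phi> where \<phi>: "\<phi> \<in> F" "free_vars \<phi> \<subseteq> {}"
    "\<And>w v. w \<in> lists A \<Longrightarrow> \<forall>x\<in>{}. v x \<in> {1..length w} \<Longrightarrow> sat w v \<phi> \<longleftrightarrow> w \<in> L"
    by (rule expressibleE) blast
  then have "L = {u \<in> lists A. models u \<phi>}"
    unfolding models_def using assms by blast
  with \<phi> show "definable_in A F L" unfolding definable_in_def by auto
qed

section \<open>Duals and complements\<close>

primrec disjs :: "'a fm list \<Rightarrow> 'a fm" where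
  "disjs [] = Bot"
| "disjs (\<phi> # \<phi>s) = Disj \<phi> (disjs \<phi>s)"

lemma disjs_simps [simp]:
  "sat w v (disjs \<phi>s) \<longleftrightarrow> (\<exists>\<phi>\<in>set \<phi>s. sat w v \<phi>)"
  "free_vars (disjs \<phi>s) = (\<Union>\<phi>\<in>set \<phi>s. free_vars \<phi>)"
  "formula_over A (disjs \<phi>s) \<longleftrightarrow> (\<forall>\<phi>\<in>set \<phi>s. formula_over A \<phi>)"
  "negation_free (disjs \<phi>s) \<longleftrightarrow> (\<forall>\<phi>\<in>set \<phi>s. negation_free \<phi>)"
  "universal (disjs \<phi>s) \<longleftrightarrow> (\<forall>\<phi>\<in>set \<phi>s. universal \<phi>)"
  by (induction \<phi>s) auto

lemma quantifier_subformula_disjs [simp]: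
  "Ex x \<psi> \<in> subformulas (disjs \<phi>s) \<longleftrightarrow> (\<exists>\<phi>\<in>set \<phi>s. Ex x \<psi> \<in> subformulas \<phi>)"
  "All x \<psi> \<in> subformulas (disjs \<phi>s) \<longleftrightarrow> (\<exists>\<phi>\<in>set \<phi>s. All x \<psi> \<in> subformulas \<phi>)"
  by (induction \<phi>s) auto

text \<open>Negation is pushed through without introducing \<open>Neg\<close>, because every negated
  atom is a disjunction of atoms: the other letters of \<open>as\<close>, the other residues, or the
  other order relations.\<close>

primrec dual :: "'a list \<Rightarrow> 'a fm \<Rightarrow> 'a fm" where
  "dual as Top = Bot"
| "dual as Bot = Top"
| "dual as (Lab x a) = disjs (map (Lab x) (removeAll a as))"
| "dual as (Eq x y) = Disj (Less x y) (Less y x)"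
| "dual as (Less x y) = Disj (Eq x y) (Less y x)"
| "dual as (Mod n i x) = disjs (map (\<lambda>j. Mod n (int j) x) (filter (\<lambda>j. \<not> [int j = i] (mod int n)) [0..<n]))"
| "dual as (Len n i) = disjs (map (\<lambda>j. Len n (int j)) (filter (\<lambda>j. \<not> [int j = i] (mod int n)) [0..<n]))"
| "dual as (Neg \<phi>) = \<phi>"
| "dual as (Conj \<phi> \<psi>) = Disj (dual as \<phi>) (dual as \<psi>)"
| "dual as (Disj \<phi> \<psi>) = Conj (dual as \<phi>) (dual as \<psi>)"
| "dual as (Ex x \<phi>) = All x (dual as \<phi>)"
| "dual as (All x \<phi>) = Ex x (dual as \<phi>)"

lemma not_cong_iff_residue:
  assumes "0 < n"
  shows "(\<exists>j<n. \<not> [int j = i] (mod int n) \<and> [int p = int j] (mod int n)) \<longleftrightarrow> \<not> [int p = i] (mod int n)"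
proof
  assume "\<exists>j<n. \<not> [int j = i] (mod int n) \<and> [int p = int j] (mod int n)"
  then show "\<not> [int p = i] (mod int n)" using cong_sym cong_trans by blast
next
  assume p: "\<not> [int p = i] (mod int n)"
  have "[int p = int (p mod n)] (mod int n)" unfolding cong_int_iff by (simp add: cong_def)
  then show "\<exists>j<n. \<not> [int j = i] (mod int n) \<and> [int p = int j] (mod int n)"
    using p assms cong_trans by (intro exI[of _ "p mod n"]) auto
qed

lemma sat_dual:
  assumes "w \<in> lists (set as)" "formula_over (set as) \<phi>" "\<forall>x\<in>free_vars \<phi>. v x \<in> {1..length w}"
  shows "sat w v (dual as \<phi>) \<longleftrightarrow> \<not> sat w v \<phi>"
  using assms
proof (induction \<phi> arbitrary: v)
  case (Lab x a)
  then have "w ! (v x - 1) \<in> set w" by (intro nth_mem) auto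
  with Lab show ?case by (auto simp: in_lists_conv_set)
next
  case (Mod n i x)
  with not_cong_iff_residue[of n i "v x"] show ?case by auto
next
  case (Len n i)
  with not_cong_iff_residue[of n i "length w"] show ?case by auto
next
  case (Ex x \<phi>)
  then have "sat w (v(x := p)) (dual as \<phi>) \<longleftrightarrow> \<not> sat w (v(x := p)) \<phi>" if "p \<in> {1..length w}" for p
    using that by (intro Ex.IH) auto
  then show ?case by simp
next
  case (All x \<phi>)
  then have "sat w (v(x := p)) (dual as \<phi>) \<longleftrightarrow> \<not> sat w (v(x := p)) \<phi>" if "p \<in> {1..length w}" for p
    using that by (intro All.IH) auto
  then show ?case by simp
qed auto

lemma formula_over_dual: "formula_over (set as) \<phi> \<Longrightarrow> formula_over (set as) (dual as \<phi>)"
  by (induction \<phi>) auto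

lemma free_vars_dual: "free_vars (dual as \<phi>) \<subseteq> free_vars \<phi>"
  by (induction \<phi>) auto

lemma negation_free_dual: "negation_free \<phi> \<Longrightarrow> negation_free (dual as \<phi>)"
  by (induction \<phi>) auto

text \<open>Dualizing swaps quantifiers and keeps their nesting, and duals of atoms contain none.
  \<open>negation_free\<close> matters since the dual of \<open>Neg\<close> exposes its argument
  undualized.\<close>

lemma Ex_subformula_dual:
  "negation_free \<phi> \<Longrightarrow> Ex x \<psi> \<in> subformulas (dual as \<phi>) \<Longrightarrow>
    \<exists>\<chi>. negation_free \<chi> \<and> \<psi> = dual as \<chi> \<and> All x \<chi> \<in> subformulas \<phi>"
  by (induction \<phi>) auto

lemma All_subformula_dual:
  "negation_free \<phi> \<Longrightarrow> All x \<psi> \<in> subformulas (dual as \<phi>) \<Longrightarrow>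
    \<exists>\<chi>. negation_free \<chi> \<and> \<psi> = dual as \<chi> \<and> Ex x \<chi> \<in> subformulas \<phi>"
  by (induction \<phi>) auto

lemma dual_Sigma2:
  assumes "\<phi> \<in> Sigma2_less_MOD (set as)"
  shows "dual as \<phi> \<in> Pi2_less_MOD (set as)"
proof -
  have \<phi>: "formula_over (set as) \<phi>" "negation_free \<phi>"
    "\<And>x \<psi> y \<chi>. All x \<psi> \<in> subformulas \<phi> \<Longrightarrow> Ex y \<chi> \<notin> subformulas \<psi>"
    using assms by (auto simp: Sigma2_less_MOD_def)
  have "All y \<chi> \<notin> subformulas \<psi>" if "Ex x \<psi> \<in> subformulas (dual as \<phi>)" for x \<psi> y \<chi>
    using Ex_subformula_dual[OF \<phi>(2) that] All_subformula_dual[of _ y \<chi> as] \<phi>(3) by blast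
  then show ?thesis
    using formula_over_dual[OF \<phi>(1)] negation_free_dual[OF \<phi>(2)] by (auto simp: Pi2_less_MOD_def)
qed

lemma dual_Pi2:
  assumes "\<phi> \<in> Pi2_less_MOD (set as)"
  shows "dual as \<phi> \<in> Sigma2_less_MOD (set as)"
proof -
  have \<phi>: "formula_over (set as) \<phi>" "negation_free \<phi>"
    "\<And>x \<psi> y \<chi>. Ex x \<psi> \<in> subformulas \<phi> \<Longrightarrow> All y \<chi> \<notin> subformulas \<psi>"
    using assms by (auto simp: Pi2_less_MOD_def)
  have "Ex y \<chi> \<notin> subformulas \<psi>" if "All x \<psi> \<in> subformulas (dual as \<phi>)" for x \<psi> y \<chi>
    using All_subformula_dual[OF \<phi>(2) that] Ex_subformula_dual[of _ y \<chi> as] \<phi>(3) by blast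
  then show ?thesis
    using formula_over_dual[OF \<phi>(1)] negation_free_dual[OF \<phi>(2)] by (auto simp: Sigma2_less_MOD_def)
qed

lemma definable_complement:
  assumes "definable_in (set as) F L" and "\<And>\<phi>. \<phi> \<in> F \<Longrightarrow> formula_over (set as) \<phi> \<and> dual as \<phi> \<in> G"
  shows "definable_in (set as) G (lists (set as) - L)"
proof -
  from assms(1) obtain \<phi> where \<phi>: "\<phi> \<in> F" "sentence \<phi>" "L = {u \<in> lists (set as). models u \<phi>}"
    unfolding definable_in_def by blast
  have dual: "sentence (dual as \<phi>)" using free_vars_dual[of as \<phi>] \<phi>(2) by blast
  have "models u (dual as \<phi>) \<longleftrightarrow> \<not> models u \<phi>" if "u \<in> lists (set as)" for u
    using sat_dual[of u as \<phi>] that assms(2)[OF \<phi>(1)] \<phi>(2)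
      models_sentence[OF dual] models_sentence[OF \<phi>(2)] by blast
  then have "lists (set as) - L = {u \<in> lists (set as). models u (dual as \<phi>)}"
    using \<phi>(3) by blast
  with \<phi>(1) assms(2) dual show ?thesis unfolding definable_in_def by blast
qed

text \<open>Reduces \<open>\<Delta>\<^sub>2\<close> to \<open>\<Sigma>\<^sub>2\<close> for a
  language and its complement, so a single game serves both halves.\<close>

lemma definable_Sigma2_complement_iff:
  assumes "finite A" "L \<subseteq> lists A"
  shows "definable_in A (Sigma2_less_MOD A) (lists A - L) \<longleftrightarrow> definable_in A (Pi2_less_MOD A) L"
proof -
  obtain as where as: "A = set as" using assms(1) finite_list by blast
  show ?thesis
  proof
    assume "definable_in A (Sigma2_less_MOD A) (lists A - L)"
    then have "definable_in A (Pi2_less_MOD A) (lists A - (lists A - L))"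
      unfolding as by (rule definable_complement) (simp add: dual_Sigma2 Sigma2_iff)
    moreover have "lists A - (lists A - L) = L" using assms(2) by blast
    ultimately show "definable_in A (Pi2_less_MOD A) L" by simp
  next
    assume "definable_in A (Pi2_less_MOD A) L"
    then show "definable_in A (Sigma2_less_MOD A) (lists A - L)"
      unfolding as by (rule definable_complement) (use dual_Pi2 in \<open>auto simp: Pi2_less_MOD_def\<close>)
  qed
qed

section \<open>Letter tests in the fragments\<close>

lemma positive_fragment_Sigma2: "positive_fragment (Sigma2_less_MOD A)"
  by (simp add: positive_fragment_def Sigma2_iff)

lemma positive_fragment_FO2: "positive_fragment (FO2_less_MOD A)"
  by (simp add: positive_fragment_def FO2_less_MOD_def)

definition universal_formulas :: "'a set \<Rightarrow> 'a fm set" where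
  "universal_formulas A = {\<phi>. formula_over A \<phi> \<and> universal \<phi>}"

lemma positive_fragment_universal: "positive_fragment (universal_formulas A)"
  by (simp add: positive_fragment_def universal_formulas_def)

lemma universal_imp_sigma2: "universal \<phi> \<Longrightarrow> sigma2 \<phi>"
  by (induction \<phi>) auto

lemma universal_formulas_subset: "universal_formulas A \<subseteq> Sigma2_less_MOD A"
  by (auto simp: universal_formulas_def Sigma2_iff universal_imp_sigma2)

lemma sat_letter:
  assumes "c < n" "v x \<in> {1..length w}"
  shows "sat w v (Conj (Lab x a) (Mod n (int c) x)) \<longleftrightarrow> coloured n w ! (v x - 1) = (a, c)"
proof -
  have "[int (v x) = int c] (mod int n) \<longleftrightarrow> v x mod n = c"
    using assms(1) unfolding cong_int_iff by (simp add: cong_def)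
  moreover have "v x - 1 < length w" "Suc (v x - 1) = v x" using assms(2) by auto
  ultimately show ?thesis by auto
qed

lemma expressible_letter_FO2:
  assumes "b \<in> A \<times> {..<n}" "x \<in> {0, 1}"
  shows "expressible A (FO2_less_MOD A) {x} (\<lambda>w v. coloured n w ! (v x - 1) = b)"
proof -
  obtain a c where b: "b = (a, c)" "a \<in> A" "c < n" using assms(1) by auto
  show ?thesis
    unfolding b(1)
    by (rule expressibleI[OF _ _ sat_letter[OF b(3)]]) (use assms(2) b in \<open>auto simp: FO2_less_MOD_def\<close>)
qed

lemma expressible_letter_Sigma2:
  assumes "b \<in> A \<times> {..<n}"
  shows "expressible A (Sigma2_less_MOD A) {x} (\<lambda>w v. coloured n w ! (v x - 1) = b)"
proof -
  obtain a c where b: "b = (a, c)" "a \<in> A" "c < n" using assms(1) by auto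
  show ?thesis
    unfolding b(1)
    by (rule expressibleI[OF _ _ sat_letter[OF b(3)]]) (use b in \<open>auto simp: Sigma2_iff\<close>)
qed

lemma expressible_not_letter:
  assumes "finite A" "b \<in> A \<times> {..<n}"
  shows "expressible A (universal_formulas A) {x} (\<lambda>w v. coloured n w ! (v x - 1) \<noteq> b)"
proof -
  obtain a c where b: "b = (a, c)" "a \<in> A" "c < n" using assms(2) by auto
  obtain as where as: "A = set as" using assms(1) finite_list by blast
  let ?\<phi> = "Conj (Lab x a) (Mod n (int c) x)"
  show ?thesis
  proof (rule expressibleI)
    show "dual as ?\<phi> \<in> universal_formulas A"
      using b as by (auto simp: universal_formulas_def)
    show "free_vars (dual as ?\<phi>) \<subseteq> {x}"
      by auto
    fix w v
    assume "w \<in> lists A" "\<forall>x\<in>{x}. v x \<in> {1..length w}"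
    then show "sat w v (dual as ?\<phi>) \<longleftrightarrow> coloured n w ! (v x - 1) \<noteq> b"
      using b as by (subst sat_dual) (simp_all add: sat_letter del: sat.simps)
  qed
qed

lemma expressible_True:
  assumes "positive_fragment F"
    and "\<And>w v. w \<in> lists A \<Longrightarrow> \<forall>x\<in>X. v x \<in> {1..length w} \<Longrightarrow> R w v"
  shows "expressible A F X R"
  by (rule expressible_cong[OF expressible_const[OF assms(1)], of _ _ True]) (use assms(2) in blast)

lemma expressible_False:
  assumes "positive_fragment F"
    and "\<And>w v. w \<in> lists A \<Longrightarrow> \<forall>x\<in>X. v x \<in> {1..length w} \<Longrightarrow> \<not> R w v"
  shows "expressible A F X R"
  by (rule expressible_cong[OF expressible_const[OF assms(1)], of _ _ False]) (use assms(2) in blast)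

section \<open>Describing rankers by formulas\<close>

text \<open>Quantifiers range over proper positions only, so ranker points at the sentinels are
  substituted into \<open>P\<close> separately; hence its premises at 0 and
  \<open>Suc (length w)\<close>. By \<open>fresh\<close>, binding \<open>y\<close> does not disturb
  \<open>P\<close>.\<close>

lemma expressible_ex_reaches:
  assumes F: "positive_fragment F" "\<And>\<phi>. \<phi> \<in> F \<Longrightarrow> Ex y \<phi> \<in> F"
    and r: "expressible A F {y} (\<lambda>w v. reaches (coloured n w) r (v y))"
    and P: "expressible A F X (\<lambda>w v. P w v 0)"
      "expressible A F X (\<lambda>w v. P w v (Suc (length w)))"
      "expressible A F (insert y X) (\<lambda>w v. P w v (v y))"
    and fresh: "\<And>w v p i. P w (v(y := p)) i \<longleftrightarrow> P w v i"
  shows "expressible A F X (\<lambda>w v. \<exists>i. reaches (coloured n w) r i \<and> P w v i)"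
proof -
  consider "r = Start" | "r = End" | "r \<noteq> Start" "r \<noteq> End" by blast
  then show ?thesis
  proof cases
    case 3
    have "expressible A F (insert y X) (\<lambda>w v. reaches (coloured n w) r (v y))"
      using r by (rule expressible_mono) auto
    from expressible_ex[OF F(2) expressible_conj[OF F(1) this P(3)]]
    have "expressible A F X (\<lambda>w v. \<exists>p\<in>{1..length w}. reaches (coloured n w) r p \<and> P w v p)"
      by (simp add: fresh)
    then show ?thesis
      by (rule expressible_cong) (use 3 reaches_range in force)
  qed (use P in simp_all)
qed

lemma expressible_before:
  assumes F: "positive_fragment F" "\<And>y \<phi>. y \<in> {0, 1} \<Longrightarrow> \<phi> \<in> F \<Longrightarrow> Ex y \<phi> \<in> F" "Less 0 1 \<in> F"
    and r: "expressible A F {0} (\<lambda>w v. reaches (coloured n w) r (v 0))"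
    and s: "expressible A F {1} (\<lambda>w v. reaches (coloured n w) s (v 1))"
  shows "expressible A F {} (\<lambda>w v. before (coloured n w) r s)"
proof -
  have "expressible A F {} (\<lambda>w v. \<exists>i. reaches (coloured n w) r i \<and>
      (\<exists>j. reaches (coloured n w) s j \<and> i < j))"
  proof (rule expressible_ex_reaches[OF F(1) F(2)[of 0] r])
    show "expressible A F {} (\<lambda>w v. \<exists>j. reaches (coloured n w) s j \<and> 0 < j)"
      by (rule expressible_ex_reaches[OF F(1) F(2)[of 1] s])
        (auto intro: expressible_True expressible_False F(1))
    show "expressible A F {} (\<lambda>w v. \<exists>j. reaches (coloured n w) s j \<and> Suc (length w) < j)"
      by (rule expressible_ex_reaches[OF F(1) F(2)[of 1] s])
        (auto intro: expressible_False F(1))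
    show "expressible A F {0} (\<lambda>w v. \<exists>j. reaches (coloured n w) s j \<and> v 0 < j)"
    proof (rule expressible_ex_reaches[OF F(1) F(2)[of 1] s])
      show "expressible A F {1, 0} (\<lambda>w v. v 0 < v 1)"
        using F(3) by (intro expressibleI[of "Less 0 1"]) auto
    qed (auto intro: expressible_True expressible_False F(1))
  qed auto
  then show ?thesis by (rule expressible_cong) (auto simp: before_def)
qed

lemma set_ranker_subset: "r \<in> rankers B m \<Longrightarrow> set_ranker r \<subseteq> B"
  by (induction m arbitrary: r) (auto simp: subset_iff)

text \<open>The gap condition in \<open>reaches\<close> relates three positions. As the point of
  \<open>r\<close> is unique, it can be recomputed from \<open>q\<close> instead, and then only two
  positions are ever compared, as two variables require.\<close>

lemma reaches_Nxt_iff: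
  assumes "p \<in> {1..length u}"
  shows "reaches u (Nxt b r) p \<longleftrightarrow> u ! (p - 1) = b \<and> (\<exists>i. reaches u r i \<and> i < p) \<and>
    \<not> (\<exists>q\<in>{1..length u}. q < p \<and> u ! (q - 1) = b \<and> (\<exists>i. reaches u r i \<and> i < q))"
proof (cases "\<exists>i. reaches u r i")
  case True
  then obtain i where i: "reaches u r i" by blast
  have the_i: "(\<exists>j. reaches u r j \<and> P j) \<longleftrightarrow> P i" for P
    using i reaches_unique[OF i] by blast
  have less_i: "(\<exists>j<p. reaches u r j \<and> P j) \<longleftrightarrow> i < p \<and> P i" for P
    using i reaches_unique[OF i] by blast
  have "q \<in> {1..length u}" if "i < q" "q < p" for q
    using assms that by auto
  then show ?thesis
    using assms unfolding reaches.simps the_i less_i by blast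
qed auto

lemma reaches_Prv_iff:
  assumes "p \<in> {1..length u}"
  shows "reaches u (Prv b r) p \<longleftrightarrow> u ! (p - 1) = b \<and> (\<exists>i. reaches u r i \<and> p < i) \<and>
    \<not> (\<exists>q\<in>{1..length u}. p < q \<and> u ! (q - 1) = b \<and> (\<exists>i. reaches u r i \<and> q < i))"
proof (cases "\<exists>i. reaches u r i")
  case True
  then obtain i where i: "reaches u r i" by blast
  have the_i: "(\<exists>j. reaches u r j \<and> P j) \<longleftrightarrow> P i" for P
    using i reaches_unique[OF i] by blast
  have greater_i: "(\<exists>j>p. reaches u r j \<and> P j) \<longleftrightarrow> p < i \<and> P i" for P
    using i reaches_unique[OF i] by blast
  have "q \<in> {1..length u}" if "p < q" "q < i" for q
    using assms that reaches_le[OF i] by auto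
  then show ?thesis
    using assms unfolding reaches.simps the_i greater_i by blast
qed auto

lemma expressible_reaches_FO2:
  fixes A :: "'a set"
  assumes "set_ranker r \<subseteq> A \<times> {..<n}" "x \<in> {0, 1}"
  shows "expressible A (FO2_less_MOD A) {x} (\<lambda>w v. reaches (coloured n w) r (v x))"
  using assms
proof (induction r arbitrary: x)
  case Start
  show ?case
    by (rule expressible_False[OF positive_fragment_FO2]) auto
next
  case End
  show ?case
    by (rule expressible_False[OF positive_fragment_FO2]) auto
next
  case (Nxt b r)
  let ?F = "FO2_less_MOD A"
  note FO2 = positive_fragment_FO2
  have b: "b \<in> A \<times> {..<n}" using Nxt.prems(1) by simp
  have ex: "Ex y \<phi> \<in> ?F" if "\<phi> \<in> ?F" "y \<in> {0, 1}" for y \<phi>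
    using that by (auto simp: FO2_less_MOD_def)
  have less: "expressible A ?F {y, x} (\<lambda>w v. v y < v x)" if "x \<in> {0, 1}" "y \<in> {0, 1}" for x y
    using that by (intro expressibleI[of "Less y x"]) (auto simp: FO2_less_MOD_def)
  \<comment> \<open>The ranker point is held by the other variable \<open>1 - x\<close>, to which
    the induction hypothesis applies.\<close>
  have right: "expressible A ?F {x} (\<lambda>w v. \<exists>i. reaches (coloured n w) r i \<and> i < v x)"
    if x: "x \<in> {0, 1}" for x
  proof (rule expressible_ex_reaches[OF FO2])
    show "expressible A ?F {1 - x} (\<lambda>w v. reaches (coloured n w) r (v (1 - x)))"
      using Nxt.prems(1) x by (intro Nxt.IH) auto
    show "expressible A ?F (insert (1 - x) {x}) (\<lambda>w v. v (1 - x) < v x)"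
      using less[of x "1 - x"] x by auto
    show "expressible A ?F {x} (\<lambda>w v. 0 < v x)" by (rule expressible_True[OF FO2]) auto
    show "expressible A ?F {x} (\<lambda>w v. Suc (length w) < v x)" by (rule expressible_False[OF FO2]) auto
  qed (use x ex in auto)
  define y where "y = 1 - x"
  have y: "y \<in> {0, 1}" "y \<noteq> x" using Nxt.prems(2) by (auto simp: y_def)
  \<comment> \<open>The formula for the last conjunct requantifies \<open>x\<close>, while the first
    conjunct still refers to its outer value.\<close>
  have "expressible A ?F (insert y {x}) (\<lambda>w v. v y < v x \<and> coloured n w ! (v y - 1) = b \<and>
      (\<exists>i. reaches (coloured n w) r i \<and> i < v y))"
    using less[OF Nxt.prems(2) y(1)]
      expressible_mono[OF expressible_letter_FO2[OF b y(1)], of "{y, x}"]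
      expressible_mono[OF right[OF y(1)], of "{y, x}"]
    by (intro expressible_conj FO2) auto
  from expressible_ex[OF ex[OF _ y(1)] this]
  have "expressible A ?F {x} (\<lambda>w v. \<exists>q\<in>{1..length w}. q < v x \<and> coloured n w ! (q - 1) = b \<and>
      (\<exists>i. reaches (coloured n w) r i \<and> i < q))"
    using y(2) by simp
  then obtain \<phi> where \<phi>: "\<phi> \<in> ?F" "free_vars \<phi> \<subseteq> {x}"
    "\<And>w v. w \<in> lists A \<Longrightarrow> \<forall>x\<in>{x}. v x \<in> {1..length w} \<Longrightarrow> sat w v \<phi> \<longleftrightarrow>
      (\<exists>q\<in>{1..length w}. q < v x \<and> coloured n w ! (q - 1) = b \<and>
      (\<exists>i. reaches (coloured n w) r i \<and> i < q))"
    by (rule expressibleE) blast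
  have "expressible A ?F {x} (\<lambda>w v. \<not> (\<exists>q\<in>{1..length w}. q < v x \<and> coloured n w ! (q - 1) = b \<and>
      (\<exists>i. reaches (coloured n w) r i \<and> i < q)))"
    by (rule expressibleI[of "Neg \<phi>"]) (use \<phi> in \<open>auto simp: FO2_less_MOD_def\<close>)
  from expressible_conj[OF FO2 expressible_letter_FO2[OF b Nxt.prems(2)]
      expressible_conj[OF FO2 right[OF Nxt.prems(2)] this]]
  show ?case
  proof (rule expressible_cong)
    fix w :: "'a list" and v
    assume "\<forall>x\<in>{x}. v x \<in> {1..length w}"
    then have x: "v x \<in> {1..length w}" by simp
    show "coloured n w ! (v x - 1) = b \<and> (\<exists>i. reaches (coloured n w) r i \<and> i < v x) \<and>
        \<not> (\<exists>q\<in>{1..length w}. q < v x \<and> coloured n w ! (q - 1) = b \<and>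
           (\<exists>i. reaches (coloured n w) r i \<and> i < q)) \<longleftrightarrow>
        reaches (coloured n w) (Nxt b r) (v x)"
      using x by (subst reaches_Nxt_iff) simp_all
  qed
next
  case (Prv b r)
  let ?F = "FO2_less_MOD A"
  note FO2 = positive_fragment_FO2
  have b: "b \<in> A \<times> {..<n}" using Prv.prems(1) by simp
  have ex: "Ex y \<phi> \<in> ?F" if "\<phi> \<in> ?F" "y \<in> {0, 1}" for y \<phi>
    using that by (auto simp: FO2_less_MOD_def)
  have less: "expressible A ?F {y, x} (\<lambda>w v. v x < v y)" if "x \<in> {0, 1}" "y \<in> {0, 1}" for x y
    using that by (intro expressibleI[of "Less x y"]) (auto simp: FO2_less_MOD_def)
  have left: "expressible A ?F {x} (\<lambda>w v. \<exists>i. reaches (coloured n w) r i \<and> v x < i)"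
    if x: "x \<in> {0, 1}" for x
  proof (rule expressible_ex_reaches[OF FO2])
    show "expressible A ?F {1 - x} (\<lambda>w v. reaches (coloured n w) r (v (1 - x)))"
      using Prv.prems(1) x by (intro Prv.IH) auto
    show "expressible A ?F (insert (1 - x) {x}) (\<lambda>w v. v x < v (1 - x))"
      using less[of x "1 - x"] x by auto
    show "expressible A ?F {x} (\<lambda>w v. v x < 0)" by (rule expressible_False[OF FO2]) auto
    show "expressible A ?F {x} (\<lambda>w v. v x < Suc (length w))" by (rule expressible_True[OF FO2]) auto
  qed (use x ex in auto)
  define y where "y = 1 - x"
  have y: "y \<in> {0, 1}" "y \<noteq> x" using Prv.prems(2) by (auto simp: y_def)
  have "expressible A ?F (insert y {x}) (\<lambda>w v. v x < v y \<and> coloured n w ! (v y - 1) = b \<and>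
      (\<exists>i. reaches (coloured n w) r i \<and> v y < i))"
    using less[OF Prv.prems(2) y(1)]
      expressible_mono[OF expressible_letter_FO2[OF b y(1)], of "{y, x}"]
      expressible_mono[OF left[OF y(1)], of "{y, x}"]
    by (intro expressible_conj FO2) auto
  from expressible_ex[OF ex[OF _ y(1)] this]
  have "expressible A ?F {x} (\<lambda>w v. \<exists>q\<in>{1..length w}. v x < q \<and> coloured n w ! (q - 1) = b \<and>
      (\<exists>i. reaches (coloured n w) r i \<and> q < i))"
    using y(2) by simp
  then obtain \<phi> where \<phi>: "\<phi> \<in> ?F" "free_vars \<phi> \<subseteq> {x}"
    "\<And>w v. w \<in> lists A \<Longrightarrow> \<forall>x\<in>{x}. v x \<in> {1..length w} \<Longrightarrow> sat w v \<phi> \<longleftrightarrow>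
      (\<exists>q\<in>{1..length w}. v x < q \<and> coloured n w ! (q - 1) = b \<and>
      (\<exists>i. reaches (coloured n w) r i \<and> q < i))"
    by (rule expressibleE) blast
  have "expressible A ?F {x} (\<lambda>w v. \<not> (\<exists>q\<in>{1..length w}. v x < q \<and> coloured n w ! (q - 1) = b \<and>
      (\<exists>i. reaches (coloured n w) r i \<and> q < i)))"
    by (rule expressibleI[of "Neg \<phi>"]) (use \<phi> in \<open>auto simp: FO2_less_MOD_def\<close>)
  from expressible_conj[OF FO2 expressible_letter_FO2[OF b Prv.prems(2)]
      expressible_conj[OF FO2 left[OF Prv.prems(2)] this]]
  show ?case
  proof (rule expressible_cong)
    fix w :: "'a list" and v
    assume "\<forall>x\<in>{x}. v x \<in> {1..length w}"
    then have x: "v x \<in> {1..length w}" by simp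
    show "coloured n w ! (v x - 1) = b \<and> (\<exists>i. reaches (coloured n w) r i \<and> v x < i) \<and>
        \<not> (\<exists>q\<in>{1..length w}. v x < q \<and> coloured n w ! (q - 1) = b \<and>
           (\<exists>i. reaches (coloured n w) r i \<and> q < i)) \<longleftrightarrow>
        reaches (coloured n w) (Prv b r) (v x)"
      using x by (subst reaches_Prv_iff) simp_all
  qed
qed

lemma expressible_leq:
  assumes "x \<in> X" "y \<in> X"
  shows "expressible A (universal_formulas A) X (\<lambda>w v. v x \<le> v y)"
  using assms
  by (intro expressibleI[of "Disj (Eq x y) (Less x y)"]) (auto simp: universal_formulas_def)

lemma expressible_avoids_letter:
  assumes "finite A" "b \<in> A \<times> {..<n}" "z \<notin> X"
    and Q: "expressible A (universal_formulas A) (insert z X) (\<lambda>w v. Q w v (v z))"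
    and fresh: "\<And>w v p q. Q w (v(z := p)) q \<longleftrightarrow> Q w v q"
  shows "expressible A (Sigma2_less_MOD A) X
    (\<lambda>w v. \<forall>q\<in>{1..length w}. Q w v q \<or> coloured n w ! (q - 1) \<noteq> b)"
proof -
  have "expressible A (universal_formulas A) (insert z X)
      (\<lambda>w v. Q w v (v z) \<or> coloured n w ! (v z - 1) \<noteq> b)"
    by (intro expressible_disj positive_fragment_universal Q
        expressible_mono[OF expressible_not_letter[OF assms(1,2)]]) auto
  then have "expressible A (universal_formulas A) X
      (\<lambda>w v. \<forall>q\<in>{1..length w}. Q w (v(z := q)) ((v(z := q)) z) \<or> coloured n w ! ((v(z := q)) z - 1) \<noteq> b)"
    by (intro expressible_all) (simp_all add: universal_formulas_def)
  then show ?thesis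
    by (rule expressible_mono) (auto simp: fresh universal_formulas_subset[THEN subsetD])
qed

lemma Sigma2_Ex: "\<phi> \<in> Sigma2_less_MOD A \<Longrightarrow> Ex y \<phi> \<in> Sigma2_less_MOD A"
  by (simp add: Sigma2_iff)

text \<open>With fresh variables available the gap is described directly by one universal
  quantifier. The recursive formula for the shorter ranker stands beside it and not beneath it, so
  no further alternation arises.\<close>

lemma expressible_reaches_Sigma2:
  fixes A :: "'a set"
  assumes "finite A" "set_ranker r \<subseteq> A \<times> {..<n}"
  shows "expressible A (Sigma2_less_MOD A) {x} (\<lambda>w v. reaches (coloured n w) r (v x))"
  using assms(2)
proof (induction r arbitrary: x)
  case Start
  show ?case by (rule expressible_False[OF positive_fragment_Sigma2]) auto
next
  case End
  show ?case by (rule expressible_False[OF positive_fragment_Sigma2]) auto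
next
  case (Nxt b r)
  let ?F = "Sigma2_less_MOD A"
  have b: "b \<in> A \<times> {..<n}" using Nxt.prems by simp
  \<comment> \<open>\<open>y\<close> holds the point of the shorter ranker, \<open>z\<close> runs
    through the gap.\<close>
  define y z where "y = Suc x" "z = Suc (Suc x)"
  have r: "expressible A ?F {y} (\<lambda>w v. reaches (coloured n w) r (v y))"
    using Nxt by simp
  have "expressible A ?F {x} (\<lambda>w v. \<exists>i. reaches (coloured n w) r i \<and>
      (i < v x \<and> (\<forall>q\<in>{1..length w}. (q \<le> i \<or> v x \<le> q) \<or> coloured n w ! (q - 1) \<noteq> b)))"
  proof (rule expressible_ex_reaches[OF positive_fragment_Sigma2 Sigma2_Ex r])
    have "expressible A ?F {x}
        (\<lambda>w v. \<forall>q\<in>{1..length w}. (v x \<le> q) \<or> coloured n w ! (q - 1) \<noteq> b)"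
      by (rule expressible_avoids_letter[OF assms(1) b, of z])
        (auto simp: y_z_def intro: expressible_leq)
    then show "expressible A ?F {x} (\<lambda>w v. 0 < v x \<and>
        (\<forall>q\<in>{1..length w}. (q \<le> 0 \<or> v x \<le> q) \<or> coloured n w ! (q - 1) \<noteq> b))"
      by (rule expressible_cong) force
    show "expressible A ?F {x} (\<lambda>w v. Suc (length w) < v x \<and>
        (\<forall>q\<in>{1..length w}. (q \<le> Suc (length w) \<or> v x \<le> q) \<or> coloured n w ! (q - 1) \<noteq> b))"
      by (rule expressible_False[OF positive_fragment_Sigma2]) auto
    have "expressible A ?F (insert y {x}) (\<lambda>w v. v y < v x)"
      by (rule expressibleI[of "Less y x"]) (auto simp: Sigma2_iff)
    moreover have "expressible A ?F (insert y {x})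
        (\<lambda>w v. \<forall>q\<in>{1..length w}. (q \<le> v y \<or> v x \<le> q) \<or> coloured n w ! (q - 1) \<noteq> b)"
      by (rule expressible_avoids_letter[OF assms(1) b, of z])
        (auto simp: y_z_def intro!: expressible_leq expressible_disj positive_fragment_universal)
    ultimately show "expressible A ?F (insert y {x}) (\<lambda>w v. v y < v x \<and>
        (\<forall>q\<in>{1..length w}. (q \<le> v y \<or> v x \<le> q) \<or> coloured n w ! (q - 1) \<noteq> b))"
      by (intro expressible_conj positive_fragment_Sigma2)
  qed (auto simp: y_z_def)
  from expressible_conj[OF positive_fragment_Sigma2 expressible_letter_Sigma2[OF b] this]
  show ?case
  proof (rule expressible_cong)
    fix w :: "'a list" and v
    assume "\<forall>x\<in>{x}. v x \<in> {1..length w}"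
    then have x: "v x \<in> {1..length w}" by simp
    have gap: "(\<forall>q\<in>{1..length w}. (q \<le> i \<or> v x \<le> q) \<or> coloured n w ! (q - 1) \<noteq> b) \<longleftrightarrow>
        (\<forall>q. i < q \<and> q < v x \<longrightarrow> coloured n w ! (q - 1) \<noteq> b)" for i
    proof -
      have "q \<in> {1..length w}" if "i < q" "q < v x" for q using x that by auto
      then show ?thesis by (metis not_le)
    qed
    show "coloured n w ! (v x - 1) = b \<and> (\<exists>i. reaches (coloured n w) r i \<and> (i < v x \<and>
        (\<forall>q\<in>{1..length w}. (q \<le> i \<or> v x \<le> q) \<or> coloured n w ! (q - 1) \<noteq> b))) \<longleftrightarrow>
        reaches (coloured n w) (Nxt b r) (v x)"
      unfolding gap reaches.simps using x by auto
  qed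
next
  case (Prv b r)
  let ?F = "Sigma2_less_MOD A"
  have b: "b \<in> A \<times> {..<n}" using Prv.prems by simp
  define y z where "y = Suc x" "z = Suc (Suc x)"
  have r: "expressible A ?F {y} (\<lambda>w v. reaches (coloured n w) r (v y))"
    using Prv by simp
  have "expressible A ?F {x} (\<lambda>w v. \<exists>i. reaches (coloured n w) r i \<and>
      (v x < i \<and> (\<forall>q\<in>{1..length w}. (i \<le> q \<or> q \<le> v x) \<or> coloured n w ! (q - 1) \<noteq> b)))"
  proof (rule expressible_ex_reaches[OF positive_fragment_Sigma2 Sigma2_Ex r])
    have "expressible A ?F {x}
        (\<lambda>w v. \<forall>q\<in>{1..length w}. (q \<le> v x) \<or> coloured n w ! (q - 1) \<noteq> b)"
      by (rule expressible_avoids_letter[OF assms(1) b, of z])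
        (auto simp: y_z_def intro: expressible_leq)
    then show "expressible A ?F {x} (\<lambda>w v. v x < Suc (length w) \<and>
        (\<forall>q\<in>{1..length w}. (Suc (length w) \<le> q \<or> q \<le> v x) \<or> coloured n w ! (q - 1) \<noteq> b))"
      by (rule expressible_cong) force
    show "expressible A ?F {x} (\<lambda>w v. v x < 0 \<and>
        (\<forall>q\<in>{1..length w}. (0 \<le> q \<or> q \<le> v x) \<or> coloured n w ! (q - 1) \<noteq> b))"
      by (rule expressible_False[OF positive_fragment_Sigma2]) auto
    have "expressible A ?F (insert y {x}) (\<lambda>w v. v x < v y)"
      by (rule expressibleI[of "Less x y"]) (auto simp: Sigma2_iff)
    moreover have "expressible A ?F (insert y {x})
        (\<lambda>w v. \<forall>q\<in>{1..length w}. (v y \<le> q \<or> q \<le> v x) \<or> coloured n w ! (q - 1) \<noteq> b)"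
      by (rule expressible_avoids_letter[OF assms(1) b, of z])
        (auto simp: y_z_def intro!: expressible_leq expressible_disj positive_fragment_universal)
    ultimately show "expressible A ?F (insert y {x}) (\<lambda>w v. v x < v y \<and>
        (\<forall>q\<in>{1..length w}. (v y \<le> q \<or> q \<le> v x) \<or> coloured n w ! (q - 1) \<noteq> b))"
      by (intro expressible_conj positive_fragment_Sigma2)
  qed (auto simp: y_z_def)
  from expressible_conj[OF positive_fragment_Sigma2 expressible_letter_Sigma2[OF b] this]
  show ?case
  proof (rule expressible_cong)
    fix w :: "'a list" and v
    assume "\<forall>x\<in>{x}. v x \<in> {1..length w}"
    then have x: "v x \<in> {1..length w}" by simp
    have gap: "(\<forall>q\<in>{1..length w}. (i \<le> q \<or> q \<le> v x) \<or> coloured n w ! (q - 1) \<noteq> b) \<longleftrightarrow>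
        (\<forall>q. v x < q \<and> q < i \<longrightarrow> coloured n w ! (q - 1) \<noteq> b)"
      if "reaches (coloured n w) r i" for i
    proof -
      have "q \<in> {1..length w}" if "v x < q" "q < i" for q
        using x that reaches_le[OF \<open>reaches (coloured n w) r i\<close>] by auto
      then show ?thesis by (metis not_le)
    qed
    show "coloured n w ! (v x - 1) = b \<and> (\<exists>i. reaches (coloured n w) r i \<and> (v x < i \<and>
        (\<forall>q\<in>{1..length w}. (i \<le> q \<or> q \<le> v x) \<or> coloured n w ! (q - 1) \<noteq> b))) \<longleftrightarrow>
        reaches (coloured n w) (Prv b r) (v x)"
      unfolding reaches.simps using x gap by (metis length_coloured)
  qed
qed

text \<open>Undefinedness in positive form: some instruction is the first to fail, and its failure
  is a universal condition relative to an existing point. This keeps undefinedness within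
  \<open>\<Sigma>\<^sub>2\<close>.\<close>

lemma reaches_Nxt_undefined:
  "\<not> (\<exists>p. reaches u (Nxt b r) p) \<longleftrightarrow> \<not> (\<exists>i. reaches u r i) \<or>
    (\<exists>i. reaches u r i \<and> (\<forall>q\<in>{1..length u}. q \<le> i \<or> u ! (q - 1) \<noteq> b))"
proof
  assume *: "\<not> (\<exists>p. reaches u (Nxt b r) p)"
  have "q \<le> i \<or> u ! (q - 1) \<noteq> b" if "reaches u r i" "q \<in> {1..length u}" for i q
    using * that reaches_Nxt_ex[of u r i q] by (metis not_le)
  then show "\<not> (\<exists>i. reaches u r i) \<or>
    (\<exists>i. reaches u r i \<and> (\<forall>q\<in>{1..length u}. q \<le> i \<or> u ! (q - 1) \<noteq> b))" by blast
next
  assume *: "\<not> (\<exists>i. reaches u r i) \<or>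
    (\<exists>i. reaches u r i \<and> (\<forall>q\<in>{1..length u}. q \<le> i \<or> u ! (q - 1) \<noteq> b))"
  show "\<not> (\<exists>p. reaches u (Nxt b r) p)"
  proof
    assume "\<exists>p. reaches u (Nxt b r) p"
    then obtain p i where p: "p \<in> {1..length u}" "u ! (p - 1) = b" "i < p" "reaches u r i" by auto
    with * show False using reaches_unique[OF p(4)] not_le by blast
  qed
qed

lemma reaches_Prv_undefined:
  "\<not> (\<exists>p. reaches u (Prv b r) p) \<longleftrightarrow> \<not> (\<exists>i. reaches u r i) \<or>
    (\<exists>i. reaches u r i \<and> (\<forall>q\<in>{1..length u}. i \<le> q \<or> u ! (q - 1) \<noteq> b))"
proof
  assume *: "\<not> (\<exists>p. reaches u (Prv b r) p)"
  have "i \<le> q \<or> u ! (q - 1) \<noteq> b" if "reaches u r i" "q \<in> {1..length u}" for i q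
    using * that reaches_Prv_ex[of u r i q] by (metis not_le)
  then show "\<not> (\<exists>i. reaches u r i) \<or>
    (\<exists>i. reaches u r i \<and> (\<forall>q\<in>{1..length u}. i \<le> q \<or> u ! (q - 1) \<noteq> b))" by blast
next
  assume *: "\<not> (\<exists>i. reaches u r i) \<or>
    (\<exists>i. reaches u r i \<and> (\<forall>q\<in>{1..length u}. i \<le> q \<or> u ! (q - 1) \<noteq> b))"
  show "\<not> (\<exists>p. reaches u (Prv b r) p)"
  proof
    assume "\<exists>p. reaches u (Prv b r) p"
    then obtain p i where p: "p \<in> {1..length u}" "u ! (p - 1) = b" "p < i" "reaches u r i" by auto
    with * show False using reaches_unique[OF p(4)] not_le by blast
  qed
qed

lemma expressible_undefined_Sigma2:
  fixes A :: "'a set"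
  assumes "finite A" "set_ranker r \<subseteq> A \<times> {..<n}"
  shows "expressible A (Sigma2_less_MOD A) {} (\<lambda>w v. \<not> (\<exists>p. reaches (coloured n w) r p))"
  using assms(2)
proof (induction r)
  case Start
  show ?case by (rule expressible_False[OF positive_fragment_Sigma2]) auto
next
  case End
  show ?case by (rule expressible_False[OF positive_fragment_Sigma2]) auto
next
  case (Nxt b r)
  let ?F = "Sigma2_less_MOD A"
  have b: "b \<in> A \<times> {..<n}" using Nxt.prems by simp
  have r: "expressible A ?F {0} (\<lambda>w v. reaches (coloured n w) r (v 0))"
    using Nxt.prems by (intro expressible_reaches_Sigma2 assms(1)) simp
  have "expressible A ?F {} (\<lambda>w v. \<exists>i. reaches (coloured n w) r i \<and>
      (\<forall>q\<in>{1..length w}. q \<le> i \<or> coloured n w ! (q - 1) \<noteq> b))"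
  proof (rule expressible_ex_reaches[OF positive_fragment_Sigma2 Sigma2_Ex r])
    show "expressible A ?F {}
        (\<lambda>w v. \<forall>q\<in>{1..length w}. q \<le> 0 \<or> coloured n w ! (q - 1) \<noteq> b)"
      by (rule expressible_avoids_letter[OF assms(1) b, of 1])
        (auto intro: expressible_False positive_fragment_universal)
    show "expressible A ?F {}
        (\<lambda>w v. \<forall>q\<in>{1..length w}. q \<le> Suc (length w) \<or> coloured n w ! (q - 1) \<noteq> b)"
      by (rule expressible_True[OF positive_fragment_Sigma2]) auto
    show "expressible A ?F (insert 0 {})
        (\<lambda>w v. \<forall>q\<in>{1..length w}. q \<le> v 0 \<or> coloured n w ! (q - 1) \<noteq> b)"
      by (rule expressible_avoids_letter[OF assms(1) b, of 1]) (auto intro: expressible_leq)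
  qed auto
  then have "expressible A ?F {} (\<lambda>w v. \<not> (\<exists>i. reaches (coloured n w) r i) \<or>
      (\<exists>i. reaches (coloured n w) r i \<and> (\<forall>q\<in>{1..length w}. q \<le> i \<or> coloured n w ! (q - 1) \<noteq> b)))"
    using Nxt by (intro expressible_disj positive_fragment_Sigma2) auto
  then show ?case unfolding reaches_Nxt_undefined length_coloured .
next
  case (Prv b r)
  let ?F = "Sigma2_less_MOD A"
  have b: "b \<in> A \<times> {..<n}" using Prv.prems by simp
  have r: "expressible A ?F {0} (\<lambda>w v. reaches (coloured n w) r (v 0))"
    using Prv.prems by (intro expressible_reaches_Sigma2 assms(1)) simp
  have "expressible A ?F {} (\<lambda>w v. \<exists>i. reaches (coloured n w) r i \<and>
      (\<forall>q\<in>{1..length w}. i \<le> q \<or> coloured n w ! (q - 1) \<noteq> b))"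
  proof (rule expressible_ex_reaches[OF positive_fragment_Sigma2 Sigma2_Ex r])
    show "expressible A ?F {}
        (\<lambda>w v. \<forall>q\<in>{1..length w}. 0 \<le> q \<or> coloured n w ! (q - 1) \<noteq> b)"
      by (rule expressible_True[OF positive_fragment_Sigma2]) auto
    show "expressible A ?F {}
        (\<lambda>w v. \<forall>q\<in>{1..length w}. Suc (length w) \<le> q \<or> coloured n w ! (q - 1) \<noteq> b)"
      by (rule expressible_avoids_letter[OF assms(1) b, of 1])
        (auto intro: expressible_False positive_fragment_universal)
    show "expressible A ?F (insert 0 {})
        (\<lambda>w v. \<forall>q\<in>{1..length w}. v 0 \<le> q \<or> coloured n w ! (q - 1) \<noteq> b)"
      by (rule expressible_avoids_letter[OF assms(1) b, of 1]) (auto intro: expressible_leq)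
  qed auto
  then have "expressible A ?F {} (\<lambda>w v. \<not> (\<exists>i. reaches (coloured n w) r i) \<or>
      (\<exists>i. reaches (coloured n w) r i \<and> (\<forall>q\<in>{1..length w}. i \<le> q \<or> coloured n w ! (q - 1) \<noteq> b)))"
    using Prv by (intro expressible_disj positive_fragment_Sigma2) auto
  then show ?case unfolding reaches_Prv_undefined length_coloured .
qed

text \<open>The order fails because a ranker is undefined or because both exist with the second not
  to the right of the first. By uniqueness of ranker points the latter is again an existential
  statement, so no negation remains.\<close>

lemma expressible_not_before_Sigma2:
  assumes "finite A" "set_ranker r \<subseteq> A \<times> {..<n}" "set_ranker s \<subseteq> A \<times> {..<n}"
  shows "expressible A (Sigma2_less_MOD A) {} (\<lambda>w v. \<not> before (coloured n w) r s)"
proof -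
  let ?F = "Sigma2_less_MOD A"
  note S2 = positive_fragment_Sigma2
  note r = expressible_reaches_Sigma2[OF assms(1,2), of 0]
  note s = expressible_reaches_Sigma2[OF assms(1,3), of 1]
  have "expressible A ?F {} (\<lambda>w v. \<exists>i. reaches (coloured n w) r i \<and>
      (\<exists>j. reaches (coloured n w) s j \<and> j \<le> i))"
  proof (rule expressible_ex_reaches[OF S2 Sigma2_Ex r])
    show "expressible A ?F {} (\<lambda>w v. \<exists>j. reaches (coloured n w) s j \<and> j \<le> 0)"
      by (rule expressible_ex_reaches[OF S2 Sigma2_Ex s])
        (auto intro: expressible_True expressible_False S2)
    show "expressible A ?F {} (\<lambda>w v. \<exists>j. reaches (coloured n w) s j \<and> j \<le> Suc (length w))"
      by (rule expressible_ex_reaches[OF S2 Sigma2_Ex s])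
        (auto intro: expressible_True S2)
    show "expressible A ?F (insert 0 {}) (\<lambda>w v. \<exists>j. reaches (coloured n w) s j \<and> j \<le> v 0)"
    proof (rule expressible_ex_reaches[OF S2 Sigma2_Ex s])
      show "expressible A ?F {1, 0} (\<lambda>w v. v 1 \<le> v 0)"
        by (rule expressible_mono[OF expressible_leq[of 1 "{1, 0}" 0] _ universal_formulas_subset]) auto
    qed (auto intro: expressible_True expressible_False S2)
  qed auto
  then have "expressible A ?F {} (\<lambda>w v. \<not> (\<exists>i. reaches (coloured n w) r i) \<or>
      \<not> (\<exists>j. reaches (coloured n w) s j) \<or>
      (\<exists>i. reaches (coloured n w) r i \<and> (\<exists>j. reaches (coloured n w) s j \<and> j \<le> i)))"
    by (intro expressible_disj S2 expressible_undefined_Sigma2 assms)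
  then show ?thesis
  proof (rule expressible_cong)
    fix w
    show "\<not> (\<exists>i. reaches (coloured n w) r i) \<or> \<not> (\<exists>j. reaches (coloured n w) s j) \<or>
      (\<exists>i. reaches (coloured n w) r i \<and> (\<exists>j. reaches (coloured n w) s j \<and> j \<le> i)) \<longleftrightarrow>
      \<not> before (coloured n w) r s"
    proof (cases "(\<exists>i. reaches (coloured n w) r i) \<and> (\<exists>j. reaches (coloured n w) s j)")
      case True
      then obtain i j where i: "reaches (coloured n w) r i" and j: "reaches (coloured n w) s j" by blast
      have "before (coloured n w) r s \<longleftrightarrow> i < j"
        unfolding before_def using i j reaches_unique[OF i] reaches_unique[OF j] by blast
      moreover have "(\<exists>i. reaches (coloured n w) r i \<and> (\<exists>j. reaches (coloured n w) s j \<and> j \<le> i)) \<longleftrightarrow> j \<le> i"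
        using i j reaches_unique[OF i] reaches_unique[OF j] by blast
      ultimately show ?thesis using i j not_le by blast
    qed (auto simp: before_def)
  qed
qed

lemma sat_Len: "j < n \<Longrightarrow> sat w v (Len n (int j)) \<longleftrightarrow> length w mod n = j"
  unfolding sat.simps cong_int_iff by (simp add: cong_def)

lemma expressible_length:
  assumes "j < n" "Len n (int j) \<in> F"
  shows "expressible A F X (\<lambda>w v. length w mod n = j)"
  using assms by (intro expressibleI[of "Len n (int j)"]) (simp_all add: sat_Len del: sat.simps)

lemma expressible_not_length:
  assumes "0 < n" "\<And>js. disjs (map (\<lambda>j. Len n (int j)) js) \<in> F"
  shows "expressible A F X (\<lambda>w v. length w mod n \<noteq> j)"
proof (rule expressibleI)
  show "disjs (map (\<lambda>j. Len n (int j)) (filter (\<lambda>i. i \<noteq> j) [0..<n])) \<in> F" by (rule assms(2))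
  fix w v
  have "(\<exists>i<n. i \<noteq> j \<and> length w mod n = i) \<longleftrightarrow> length w mod n \<noteq> j"
    using assms(1) by auto
  then show "sat w v (disjs (map (\<lambda>j. Len n (int j)) (filter (\<lambda>i. i \<noteq> j) [0..<n]))) \<longleftrightarrow>
      length w mod n \<noteq> j"
    by (auto simp: sat_Len simp del: sat.simps)
qed simp

section \<open>The two characterizations coincide\<close>

text \<open>One direction suffices because the underlying relation on words is symmetric.\<close>

definition ranker_saturated :: "'a set \<Rightarrow> nat \<Rightarrow> nat \<Rightarrow> 'a list set \<Rightarrow> bool" where
  "ranker_saturated A n m L \<longleftrightarrow> (\<forall>u\<in>lists A. \<forall>w\<in>lists A. [length u = length w] (mod n) \<longrightarrow>
     ranker_equiv (A \<times> {..<n}) m (coloured n u) (coloured n w) \<longrightarrow> u \<in> L \<longrightarrow> w \<in> L)"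

lemma ranker_saturated_complement: "ranker_saturated A n m L \<Longrightarrow> ranker_saturated A n m (lists A - L)"
  unfolding ranker_saturated_def using ranker_equiv_sym cong_sym by blast

lemma ranker_saturated_expressible:
  assumes "positive_fragment F" "finite A" "0 < n" "ranker_saturated A n m L"
    and before: "\<And>r s. set_ranker r \<subseteq> A \<times> {..<n} \<Longrightarrow> set_ranker s \<subseteq> A \<times> {..<n} \<Longrightarrow>
      expressible A F {} (\<lambda>w v. before (coloured n w) r s) \<and>
      expressible A F {} (\<lambda>w v. \<not> before (coloured n w) r s)"
    and length: "\<And>j. j < n \<Longrightarrow> Len n (int j) \<in> F"
      "\<And>js. disjs (map (\<lambda>j. Len n (int j)) js) \<in> F"
  shows "expressible A F {} (\<lambda>w v. w \<in> L)"
proof -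
  let ?B = "A \<times> {..<n}"
  \<comment> \<open>A finite alphabet has finitely many rankers of bounded depth, hence finitely
    many order tests, besides the \<open>n\<close> residues of the length.\<close>
  define T where "T = (\<lambda>(r, s) w. before (coloured n w) r s) ` (rankers ?B m \<times> rankers ?B m)
    \<union> (\<lambda>j w. length w mod n = j) ` {..<n}"
  show ?thesis
  proof (rule expressible_saturated[OF assms(1), of T])
    show "finite T" using finite_rankers[of ?B m] assms(2) by (simp add: T_def)
    have "expressible A F {} (\<lambda>w v. t w) \<and> expressible A F {} (\<lambda>w v. \<not> t w)" if "t \<in> T" for t
    proof -
      from that consider r s where "r \<in> rankers ?B m" "s \<in> rankers ?B m" "t = (\<lambda>w. before (coloured n w) r s)"
        | j where "j < n" "t = (\<lambda>w. length w mod n = j)"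
        unfolding T_def by blast
      then show ?thesis
      proof cases
        case 1
        with before set_ranker_subset show ?thesis by blast
      next
        case 2
        then show ?thesis
          using expressible_length[OF _ length(1)] expressible_not_length[OF assms(3) length(2)] by blast
      qed
    qed
    then show "expressible A F {} (\<lambda>w v. t w)" "expressible A F {} (\<lambda>w v. \<not> t w)" if "t \<in> T" for t
      using that by blast+
    fix u w
    assume "u \<in> lists A" "w \<in> lists A" and T: "\<forall>t\<in>T. t u \<longleftrightarrow> t w" and "u \<in> L"
    moreover have "ranker_equiv ?B m (coloured n u) (coloured n w)"
      unfolding ranker_equiv_def
    proof (intro ballI)
      fix r s
      assume "r \<in> rankers ?B m" "s \<in> rankers ?B m"
      then have "(\<lambda>w. before (coloured n w) r s) \<in> T" by (force simp: T_def)
      from bspec[OF T this] show "before (coloured n u) r s \<longleftrightarrow> before (coloured n w) r s" by simp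
    qed
    moreover have "[length u = length w] (mod n)"
    proof -
      have "(\<lambda>w. length w mod n = length u mod n) \<in> T" using assms(3) by (auto simp: T_def)
      from bspec[OF T this] show ?thesis by (simp add: cong_def)
    qed
    ultimately show "w \<in> L" using assms(4) unfolding ranker_saturated_def by blast
  qed
qed

lemma ranker_saturated_Sigma2:
  assumes "finite A" "0 < n" "ranker_saturated A n m L" "L \<subseteq> lists A"
  shows "definable_in A (Sigma2_less_MOD A) L"
  unfolding definable_iff_expressible[OF assms(4)]
proof (rule ranker_saturated_expressible[OF positive_fragment_Sigma2 assms(1-3)])
  fix r s
  assume r: "set_ranker r \<subseteq> A \<times> {..<n}" and s: "set_ranker s \<subseteq> A \<times> {..<n}"
  have "expressible A (Sigma2_less_MOD A) {} (\<lambda>w v. before (coloured n w) r s)"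
    by (rule expressible_before[OF positive_fragment_Sigma2 Sigma2_Ex _
          expressible_reaches_Sigma2[OF assms(1) r] expressible_reaches_Sigma2[OF assms(1) s]])
      (simp_all add: Sigma2_iff)
  with expressible_not_before_Sigma2[OF assms(1) r s]
  show "expressible A (Sigma2_less_MOD A) {} (\<lambda>w v. before (coloured n w) r s) \<and>
    expressible A (Sigma2_less_MOD A) {} (\<lambda>w v. \<not> before (coloured n w) r s)" by blast
qed (use assms(2) in \<open>auto simp: Sigma2_iff intro!: universal_imp_sigma2\<close>)

lemma ranker_saturated_FO2:
  assumes "finite A" "0 < n" "ranker_saturated A n m L" "L \<subseteq> lists A"
  shows "definable_in A (FO2_less_MOD A) L"
  unfolding definable_iff_expressible[OF assms(4)]
proof (rule ranker_saturated_expressible[OF positive_fragment_FO2 assms(1-3)])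
  fix r s
  assume r: "set_ranker r \<subseteq> A \<times> {..<n}" and s: "set_ranker s \<subseteq> A \<times> {..<n}"
  have before: "expressible A (FO2_less_MOD A) {} (\<lambda>w v. before (coloured n w) r s)"
    by (rule expressible_before[OF positive_fragment_FO2 _ _
          expressible_reaches_FO2[OF r] expressible_reaches_FO2[OF s]])
      (auto simp: FO2_less_MOD_def)
  then obtain \<phi> where \<phi>: "\<phi> \<in> FO2_less_MOD A" "free_vars \<phi> \<subseteq> {}"
    "\<And>w v. w \<in> lists A \<Longrightarrow> \<forall>x\<in>{}. v x \<in> {1..length w} \<Longrightarrow>
      sat w v \<phi> \<longleftrightarrow> before (coloured n w) r s"
    by (rule expressibleE) blast
  have "expressible A (FO2_less_MOD A) {} (\<lambda>w v. \<not> before (coloured n w) r s)"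
    by (rule expressibleI[of "Neg \<phi>"]) (use \<phi> in \<open>auto simp: FO2_less_MOD_def\<close>)
  with before show "expressible A (FO2_less_MOD A) {} (\<lambda>w v. before (coloured n w) r s) \<and>
    expressible A (FO2_less_MOD A) {} (\<lambda>w v. \<not> before (coloured n w) r s)" by blast
next
  have "vars (disjs \<phi>s) = (\<Union>\<phi>\<in>set \<phi>s. vars \<phi>)" for \<phi>s :: "'a fm list"
    by (induction \<phi>s) auto
  then show "disjs (map (\<lambda>j. Len n (int j)) js) \<in> FO2_less_MOD A" for js
    using assms(2) by (simp add: FO2_less_MOD_def)
qed (use assms(2) in \<open>simp add: FO2_less_MOD_def\<close>)

lemma FO2_ranker_saturated:
  assumes "definable_in A (FO2_less_MOD A) L"
  obtains n m where "0 < n" "ranker_saturated A n m L"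
proof -
  from assms obtain \<phi> where \<phi>: "\<phi> \<in> FO2_less_MOD A" "sentence \<phi>" "L = {u \<in> lists A. models u \<phi>}"
    unfolding definable_in_def by blast
  then have over: "formula_over A \<phi>" "vars \<phi> \<subseteq> {0, 1}" by (simp_all add: FO2_less_MOD_def)
  then obtain n where n: "0 < n" "moduli_dvd n \<phi>" using common_modulus by blast
  have "ranker_saturated A n (depth \<phi>) L"
    unfolding ranker_saturated_def
  proof (intro ballI impI)
    fix u w
    assume uw: "u \<in> lists A" "w \<in> lists A" "[length u = length w] (mod n)"
      "ranker_equiv (A \<times> {..<n}) (depth \<phi>) (coloured n u) (coloured n w)" "u \<in> L"
    have "pebbles_equiv A n (depth \<phi>) (free_vars \<phi>) u v w v" for v
      using \<phi>(2) by (simp add: pebbles_equiv_def)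
    then have "sat u v \<phi> \<longleftrightarrow> sat w v \<phi>" for v
      using FO2_invariant[OF n(1) uw(1-3) n(2) over(2) order_refl uw(4)] by blast
    with uw(2,5) \<phi>(3) show "w \<in> L" by (simp add: models_def)
  qed
  with n(1) that show thesis by blast
qed

text \<open>Two ranker-equivalent words on different sides of the language would have a common upper bound
  in the \<open>\<Sigma>\<^sub>2\<close> preorder, which would lie on both sides.\<close>

lemma Sigma2_complement_ranker_saturated:
  fixes A :: "'a set"
  assumes "finite A" "definable_in A (Sigma2_less_MOD A) L"
    and "definable_in A (Sigma2_less_MOD A) (lists A - L)"
  obtains n m where "0 < n" "ranker_saturated A n m L"
proof -
  from assms(2) obtain \<phi> where "\<phi> \<in> Sigma2_less_MOD A" "sentence \<phi>"
    "L = {u \<in> lists A. models u \<phi>}"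
    unfolding definable_in_def by blast
  then have \<phi>: "formula_over A \<phi>" "sigma2 \<phi>" "sentence \<phi>" "L = {u \<in> lists A. models u \<phi>}"
    by (simp_all add: Sigma2_iff)
  from assms(3) obtain \<psi> where "\<psi> \<in> Sigma2_less_MOD A" "sentence \<psi>"
    "lists A - L = {u \<in> lists A. models u \<psi>}"
    unfolding definable_in_def by blast
  then have \<psi>: "formula_over A \<psi>" "sigma2 \<psi>" "sentence \<psi>" "lists A - L = {u \<in> lists A. models u \<psi>}"
    by (simp_all add: Sigma2_iff)
  from \<phi>(1) \<psi>(1) have "formula_over A (Conj \<phi> \<psi>)" by simp
  then obtain n where n: "0 < n" "moduli_dvd n \<phi>" "moduli_dvd n \<psi>"
    using common_modulus by (metis moduli_dvd.simps(9))
  \<comment> \<open>Chosen so that \<open>Suc l\<close> and \<open>Suc k\<close> cover the budgets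
    of both formulas at once, the depth of each serving as slack for the other.\<close>
  define l where "l = depth \<phi> + depth \<psi> + 1"
  define k where "k = depth \<phi> + depth \<psi>"
  obtain m where m: "\<And>c (u :: ('a \<times> nat) list) v. path n c u \<Longrightarrow> path n c v \<Longrightarrow>
    [length u = length v] (mod n) \<Longrightarrow> eqv m u v \<Longrightarrow> card (set u) \<le> card (A \<times> {..<n}) \<Longrightarrow>
    upper_bounded n (Suc l) (Suc k) c u v"
    using eqv_imp_upper_bounded[OF n(1), of "card (A \<times> {..<n})" l k] by blast
  \<comment> \<open>The level beyond \<open>m\<close> is the one spent by
    \<open>ranker_equiv_imp_eqv\<close>.\<close>
  have "ranker_saturated A n (Suc m) L"
    unfolding ranker_saturated_def
  proof (intro ballI impI)
    fix u w
    assume uw: "u \<in> lists A" "w \<in> lists A" "[length u = length w] (mod n)"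
      "ranker_equiv (A \<times> {..<n}) (Suc m) (coloured n u) (coloured n w)" "u \<in> L"
    show "w \<in> L"
    proof (rule ccontr)
      assume "w \<notin> L"
      note B = set_coloured[OF n(1) uw(1)] set_coloured[OF n(1) uw(2)]
      have "card (set (coloured n u)) \<le> card (A \<times> {..<n})"
        using B(1) assms(1) by (intro card_mono) auto
      with m[OF path_coloured path_coloured _ ranker_equiv_imp_eqv[OF uw(4) B]] uw(3)
      have "upper_bounded n (Suc l) (Suc k) 1 (coloured n u) (coloured n w)" by simp
      then obtain x where x: "path n 1 x" "[length x = length u] (mod n)"
        "le (Suc l) (Suc k) (coloured n u) x" "le (Suc l) (Suc k) (coloured n w) x"
        unfolding upper_bounded_def by auto
      \<comment> \<open>Since \<open>x\<close> is a path from 1, it is the colouring of its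
        underlying word, in which formulas can be evaluated.\<close>
      define y where "y = map fst x"
      have y: "coloured n y = x" using coloured_map_fst[OF x(1)] by (simp add: y_def)
      have "set x \<subseteq> A \<times> {..<n}"
        using le_set[OF x(3)] B(1) by simp
      then have "y \<in> lists A" by (auto simp: y_def in_lists_conv_set)
      have "[length u = length y] (mod n)" "[length w = length y] (mod n)"
        using x(2) uw(3) by (auto simp: y_def intro: cong_sym cong_trans)
      moreover have "le (depth \<phi> + depth \<psi> + 2) (depth \<phi> + Suc (depth \<psi>)) (coloured n u) (coloured n y)"
        "le (depth \<psi> + depth \<phi> + 2) (depth \<psi> + Suc (depth \<phi>)) (coloured n w) (coloured n y)"
        using x(3,4) unfolding y l_def k_def by (simp_all add: add_ac)
      moreover have "models u \<phi>" "models w \<psi>"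
        using uw \<open>w \<notin> L\<close> \<phi>(4) \<psi>(4) by blast+
      ultimately have "models y \<phi>" "models y \<psi>"
        using sigma2_sentence_preserved[OF \<phi>(2) n(2) \<phi>(3)]
          sigma2_sentence_preserved[OF \<psi>(2) n(3) \<psi>(3)] by blast+
      with \<open>y \<in> lists A\<close> \<phi>(4) \<psi>(4) show False by blast
    qed
  qed
  with n(1) that show thesis by blast
qed

theorem corollary5p10:
  fixes A :: "'a set" and L :: "'a list set"
  assumes "finite A" and "L \<subseteq> lists A"
  shows "definable_in A (FO2_less_MOD A) L \<longleftrightarrow> Delta2_less_MOD_definable A L"
proof
  assume "definable_in A (FO2_less_MOD A) L"
  then obtain n m where n: "0 < n" "ranker_saturated A n m L" by (rule FO2_ranker_saturated)
  have "definable_in A (Sigma2_less_MOD A) L"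
    using ranker_saturated_Sigma2[OF assms(1) n assms(2)] .
  \<comment> \<open>Saturation passes to the complement, whose \<open>\<Sigma>\<^sub>2\<close>
    definition dualizes to a \<open>\<Pi>\<^sub>2\<close> definition of \<open>L\<close>.\<close>
  moreover have "definable_in A (Sigma2_less_MOD A) (lists A - L)"
    using ranker_saturated_Sigma2[OF assms(1) n(1) ranker_saturated_complement[OF n(2)]] by blast
  ultimately show "Delta2_less_MOD_definable A L"
    by (simp add: Delta2_less_MOD_definable_def definable_Sigma2_complement_iff[OF assms])
next
  assume "Delta2_less_MOD_definable A L"
  then have "definable_in A (Sigma2_less_MOD A) L" "definable_in A (Sigma2_less_MOD A) (lists A - L)"
    by (simp_all add: Delta2_less_MOD_definable_def definable_Sigma2_complement_iff[OF assms])
  with assms(1) obtain n m where "0 < n" "ranker_saturated A n m L"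
    by (rule Sigma2_complement_ranker_saturated)
  then show "definable_in A (FO2_less_MOD A) L"
    by (rule ranker_saturated_FO2[OF assms(1) _ _ assms(2)])
qed

end
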